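(* Let $G$ be a finite soluble group and $d$ a positive integer such that all Sylow subgroups of $G$ can be generated by $d$ elements. Then $e(G)\le e(H_{\pi,d})$, where $\pi=\pi(G)\cup\{2\}$.
   Context: $e(G)$ is the expected number of uniformly random elements of $G$, drawn independently with replacement, needed until they generate $G$; equivalently $e(G)=\sum_{n\ge0}(1-P_G(n))$ with $P_G(n)$ the probability that $n$ random elements generate $G$. $\pi(G)$ is the set of primes dividing $|G|$. For a finite set of primes $\pi$ with $2\in\pi$ and a positive integer $d$, $H_{\pi,d}=\bigl(A\rtimes\langle y\rangle\bigr)\times C_2^{d-1}$, where $A=\prod_{p\in\pi\setminus\{2\}}C_p^d$ ($C_p$ cyclic of order $p$), $\langle y\rangle\cong C_2$, and $y$ acts on $A$ by inversion: $x^y=x^{-1}$ for all $x\in A$. *)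

theory Defs
  imports "HOL-Algebra.Algebra" Complex_Main
begin

definition gen_prob :: "('a, 'b) monoid_scheme \<Rightarrow> nat \<Rightarrow> real" where
  "gen_prob G n =
     real (card {f \<in> {0..<n} \<rightarrow>\<^sub>E carrier G. generate G (f ` {0..<n}) = carrier G})
     / real (card (carrier G)) ^ n"

text \<open>Expected number of random elements needed to generate G.\<close>
definition exp_gen :: "('a, 'b) monoid_scheme \<Rightarrow> real" where
  "exp_gen G = suminf (\<lambda>n. 1 - gen_prob G n)"

definition sylow_subgroup :: "('a, 'b) monoid_scheme \<Rightarrow> nat \<Rightarrow> 'a set \<Rightarrow> bool" where
  "sylow_subgroup G p P \<longleftrightarrow> Factorial_Ring.prime p \<and> subgroup P G \<and>
     card P = p ^ multiplicity p (order G)"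

definition d_generated :: "('a, 'b) monoid_scheme \<Rightarrow> nat \<Rightarrow> 'a set \<Rightarrow> bool" where
  "d_generated G d P \<longleftrightarrow> (\<exists>S. S \<subseteq> carrier G \<and> finite S \<and> card S \<le> d \<and> generate G S = P)"

text \<open>The group H_{pi,d} = (A \<rtimes> <y>) \<times> C_2^(d-1), A = prod_{p in pi - {2}} C_p^d,
  y acting by inversion. An element is a triple (a, k, v):
  a p i \<in> Z/p for p \<in> pi - {2} prime, i < d (the A-component, 0 elsewhere),
  k \<in> {0,1} (the power of y), v i \<in> Z/2 for i < d - 1 (0 elsewhere).
  Multiplication: (a,k,v)(a',k',v') = (a + (-1)^k a', k + k', v + v').\<close>
definition H_bnd :: "nat set \<Rightarrow> nat \<Rightarrow> nat \<Rightarrow> nat \<Rightarrow> nat" where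
  "H_bnd \<pi> d p i = (if Factorial_Ring.prime p \<and> p \<in> \<pi> \<and> p \<noteq> 2 \<and> i < d then p else 1)"

definition H_vbnd :: "nat \<Rightarrow> nat \<Rightarrow> nat" where
  "H_vbnd d i = (if i < d - 1 then 2 else 1)"

definition H_carrier :: "nat set \<Rightarrow> nat \<Rightarrow> ((nat \<Rightarrow> nat \<Rightarrow> nat) \<times> nat \<times> (nat \<Rightarrow> nat)) set" where
  "H_carrier \<pi> d = {(a, k, v). (\<forall>p i. a p i < H_bnd \<pi> d p i) \<and> k < 2 \<and> (\<forall>i. v i < H_vbnd d i)}"

definition H_mult :: "nat set \<Rightarrow> nat \<Rightarrow> (nat \<Rightarrow> nat \<Rightarrow> nat) \<times> nat \<times> (nat \<Rightarrow> nat)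
    \<Rightarrow> (nat \<Rightarrow> nat \<Rightarrow> nat) \<times> nat \<times> (nat \<Rightarrow> nat) \<Rightarrow> (nat \<Rightarrow> nat \<Rightarrow> nat) \<times> nat \<times> (nat \<Rightarrow> nat)" where
  "H_mult \<pi> d x x' =
     (case x of (a, k, v) \<Rightarrow> case x' of (a', k', v') \<Rightarrow>
        (\<lambda>p i. (a p i + (if k = 0 then a' p i else H_bnd \<pi> d p i - a' p i)) mod H_bnd \<pi> d p i,
         (k + k') mod 2,
         \<lambda>i. (v i + v' i) mod H_vbnd d i))"

definition H_group :: "nat set \<Rightarrow> nat \<Rightarrow> ((nat \<Rightarrow> nat \<Rightarrow> nat) \<times> nat \<times> (nat \<Rightarrow> nat)) monoid" where
  "H_group \<pi> d = \<lparr> carrier = H_carrier \<pi> d, monoid.mult = H_mult \<pi> d, monoid.one = ((\<lambda>p i. 0), 0, (\<lambda>i. 0)) \<rparr>"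

end

theory Submission
  imports Defs "HOL-Number_Theory.Cong"
begin

text \<open>
  In fact \<open>P\<^sub>G(n) \<ge> P\<^sub>H(n)\<close> for every \<open>n\<close>.  Let \<open>N\<close> be a minimal normal subgroup of \<open>G\<close>, of order
  \<open>p\<^sup>k\<close>.  By Gaschuetz, \<open>P\<^sub>G(n) = P\<^sub>G\<^sub>/\<^sub>N(n) (1 - c / |N|\<^sup>n)\<close>, where \<open>c\<close> is the number of complements of
  \<open>N\<close>.  If \<open>N\<close> has a complement and the Sylow \<open>p\<close>-subgroup \<open>P \<ge> N\<close> is generated by \<open>m\<close> elements, then
  \<open>N\<close> is not contained in the Frattini subgroup of \<open>P\<close>, so \<open>P / N\<close> is generated by \<open>m - 1\<close> elements.
  Complements of \<open>N\<close> correspond to crossed homomorphisms \<open>G \<rightarrow> N\<close> that are the identity on \<open>N\<close>.  Such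
  a map is determined by its values on \<open>m - 1\<close> elements of \<open>P\<close> and, because the index of \<open>P\<close> is prime
  to \<open>p\<close>, by the product of its values over a transversal of \<open>P\<close>; so \<open>c \<le> |N|\<^sup>m\<close>.  The transversal is
  not needed if \<open>N\<close> is central or \<open>P = G\<close>, and then \<open>c \<le> |N|\<^sup>m\<^sup>-\<^sup>1\<close>.  By induction, for \<open>n > d\<close>,
  \<open>P\<^sub>G(n)\<close> is at least the product of the factors \<open>1 - 2\<^sup>i / 2\<^sup>n\<close> with \<open>0 \<le> i < d\<close> and
  \<open>1 - p\<^sup>i / p\<^sup>n\<close> with \<open>p\<close> odd in \<open>\<pi>\<close> and \<open>1 \<le> i \<le> d\<close>.  That product bounds \<open>P\<^sub>H(n)\<close> from above,
  because the coordinate rows of a generating tuple of \<open>H\<close> are linearly independent modulo each prime.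
\<close>

section \<open>Generating tuples\<close>

text \<open>The exponents on the two sides agree for the following reason. In \<open>G\<close>, the
  shift by one at odd primes is the price of the transversal. At \<open>p = 2\<close> it need not be
  paid: conjugation has a single non-identity element to permute in a chief factor of order 2, and
  for a factor of order \<open>2^k\<close> with \<open>k \<ge> 2\<close> the surplus
  \<open>(k - 1) * (n - m)\<close> in the exponents absorbs it as soon as \<open>n > m\<close>. In
  \<open>H\<close>, the exponent of \<open>y\<close> is a 0/1 row common to all primes. Modulo 2 it
  is one of the \<open>d\<close> rows; modulo an odd prime it stands in front of \<open>d\<close>
  further rows and is already fixed, so the choices there avoid subspaces of sizes
  \<open>p^1, ..., p^d\<close>. The delicate length is \<open>n = d\<close>. If \<open>\<pi>\<close>
  contains an odd prime, \<open>d + 1\<close> rows of length \<open>d\<close> are dependent and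
  \<open>H\<close> has no generating tuple. If not, \<open>G\<close> is a 2-group and the surplus
  may be zero; the saving then comes from \<open>P = G\<close>, where no transversal is left.
  Inequalities suffice throughout: failing lifts are only bounded by the number of complements, and
  for \<open>H\<close> independence of the rows is only a necessary condition.\<close>

definition generating_tuples :: "('a, 'b) monoid_scheme \<Rightarrow> nat \<Rightarrow> (nat \<Rightarrow> 'a) set" where
  "generating_tuples G n = {f \<in> {0..<n} \<rightarrow>\<^sub>E carrier G. generate G (f ` {0..<n}) = carrier G}"

lemma gen_prob_eq: "gen_prob G n = real (card (generating_tuples G n)) / real (order G) ^ n"
  by (simp add: gen_prob_def generating_tuples_def order_def)

lemma finite_generating_tuples:
  "finite (carrier G) \<Longrightarrow> finite (generating_tuples G n)"
  unfolding generating_tuples_def by (rule finite_subset[of _ "{0..<n} \<rightarrow>\<^sub>E carrier G"]) (auto intro: finite_PiE)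

text \<open>The exponent shift is the difference between central and non-central chief factors: the former
  have fewer complements, and chief factors of order 2 are always central.\<close>

definition prime_factor_bound :: "nat \<Rightarrow> nat \<Rightarrow> nat \<Rightarrow> real" where
  "prime_factor_bound p m n = (\<Prod>i<m. 1 - real p ^ (i + (if p = 2 then 0 else 1)) / real p ^ n)"

section \<open>Finite p-groups\<close>

text \<open>Orbit lengths are powers of \<open>p\<close>. If \<open>x\<close> were the only fixed
  point, every other orbit would have length divisible by \<open>p\<close>, and the class equation
  would leave the remainder 1.\<close>

lemma (in group_action) p_group_second_fixed_point:
  assumes p: "Factorial_Ring.prime (p::nat)" and ord: "order G = p ^ k"
    and fin: "finite E" and dvd: "p dvd card E" and x: "x \<in> E"
    and fixx: "\<And>g. g \<in> carrier G \<Longrightarrow> \<phi> g x = x"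
  shows "\<exists>y\<in>E. y \<noteq> x \<and> (\<forall>g\<in>carrier G. \<phi> g y = y)"
proof (rule ccontr)
  assume contr: "\<not> ?thesis"
  interpret G: group G using group_hom group_hom.axioms(1) by blast
  have orbx: "orbit G \<phi> x = {x}"
    using fixx G.one_closed unfolding orbit_def by force
  have "card E = (\<Sum>orb\<in>orbits G E \<phi>. \<Sum>x\<in>orb. 1)"
    using disjoint_sum[OF fin, of "\<lambda>_. 1::nat"] by simp
  also have "\<dots> = (\<Sum>orb\<in>orbits G E \<phi>. card orb)" by simp
  also have "\<dots> = card {x} + (\<Sum>orb\<in>orbits G E \<phi> - {{x}}. card orb)"
  proof (rule sum.remove)
    show "finite (orbits G E \<phi>)"
      using fin orbits_coverture finite_UnionD by metis
    show "{x} \<in> orbits G E \<phi>" using orbx x unfolding orbits_def by auto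
  qed
  finally have "card E = 1 + (\<Sum>orb\<in>orbits G E \<phi> - {{x}}. card orb)" by simp
  moreover have "p dvd (\<Sum>orb\<in>orbits G E \<phi> - {{x}}. card orb)"
  proof (rule dvd_sum)
    fix orb assume "orb \<in> orbits G E \<phi> - {{x}}"
    then obtain y where y: "y \<in> E" "orb = orbit G \<phi> y" "orb \<noteq> {x}"
      unfolding orbits_def by auto
    have "card orb dvd p ^ k"
      using orbit_stabilizer_theorem[OF y(1)] ord y(2) by (metis dvd_triv_left)
    then obtain j where j: "card orb = p ^ j"
      using p divides_primepow_nat by blast
    have "card orb \<noteq> 1"
    proof
      assume "card orb = 1"
      then obtain z where z: "orb = {z}" by (auto simp: card_1_singleton_iff)
      have "y \<in> orb" using orbit_refl y by blast
      then have "orb = {y}" using z by auto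
      then have "\<forall>g\<in>carrier G. \<phi> g y = y"
        using y(2) unfolding orbit_def by blast
      then have "y = x" using contr y(1) by blast
      then show False using y(3) \<open>orb = {y}\<close> by simp
    qed
    then have "j > 0" using j by (cases j) auto
    then show "p dvd card orb" using j by simp
  qed
  ultimately have "p dvd 1" using dvd by (metis dvd_add_left_iff)
  then show False using p by (simp add: prime_nat_iff)
qed

lemma (in group) left_mult_action_on_lcosets:
  assumes M: "subgroup M G"
  shows "group_action (G\<lparr>carrier := M\<rparr>) (lcosets M) (\<lambda>h. \<lambda>C\<in>lcosets M. h <# C)"
proof -
  have MG: "M \<subseteq> carrier G" using M by (rule subgroup.subset)
  have cos: "C \<subseteq> carrier G" if "C \<in> lcosets M" for C
    using that l_coset_subset_G[OF MG] by (auto simp: LCOSETS_def)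
  have closed: "h <# C \<in> lcosets M" if "h \<in> carrier G" "C \<in> lcosets M" for h C
    using that by (auto simp: LCOSETS_def lcos_m_assoc[OF MG])
  have bij: "bij_betw (\<lambda>C\<in>lcosets M. h <# C) (lcosets M) (lcosets M)" if h: "h \<in> carrier G" for h
    by (rule bij_betwI[where g = "\<lambda>C\<in>lcosets M. inv h <# C"])
       (use h in \<open>auto simp: closed lcos_m_assoc cos lcos_mult_one\<close>)
  have Bij: "(\<lambda>C\<in>lcosets M. h <# C) \<in> Bij (lcosets M)" if "h \<in> carrier G" for h
    using bij[OF that] by (simp add: Bij_def)
  show ?thesis
    unfolding group_action_def group_hom_def group_hom_axioms_def
  proof (intro conjI)
    show "group (G\<lparr>carrier := M\<rparr>)" using subgroup.subgroup_is_group[OF M is_group] .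
    show "group (BijGroup (lcosets M))" by (rule group_BijGroup)
    show "(\<lambda>h. \<lambda>C\<in>lcosets M. h <# C) \<in> hom (G\<lparr>carrier := M\<rparr>) (BijGroup (lcosets M))"
    proof (rule homI)
      fix g assume "g \<in> carrier (G\<lparr>carrier := M\<rparr>)"
      then show "(\<lambda>C\<in>lcosets M. g <# C) \<in> carrier (BijGroup (lcosets M))"
        using Bij MG by (auto simp: BijGroup_def)
    next
      fix g h assume "g \<in> carrier (G\<lparr>carrier := M\<rparr>)" "h \<in> carrier (G\<lparr>carrier := M\<rparr>)"
      then have gh: "g \<in> carrier G" "h \<in> carrier G" using MG by auto
      show "(\<lambda>C\<in>lcosets M. (g \<otimes>\<^bsub>G\<lparr>carrier := M\<rparr>\<^esub> h) <# C) =
        (\<lambda>C\<in>lcosets M. g <# C) \<otimes>\<^bsub>BijGroup (lcosets M)\<^esub> (\<lambda>C\<in>lcosets M. h <# C)"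
        using gh Bij
        by (auto simp: BijGroup_def compose_def fun_eq_iff lcos_m_assoc cos closed)
    qed
  qed
qed

text \<open>\<open>M\<close> acts on its left cosets by left multiplication and fixes the coset
  \<open>M\<close>. The number of cosets is divisible by \<open>p\<close>, so a second coset
  \<open>x M\<close> is fixed, which says that \<open>x\<close> normalizes \<open>M\<close>. The
  normalizer is thus larger than \<open>M\<close>, and maximality makes it the whole group.\<close>

lemma (in group) p_group_maximal_subgroup_normal:
  assumes p: "Factorial_Ring.prime (p::nat)" and ord: "order G = p ^ k"
    and M: "subgroup M G" "M \<noteq> carrier G"
    and max: "\<And>H. subgroup H G \<Longrightarrow> M \<subseteq> H \<Longrightarrow> H = M \<or> H = carrier G"
  shows "M \<lhd> G"
proof -
  have fin: "finite (carrier G)"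
    using ord p by (metis order_gt_0_iff_finite prime_gt_0_nat zero_less_power)
  have MG: "M \<subseteq> carrier G" using M by (simp add: subgroup.subset)
  have finM: "finite M" using MG fin finite_subset by blast
  let ?\<phi> = "\<lambda>h. \<lambda>C\<in>lcosets M. h <# C"
  interpret act: group_action "G\<lparr>carrier := M\<rparr>" "lcosets M" ?\<phi>
    by (rule left_mult_action_on_lcosets[OF M(1)])
  have lag: "card (lcosets M) * card M = p ^ k"
    using l_lagrange[OF fin M(1)] ord by simp
  have "card M dvd p ^ k" "card (lcosets M) dvd p ^ k" using lag by (metis dvd_triv_right dvd_triv_left)+
  then obtain j l where j: "card M = p ^ j" and l: "card (lcosets M) = p ^ l"
    using p divides_primepow_nat by meson
  have "l \<noteq> 0"
  proof
    assume "l = 0"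
    then have "card M = card (carrier G)" using lag l ord by (simp add: order_def)
    then show False using M(2) MG fin card_subset_eq by blast
  qed
  then have pd: "p dvd card (lcosets M)" using l by simp
  have Mcos: "M \<in> lcosets M" using lcos_mult_one[OF MG] by (force simp: LCOSETS_def)
  have fixM: "?\<phi> g M = M" if "g \<in> carrier (G\<lparr>carrier := M\<rparr>)" for g
  proof -
    have g: "g \<in> M" using that by simp
    have "g <# M = \<one> <# M"
      using l_repr_independence[OF _ one_closed M(1), of g] g lcos_mult_one[OF MG] by simp
    then show ?thesis using Mcos lcos_mult_one[OF MG] by simp
  qed
  have "finite (lcosets M)"
    using lcosets_subset_PowG[OF M(1)] fin finite_subset by blast
  then obtain C where C: "C \<in> lcosets M" "C \<noteq> M" "\<forall>g\<in>M. ?\<phi> g C = C"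
    using act.p_group_second_fixed_point[OF p _ _ pd Mcos fixM, of j] j by (auto simp: order_def)
  then obtain x where x: "x \<in> carrier G" "C = x <# M" by (auto simp: LCOSETS_def)
  have xM: "x \<notin> M" 
    using C(2) x fixM[of x] Mcos by auto
  have norm: "inv x \<otimes> g \<otimes> x \<in> M" if g: "g \<in> M" for g
  proof -
    have "g <# C = C" using C(1,3) g by auto
    moreover have "x \<in> C" using lcos_self x M(1) by auto
    ultimately have "g \<otimes> x \<in> C" unfolding l_coset_def[of G g] by blast
    then have "g \<otimes> x \<in> x <# M" using x(2) by simp
    then have "inv x \<otimes> (g \<otimes> x) \<in> M"
      using subgroup.lcos_module_imp[OF M(1) is_group x(1)] by auto
    then show ?thesis using g MG x(1) by (simp add: m_assoc subsetD)
  qed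
  \<comment> \<open>The normalizer of \<open>M\<close>. Equality in the definition gives closure
    under inverses; by finiteness of \<open>M\<close>, inclusion is enough to establish it.\<close>
  define T where "T = {y \<in> carrier G. (\<lambda>g. inv y \<otimes> g \<otimes> y) ` M = M}"
  have T_iff: "y \<in> T \<longleftrightarrow> y \<in> carrier G \<and> (\<forall>g\<in>M. inv y \<otimes> g \<otimes> y \<in> M)" for y
  proof
    assume y: "y \<in> carrier G \<and> (\<forall>g\<in>M. inv y \<otimes> g \<otimes> y \<in> M)"
    have "inj_on (\<lambda>g. inv y \<otimes> g \<otimes> y) M"
      using y MG by (intro inj_onI) (auto simp: subset_iff)
    then have "(\<lambda>g. inv y \<otimes> g \<otimes> y) ` M = M"
      using y finM by (intro endo_inj_surj) auto
    then show "y \<in> T" using y by (auto simp: T_def)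
  qed (auto simp: T_def)
  have T: "subgroup T G"
  proof (rule subgroupI)
    show "T \<subseteq> carrier G" by (auto simp: T_def)
    show "T \<noteq> {}" using T_iff[of \<one>] MG by (auto simp: subset_iff)
  next
    fix a assume "a \<in> T"
    then have a: "a \<in> carrier G" "(\<lambda>g. inv a \<otimes> g \<otimes> a) ` M = M" by (auto simp: T_def)
    have "a \<otimes> g \<otimes> inv a \<in> M" if "g \<in> M" for g
    proof -
      obtain h where h: "h \<in> M" "g = inv a \<otimes> h \<otimes> a" using a(2) \<open>g \<in> M\<close> by force
      then have hc: "h \<in> carrier G" using MG by auto
      have "a \<otimes> g \<otimes> inv a = h" unfolding h(2) using hc a(1)
        by (metis inv_closed m_assoc m_closed r_inv r_one inv_solve_left)
      then show ?thesis using h by simp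
    qed
    then show "inv a \<in> T" using a(1) T_iff by auto
  next
    fix a b assume ab: "a \<in> T" "b \<in> T"
    then have c: "a \<in> carrier G" "b \<in> carrier G" by (auto simp: T_def)
    have "inv (a \<otimes> b) \<otimes> g \<otimes> (a \<otimes> b) \<in> M" if "g \<in> M" for g
    proof -
      have "inv (a \<otimes> b) \<otimes> g \<otimes> (a \<otimes> b) = inv b \<otimes> (inv a \<otimes> g \<otimes> a) \<otimes> b"
        using c that MG by (simp add: inv_mult_group m_assoc subset_iff)
      then show ?thesis using ab that T_iff by auto
    qed
    then show "a \<otimes> b \<in> T" using c T_iff by auto
  qed
  have "M \<subseteq> T" using T_iff MG M(1) by (auto simp: subgroup.m_closed subgroup.m_inv_closed)
  moreover have "x \<in> T" using T_iff norm x(1) by auto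
  ultimately have "T = carrier G" using max[OF T] xM by auto
  then show ?thesis
    using normal_invI[OF M(1)] T_iff by (metis inv_closed inv_inv)
qed

lemma (in group) set_mult_generate_singleton:
  assumes I: "I \<lhd> G" and g: "g \<in> carrier G"
  shows "subgroup (I <#> generate G {g}) G" "I \<subseteq> I <#> generate G {g}" "g \<in> I <#> generate G {g}"
    and "x \<in> I <#> generate G {g} \<Longrightarrow> \<exists>a::int. \<exists>y\<in>I. x = y \<otimes> g [^] a"
proof -
  have Is: "subgroup I G" using I by (rule normal_imp_subgroup)
  show "subgroup (I <#> generate G {g}) G"
    using mult_norm_subgroup[OF I generate_is_subgroup] g by auto
  show "I \<subseteq> I <#> generate G {g}"
  proof
    fix m assume "m \<in> I"
    then have "m = m \<otimes> \<one>" using subgroup.subset[OF Is] by auto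
    then show "m \<in> I <#> generate G {g}"
      using \<open>m \<in> I\<close> generate.one unfolding set_mult_def by blast
  qed
  have "g = \<one> \<otimes> g" using g by auto
  then show "g \<in> I <#> generate G {g}"
    using subgroup.one_closed[OF Is] generate.incl[of g "{g}" G] unfolding set_mult_def by blast
  assume "x \<in> I <#> generate G {g}"
  then obtain y z where "y \<in> I" "z \<in> generate G {g}" "x = y \<otimes> z" unfolding set_mult_def by blast
  then show "\<exists>a::int. \<exists>y\<in>I. x = y \<otimes> g [^] a" using generate_pow[OF g] by auto
qed

text \<open>If \<open>g^p\<close> were outside \<open>M\<close>, then \<open>M\<close> and
  \<open>g^p\<close> would generate everything, so some \<open>g^(1 - p i)\<close> would lie in
  \<open>M\<close>. The exponent is prime to the group order, so \<open>g\<close> itself, and with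
  it \<open>g^p\<close>, would lie in \<open>M\<close>.\<close>

lemma (in group) p_group_maximal_subgroup_pow:
  assumes p: "Factorial_Ring.prime (p::nat)" and ord: "order G = p ^ k"
    and M: "subgroup M G" "M \<noteq> carrier G"
    and max: "\<And>H. subgroup H G \<Longrightarrow> M \<subseteq> H \<Longrightarrow> H = M \<or> H = carrier G"
    and g: "g \<in> carrier G"
  shows "g [^] p \<in> M"
proof (rule ccontr)
  assume ng: "g [^] p \<notin> M"
  have norm: "M \<lhd> G" by (rule p_group_maximal_subgroup_normal[OF p ord M max])
  have MG: "M \<subseteq> carrier G" using M by (simp add: subgroup.subset)
  have gpc: "g [^] p \<in> carrier G" using g by simp
  have "M <#> generate G {g [^] p} = carrier G"
    using max set_mult_generate_singleton(1-3)[OF norm gpc] ng by blast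
  then obtain m i where m: "m \<in> M" "g = m \<otimes> (g [^] p) [^] (i::int)"
    using set_mult_generate_singleton(4)[OF norm gpc, of g] g by blast
  have "g = m \<otimes> g [^] (int p * i)" using m(2) g by (metis int_pow_int int_pow_pow)
  then have "g [^] (1::int) = m \<otimes> g [^] (int p * i)" using g by simp
  moreover have "g [^] (1 - int p * i) = g [^] (1::int) \<otimes> inv (g [^] (int p * i))"
    using int_pow_diff[OF g] .
  ultimately have "g [^] (1 - int p * i) = m" using g m(1) MG
    by (metis inv_solve_right int_pow_closed subsetD)
  then have 1: "g [^] (1 - int p * i) \<in> M" using m by simp
  have 2: "g [^] (int (p ^ k)) = \<one>"
    using pow_order_eq_1[OF g] ord by (simp only: int_pow_int)
  have "coprime (1 - int p * i) (int p)"
    by (metis add.commute coprime_1_left coprime_iff_gcd_eq_1 diff_add_cancel gcd_add_mult gcd.commute mult.commute)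
  then have "coprime (1 - int p * i) (int (p ^ k))" by (simp add: coprime_power_right_iff)
  then obtain u v where uv: "(1 - int p * i) * u + int (p ^ k) * v = 1"
    by (metis bezout_int coprime_iff_gcd_eq_1 mult.commute)
  have "g = g [^] ((1 - int p * i) * u + int (p ^ k) * v)" using uv g by simp
  also have "\<dots> = (g [^] (1 - int p * i)) [^] u \<otimes> (g [^] (int (p ^ k))) [^] v"
    using g by (simp only: int_pow_mult int_pow_pow)
  also have "\<dots> = (g [^] (1 - int p * i)) [^] u" using 2 g by simp
  also have "\<dots> \<in> M" using subgroup_int_pow_closed[OF M(1) 1] .
  finally have "g \<in> M" .
  then have "g [^] p \<in> M" using M(1) subgroup_int_pow_closed[OF M(1), of g "int p"] by (simp add: int_pow_int)
  then show False using ng by simp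
qed


lemma (in group) proper_subgroup_in_maximal:
  assumes fin: "finite (carrier G)" and T: "subgroup T G" "T \<noteq> carrier G"
  obtains M where "subgroup M G" "M \<noteq> carrier G" "T \<subseteq> M"
    "\<And>H. subgroup H G \<Longrightarrow> M \<subseteq> H \<Longrightarrow> H = M \<or> H = carrier G"
proof -
  let ?A = "{M. subgroup M G \<and> M \<noteq> carrier G \<and> T \<subseteq> M}"
  have "?A \<subseteq> Pow (carrier G)" by (auto dest: subgroup.subset)
  then have "finite ?A" using fin finite_subset by blast
  moreover have "T \<in> ?A" using T by auto
  ultimately obtain M where M: "M \<in> ?A" "\<And>H. H \<in> ?A \<Longrightarrow> M \<subseteq> H \<Longrightarrow> H = M"
    using finite_has_maximal[of ?A] by (metis (no_types, lifting) empty_iff)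
  show thesis
  proof (rule that[of M])
    fix H assume "subgroup H G" "M \<subseteq> H"
    then show "H = M \<or> H = carrier G" using M(1) M(2)[of H] by blast
  qed (use M in auto)
qed

text \<open>Burnside's basis theorem in disguise: \<open>N\<close> is not contained in some maximal subgroup, so one
  generator can be traded for an element of \<open>N\<close>.\<close>

lemma (in group) p_group_drop_generator:
  assumes p: "Factorial_Ring.prime (p::nat)" and ord: "order G = p ^ k"
    and N: "N \<lhd> G" and K: "subgroup K G" "K \<noteq> carrier G" "N <#> K = carrier G"
    and S: "finite S" "S \<subseteq> carrier G" "generate G S = carrier G"
  obtains S' where "finite S'" "S' \<subseteq> carrier G" "card S' < card S" "generate G (N \<union> S') = carrier G"
proof -
  have fin: "finite (carrier G)"
    using ord p by (metis order_gt_0_iff_finite prime_gt_0_nat zero_less_power)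
  have Ns: "subgroup N G" using N by (rule normal_imp_subgroup)
  obtain M where M: "subgroup M G" "M \<noteq> carrier G" "K \<subseteq> M"
    and max: "\<And>H. subgroup H G \<Longrightarrow> M \<subseteq> H \<Longrightarrow> H = M \<or> H = carrier G"
    using proper_subgroup_in_maximal[OF fin K(1,2)] by metis
  have Mn: "M \<lhd> G" by (rule p_group_maximal_subgroup_normal[OF p ord M(1,2) max])
  obtain x where x: "x \<in> N" "x \<notin> M"
  proof -
    have "\<not> N \<subseteq> M"
    proof
      assume "N \<subseteq> M"
      then have "N <#> K \<subseteq> M" using M(1,3) unfolding set_mult_def by (auto intro: subgroup.m_closed)
      then show False using K(3) M(1,2) subgroup.subset by blast
    qed
    then show thesis using that by blast
  qed
  have "\<not> S \<subseteq> M" using generate_subgroup_incl[of S M] M(1,2) S(3) subgroup.subset by blast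
  then obtain g where g: "g \<in> S" "g \<notin> M" by blast
  then have gc: "g \<in> carrier G" using S by auto
  have "M <#> generate G {g} = carrier G"
    using max set_mult_generate_singleton(1-3)[OF Mn gc] g(2) by blast
  then have "\<exists>a::int. s \<otimes> g [^] a \<in> M" if "s \<in> S" for s
  proof -
    obtain a :: int and y where y: "y \<in> M" "s = y \<otimes> g [^] a"
      using set_mult_generate_singleton(4)[OF Mn gc, of s] \<open>s \<in> S\<close> S(2) \<open>M <#> generate G {g} = carrier G\<close> by blast
    have "s \<otimes> g [^] (- a) = y"
      unfolding y(2) using y(1) gc subgroup.mem_carrier[OF M(1)]
      by (simp add: int_pow_neg m_assoc)
    then show ?thesis using y(1) by blast
  qed
  then obtain a :: "'a \<Rightarrow> int" where a: "\<And>s. s \<in> S \<Longrightarrow> s \<otimes> g [^] (a s) \<in> M" by metis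
  \<comment> \<open>The group consists of the products of \<open>M\<close> with powers of
    \<open>g\<close>, so each generator other than \<open>g\<close> can be corrected by a power of
    \<open>g\<close> to lie in \<open>M\<close>. Together with \<open>g\<close> the corrected
    elements still generate.\<close>
  define S' where "S' = (\<lambda>s. s \<otimes> g [^] (a s)) ` (S - {g})"
  have S'c: "S' \<subseteq> carrier G" using S(2) gc by (auto simp: S'_def)
  have S'M: "S' \<subseteq> M" using a by (auto simp: S'_def)
  have gen_sub: "carrier G \<subseteq> L" if L: "subgroup L G" "g \<in> L" "S' \<subseteq> L" for L
  proof -
    have "s \<in> L" if "s \<in> S" for s
    proof (cases "s = g")
      case False
      then have "s \<otimes> g [^] (a s) \<in> L" using L(3) that by (auto simp: S'_def)
      then have "(s \<otimes> g [^] (a s)) \<otimes> inv (g [^] (a s)) \<in> L"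
        using L(1) subgroup_int_pow_closed[OF L(1,2)]
        by (metis subgroup.m_closed subgroup.m_inv_closed)
      then show ?thesis using gc that S(2) by (simp add: m_assoc subset_iff)
    qed (use L in simp)
    then have "generate G S \<subseteq> L" using generate_subgroup_incl[OF _ L(1)] by blast
    then show ?thesis using S(3) by simp
  qed
  have "generate G (N \<union> S') = carrier G"
  proof (rule ccontr)
    assume "generate G (N \<union> S') \<noteq> carrier G"
    moreover have NS: "N \<union> S' \<subseteq> carrier G" using S'c subgroup.subset[OF Ns] by auto
    ultimately obtain M' where M': "subgroup M' G" "M' \<noteq> carrier G" "generate G (N \<union> S') \<subseteq> M'"
      and max': "\<And>H. subgroup H G \<Longrightarrow> M' \<subseteq> H \<Longrightarrow> H = M' \<or> H = carrier G"
      using proper_subgroup_in_maximal[OF fin generate_is_subgroup] by metis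
    have M'n: "M' \<lhd> G" by (rule p_group_maximal_subgroup_normal[OF p ord M'(1,2) max'])
    have NSM': "N \<union> S' \<subseteq> M'" using M'(3) generate.incl[of _ "N \<union> S'" G] by blast
    have gM': "g \<notin> M'" using gen_sub[OF M'(1)] NSM' M'(1,2) subgroup.subset by blast
    have I: "M \<inter> M' \<lhd> G" using normal_subgroup_intersect[OF Mn M'n] .
    \<comment> \<open>\<open>S'\<close> lies in both maximal subgroups, so modulo
      \<open>M \<inter> M'\<close> the group is generated by \<open>g\<close> alone, and
      \<open>x\<close> becomes \<open>y g^b\<close>. Here \<open>g^b\<close> lies in
      \<open>M'\<close>, because \<open>x\<close> and \<open>y\<close> do, but not in
      \<open>M\<close>. Since \<open>g^p\<close> lies in both, \<open>p\<close> dividing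
      \<open>b\<close> would put \<open>g^b\<close> into \<open>M\<close>, and \<open>p\<close> not
      dividing \<open>b\<close> would put \<open>g\<close> into \<open>M'\<close>.\<close>
    have "x \<in> (M \<inter> M') <#> generate G {g}"
      using gen_sub[OF set_mult_generate_singleton(1)[OF I gc]] set_mult_generate_singleton(2,3)[OF I gc]
        S'M NSM' x(1) subgroup.subset[OF Ns] by blast
    then obtain b :: int and y where y: "y \<in> M" "y \<in> M'" "x = y \<otimes> g [^] b"
      using set_mult_generate_singleton(4)[OF I gc] by blast
    have gb: "g [^] b = inv y \<otimes> x"
      unfolding y(3) using y(1) gc subgroup.mem_carrier[OF M(1)] by (simp add: m_assoc[symmetric])
    have gbM': "g [^] b \<in> M'"
      unfolding gb using y x NSM' M'(1) by (auto intro: subgroup.m_closed subgroup.m_inv_closed)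
    have gbM: "g [^] b \<notin> M" using y(1,3) x(2) M(1) by (auto intro: subgroup.m_closed)
    have gpM: "g [^] (int p) \<in> M" "g [^] (int p) \<in> M'"
      using p_group_maximal_subgroup_pow[OF p ord M(1,2) max gc]
        p_group_maximal_subgroup_pow[OF p ord M'(1,2) max' gc] by (simp_all add: int_pow_int)
    show False
    proof (cases "int p dvd b")
      case True
      then obtain c where "b = int p * c" by blast
      then have "g [^] b = (g [^] (int p)) [^] c" using gc by (simp add: int_pow_pow)
      then show False using gbM gpM(1) subgroup_int_pow_closed[OF M(1)] by simp
    next
      case False
      then have "coprime (int p) b" using p by (simp add: prime_imp_coprime)
      then obtain u v where uv: "b * u + int p * v = 1"
        by (metis bezout_int coprime_iff_gcd_eq_1 mult.commute add.commute)
      have "g = g [^] (b * u + int p * v)" using uv gc by simp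
      also have "\<dots> = (g [^] b) [^] u \<otimes> (g [^] (int p)) [^] v"
        using gc by (simp only: int_pow_mult int_pow_pow)
      also have "\<dots> \<in> M'" using gbM' gpM(2) M'(1) by (metis subgroup.m_closed subgroup_int_pow_closed)
      finally show False using gM' by simp
    qed
  qed
  moreover have "card S' < card S"
  proof -
    have "card S' \<le> card (S - {g})" unfolding S'_def using S(1) by (intro card_image_le) auto
    also have "\<dots> < card S" using S(1) g(1) by (rule card_Diff1_less)
    finally show ?thesis .
  qed
  ultimately show thesis using that[of S'] S'c S(1) by (auto simp: S'_def)
qed

section \<open>Complements and crossed homomorphisms\<close>

definition crossed_homs :: "('a, 'b) monoid_scheme \<Rightarrow> 'a set \<Rightarrow> ('a \<Rightarrow> 'a) set" where
  "crossed_homs G N = {\<delta> \<in> carrier G \<rightarrow>\<^sub>E N. \<forall>g\<in>carrier G. \<forall>h\<in>carrier G.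
     \<delta> (g \<otimes>\<^bsub>G\<^esub> h) = \<delta> g \<otimes>\<^bsub>G\<^esub> (g \<otimes>\<^bsub>G\<^esub> \<delta> h \<otimes>\<^bsub>G\<^esub> inv\<^bsub>G\<^esub> g)}"

definition complements :: "('a, 'b) monoid_scheme \<Rightarrow> 'a set \<Rightarrow> 'a set set" where
  "complements G N = {K. subgroup K G \<and> K \<inter> N = {\<one>\<^bsub>G\<^esub>} \<and> N <#>\<^bsub>G\<^esub> K = carrier G}"

lemma (in group) mult_inv_cancel_left:
  assumes "g \<in> carrier G" "x \<in> carrier G"
  shows "inv g \<otimes> (g \<otimes> x) = x" "g \<otimes> (inv g \<otimes> x) = x"
  using assms by (simp_all add: m_assoc[symmetric])

locale abelian_normal = normal N G for N and G (structure) +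
  assumes N_comm: "\<lbrakk>x \<in> N; y \<in> N\<rbrakk> \<Longrightarrow> x \<otimes> y = y \<otimes> x"
begin

lemma N_carrier [simp]: "x \<in> N \<Longrightarrow> x \<in> carrier G"
  using subset by auto

lemma N_comm_group: "comm_group (G\<lparr>carrier := N\<rparr>)"
  by (rule group.group_comm_groupI[OF subgroup_is_group[OF is_group]]) (simp add: N_comm)

lemma conj_N [simp]: "\<lbrakk>g \<in> carrier G; x \<in> N\<rbrakk> \<Longrightarrow> g \<otimes> x \<otimes> inv g \<in> N"
  using inv_op_closed2 by auto

lemma conj_mult:
  "\<lbrakk>g \<in> carrier G; x \<in> carrier G; y \<in> carrier G\<rbrakk> \<Longrightarrow>
    (g \<otimes> x \<otimes> inv g) \<otimes> (g \<otimes> y \<otimes> inv g) = g \<otimes> (x \<otimes> y) \<otimes> inv g"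
  by (simp add: m_assoc mult_inv_cancel_left)

lemma N_swap: "\<lbrakk>a \<in> N; b \<in> N; c \<in> N; d \<in> N\<rbrakk> \<Longrightarrow> (a \<otimes> b) \<otimes> (c \<otimes> d) = (a \<otimes> c) \<otimes> (b \<otimes> d)"
  by (metis N_carrier N_comm m_assoc m_closed)

lemma crossed_homD:
  assumes "\<delta> \<in> crossed_homs G N"
  shows "g \<in> carrier G \<Longrightarrow> \<delta> g \<in> N"
    and "\<lbrakk>g \<in> carrier G; h \<in> carrier G\<rbrakk> \<Longrightarrow> \<delta> (g \<otimes> h) = \<delta> g \<otimes> (g \<otimes> \<delta> h \<otimes> inv g)"
  using assms unfolding crossed_homs_def by auto

lemma crossed_hom_one:
  assumes d: "\<delta> \<in> crossed_homs G N"
  shows "\<delta> \<one> = \<one>"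
proof -
  have c: "\<delta> \<one> \<in> carrier G" using crossed_homD(1)[OF d] by simp
  have "\<delta> \<one> = \<delta> \<one> \<otimes> \<delta> \<one>" using crossed_homD(2)[OF d, of \<one> \<one>] c by simp
  then show ?thesis using c by (metis l_cancel_one' )
qed

lemma crossed_hom_inv:
  assumes d: "\<delta> \<in> crossed_homs G N" and g: "g \<in> carrier G"
  shows "\<delta> (inv g) = inv g \<otimes> inv (\<delta> g) \<otimes> g"
proof -
  have c: "\<delta> g \<in> carrier G" "\<delta> (inv g) \<in> carrier G" using crossed_homD(1)[OF d] g by auto
  have "\<one> = \<delta> g \<otimes> (g \<otimes> \<delta> (inv g) \<otimes> inv g)"
    using crossed_homD(2)[OF d g, of "inv g"] crossed_hom_one[OF d] g by simp
  then have "inv (\<delta> g) = g \<otimes> \<delta> (inv g) \<otimes> inv g"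
    using c g by (metis inv_closed inv_solve_left m_closed r_one one_closed)
  then show ?thesis using c g by (simp add: m_assoc mult_inv_cancel_left)
qed

text \<open>As \<open>N\<close> is abelian, crossed homomorphisms can be divided pointwise. Whether
  two of them coincide thus becomes the question whether one of them is trivial.\<close>

lemma crossed_hom_quotient:
  assumes d: "\<delta> \<in> crossed_homs G N" and e: "\<epsilon> \<in> crossed_homs G N"
  shows "(\<lambda>g\<in>carrier G. \<delta> g \<otimes> inv (\<epsilon> g)) \<in> crossed_homs G N"
proof -
  note D = crossed_homD[OF d] and E = crossed_homD[OF e]
  have "\<delta> (g \<otimes> h) \<otimes> inv (\<epsilon> (g \<otimes> h)) = \<delta> g \<otimes> inv (\<epsilon> g) \<otimes> (g \<otimes> (\<delta> h \<otimes> inv (\<epsilon> h)) \<otimes> inv g)"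
    if g: "g \<in> carrier G" and h: "h \<in> carrier G" for g h
  proof -
    have "inv (\<epsilon> (g \<otimes> h)) = inv (g \<otimes> \<epsilon> h \<otimes> inv g) \<otimes> inv (\<epsilon> g)"
      using E g h by (simp add: inv_mult_group[of "\<epsilon> g"])
    also have "\<dots> = inv (\<epsilon> g) \<otimes> inv (g \<otimes> \<epsilon> h \<otimes> inv g)"
      using E(1) g h by (intro N_comm m_inv_closed conj_N)
    also have "inv (g \<otimes> \<epsilon> h \<otimes> inv g) = g \<otimes> inv (\<epsilon> h) \<otimes> inv g"
      using E(1)[OF h] g by (simp add: inv_mult_group m_assoc)
    finally have "\<delta> (g \<otimes> h) \<otimes> inv (\<epsilon> (g \<otimes> h)) =
       (\<delta> g \<otimes> (g \<otimes> \<delta> h \<otimes> inv g)) \<otimes> (inv (\<epsilon> g) \<otimes> (g \<otimes> inv (\<epsilon> h) \<otimes> inv g))"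
      using D(2)[OF g h] by simp
    also have "\<dots> = (\<delta> g \<otimes> inv (\<epsilon> g)) \<otimes> ((g \<otimes> \<delta> h \<otimes> inv g) \<otimes> (g \<otimes> inv (\<epsilon> h) \<otimes> inv g))"
      using D(1) E(1) g h by (intro N_swap) auto
    also have "(g \<otimes> \<delta> h \<otimes> inv g) \<otimes> (g \<otimes> inv (\<epsilon> h) \<otimes> inv g) = g \<otimes> (\<delta> h \<otimes> inv (\<epsilon> h)) \<otimes> inv g"
      using D(1)[OF h] E(1)[OF h] g by (intro conj_mult) auto
    finally show ?thesis .
  qed
  then show ?thesis using D(1) E(1) unfolding crossed_homs_def by auto
qed

lemma crossed_homs_agree_on_generate:
  assumes d: "\<delta> \<in> crossed_homs G N" and e: "\<epsilon> \<in> crossed_homs G N"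
    and S: "S \<subseteq> carrier G" "\<And>s. s \<in> S \<Longrightarrow> \<delta> s = \<epsilon> s"
    and x: "x \<in> generate G S"
  shows "\<delta> x = \<epsilon> x"
  using x
proof (induction rule: generate.induct)
  case one then show ?case using crossed_hom_one[OF d] crossed_hom_one[OF e] by simp
next
  case (incl h) then show ?case using S by simp
next
  case (inv h) then show ?case using S crossed_hom_inv[OF d, of h] crossed_hom_inv[OF e, of h] by auto
next
  case (eng g h)
  then have "g \<in> carrier G" "h \<in> carrier G" using generate_in_carrier[OF S(1)] by auto
  then show ?case using eng crossed_homD(2)[OF d] crossed_homD(2)[OF e] by simp
qed

section \<open>Products over a transversal\<close>

text \<open>The representatives are chosen independently of \<open>\<delta>\<close>, which makes
  this multiplicative in \<open>\<delta>\<close>. It is the one parameter in \<open>N\<close> that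
  records what the values on \<open>P\<close> leave open.\<close>

definition coset_prod :: "'a set \<Rightarrow> ('a \<Rightarrow> 'a) \<Rightarrow> 'a" where
  "coset_prod P \<delta> = finprod (G\<lparr>carrier := N\<rparr>) (\<lambda>C. \<delta> (SOME t. t \<in> C)) (lcosets P)"

lemma some_in_lcoset:
  assumes P: "subgroup P G" and C: "C \<in> lcosets P"
  shows "(SOME t. t \<in> C) \<in> C" "(SOME t. t \<in> C) \<in> carrier G"
proof -
  obtain a where "a \<in> carrier G" "C = a <# P" using C by (auto simp: LCOSETS_def)
  then have "a \<in> C" using lcos_self P by auto
  then show 1: "(SOME t. t \<in> C) \<in> C" by (metis someI)
  show "(SOME t. t \<in> C) \<in> carrier G" using 1 C lcosets_part_G[OF P] by blast
qed

lemma coset_prod_closed: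
  assumes "\<delta> \<in> crossed_homs G N" "subgroup P G"
  shows "coset_prod P \<delta> \<in> N"
proof -
  interpret A: comm_group "G\<lparr>carrier := N\<rparr>" by (rule N_comm_group)
  have "finprod (G\<lparr>carrier := N\<rparr>) (\<lambda>C. \<delta> (SOME t. t \<in> C)) (lcosets P) \<in> carrier (G\<lparr>carrier := N\<rparr>)"
    using assms crossed_homD(1) some_in_lcoset by (intro A.finprod_closed) auto
  then show ?thesis by (simp add: coset_prod_def)
qed

lemma finprod_twisted:
  assumes F: "finite F" and e: "\<And>C. C \<in> F \<Longrightarrow> e C \<in> N" and n: "n \<in> N" and g: "g \<in> carrier G"
  shows "finprod (G\<lparr>carrier := N\<rparr>) (\<lambda>C. n \<otimes> (g \<otimes> e C \<otimes> inv g)) F =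
    n [^] card F \<otimes> (g \<otimes> finprod (G\<lparr>carrier := N\<rparr>) e F \<otimes> inv g)"
  using F e
proof (induction F rule: finite_induct)
  case empty
  interpret A: comm_group "G\<lparr>carrier := N\<rparr>" by (rule N_comm_group)
  show ?case using g by simp
next
  case (insert C F)
  interpret A: comm_group "G\<lparr>carrier := N\<rparr>" by (rule N_comm_group)
  let ?A = "G\<lparr>carrier := N\<rparr>"
  have eF: "e \<in> F \<rightarrow> carrier ?A" and eC: "e C \<in> N" using insert by auto
  then have fp: "finprod ?A e F \<in> N" using A.finprod_closed[OF eF] by simp
  have np: "n [^] card F \<in> N" using A.nat_pow_closed[of n "card F"] n nat_pow_consistent[of n "card F" N] by simp
  have "finprod ?A (\<lambda>C. n \<otimes> (g \<otimes> e C \<otimes> inv g)) (insert C F) =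
    (n \<otimes> (g \<otimes> e C \<otimes> inv g)) \<otimes> finprod ?A (\<lambda>C. n \<otimes> (g \<otimes> e C \<otimes> inv g)) F"
    using insert n g by (subst A.finprod_insert) auto
  also have "\<dots> = (n \<otimes> (g \<otimes> e C \<otimes> inv g)) \<otimes> (n [^] card F \<otimes> (g \<otimes> finprod ?A e F \<otimes> inv g))"
    using insert by simp
  also have "\<dots> = (n \<otimes> n [^] card F) \<otimes> ((g \<otimes> e C \<otimes> inv g) \<otimes> (g \<otimes> finprod ?A e F \<otimes> inv g))"
    using n g eC fp np by (intro N_swap) auto
  also have "(g \<otimes> e C \<otimes> inv g) \<otimes> (g \<otimes> finprod ?A e F \<otimes> inv g) = g \<otimes> (e C \<otimes> finprod ?A e F) \<otimes> inv g"
    using g eC fp by (intro conj_mult) auto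
  also have "e C \<otimes> finprod ?A e F = finprod ?A e (insert C F)"
    using insert eF eC by (subst A.finprod_insert) auto
  also have "n \<otimes> n [^] card F = n [^] card (insert C F)"
    using insert n np by (simp add: N_comm)
  finally show ?case .
qed

text \<open>The averaging argument behind the injectivity of restriction to a Sylow subgroup in
  first cohomology.\<close>

lemma crossed_hom_trivial:
  assumes fin: "finite (carrier G)" and d: "\<delta> \<in> crossed_homs G N"
    and P: "subgroup P G" "\<And>h. h \<in> P \<Longrightarrow> \<delta> h = \<one>"
    and cop: "coprime q (card (lcosets P))" and exp: "\<And>x. x \<in> N \<Longrightarrow> x [^] (q::nat) = \<one>"
    and alt: "coset_prod P \<delta> = \<one> \<or> (\<forall>g\<in>carrier G. \<forall>x\<in>N. g \<otimes> x \<otimes> inv g = x)"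
    and g: "g \<in> carrier G"
  shows "\<delta> g = \<one>"
proof -
  interpret A: comm_group "G\<lparr>carrier := N\<rparr>" by (rule N_comm_group)
  note D = crossed_homD[OF d]
  have PG: "P \<subseteq> carrier G" using P(1) by (rule subgroup.subset)
  have finL: "finite (lcosets P)"
    using lcosets_subset_PowG[OF P(1)] fin finite_subset by blast
  \<comment> \<open>Since \<open>\<delta>\<close> is trivial on \<open>P\<close>, the cocycle rule
    gives \<open>\<delta> (a h) = \<delta> a\<close> for \<open>h\<close> in \<open>P\<close>: the
    values depend on the left coset only.\<close>
  define e where "e C = \<delta> (SOME t. t \<in> C)" for C
  have e_eq: "e C = \<delta> t" if C: "C \<in> lcosets P" and t: "t \<in> C" for C t
  proof -
    obtain a where a: "a \<in> carrier G" "C = a <# P" using C by (auto simp: LCOSETS_def)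
    have "\<delta> s = \<delta> a" if "s \<in> C" for s
    proof -
      obtain h where h: "h \<in> P" "s = a \<otimes> h" using \<open>s \<in> C\<close> a(2) by (auto simp: l_coset_def)
      then have "h \<in> carrier G" using PG by auto
      then show ?thesis using D[of a] D(2)[of a h] P(2)[OF h(1)] h(2) a(1) by simp
    qed
    then show ?thesis using t some_in_lcoset(1)[OF P(1) C] unfolding e_def by metis
  qed
  have eN: "e C \<in> N" if "C \<in> lcosets P" for C
    using that D(1) some_in_lcoset[OF P(1)] by (simp add: e_def)
  have bij: "bij_betw (\<lambda>C. g <# C) (lcosets P) (lcosets P)"
  proof (rule bij_betwI[where g = "\<lambda>C. inv g <# C"])
    have cos: "C \<subseteq> carrier G" if "C \<in> lcosets P" for C
      using that l_coset_subset_G[OF PG] by (auto simp: LCOSETS_def)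
    have closed: "h <# C \<in> lcosets P" if "h \<in> carrier G" "C \<in> lcosets P" for h C
      using that by (auto simp: LCOSETS_def lcos_m_assoc[OF PG])
    show "(\<lambda>C. g <# C) \<in> lcosets P \<rightarrow> lcosets P" "(\<lambda>C. inv g <# C) \<in> lcosets P \<rightarrow> lcosets P"
      using closed g by auto
    show "inv g <# (g <# C) = C" "g <# (inv g <# C) = C" if "C \<in> lcosets P" for C
      using g cos[OF that] by (simp_all add: lcos_m_assoc lcos_mult_one)
  qed
  define T where "T = finprod (G\<lparr>carrier := N\<rparr>) e (lcosets P)"
  have TN: "T \<in> N" using A.finprod_closed[of e "lcosets P"] eN by (auto simp: T_def)
  \<comment> \<open>Left multiplication by \<open>g\<close> permutes the cosets and turns a
    representative \<open>t\<close> into a representative \<open>g t\<close>. Expanding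
    \<open>\<delta> (g t)\<close> expresses \<open>T\<close> as the power of
    \<open>\<delta> g\<close> by the index, times the conjugate of \<open>T\<close> under
    \<open>g\<close>. In both alternatives that conjugate is \<open>T\<close> itself, so
    \<open>\<delta> g\<close> is annihilated by the index as well as by \<open>q\<close>, and these
    are coprime.\<close>
  have "T = finprod (G\<lparr>carrier := N\<rparr>) e ((\<lambda>C. g <# C) ` (lcosets P))"
    using bij by (simp add: bij_betw_def T_def)
  also have "\<dots> = finprod (G\<lparr>carrier := N\<rparr>) (\<lambda>C. e (g <# C)) (lcosets P)"
    using bij eN by (intro A.finprod_reindex) (auto simp: bij_betw_def)
  also have "\<dots> = finprod (G\<lparr>carrier := N\<rparr>) (\<lambda>C. \<delta> g \<otimes> (g \<otimes> e C \<otimes> inv g)) (lcosets P)"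
  proof (rule A.finprod_cong')
    fix C assume C: "C \<in> lcosets P"
    let ?t = "SOME t. t \<in> C"
    have gC: "g <# C \<in> lcosets P" using bij C by (auto simp: bij_betw_def)
    have "g \<otimes> ?t \<in> g <# C" using some_in_lcoset[OF P(1) C] by (auto simp: l_coset_def)
    then have "e (g <# C) = \<delta> (g \<otimes> ?t)" using e_eq[OF gC] by blast
    then show "e (g <# C) = \<delta> g \<otimes> (g \<otimes> e C \<otimes> inv g)"
      using D(2)[OF g some_in_lcoset(2)[OF P(1) C]] by (simp add: e_def)
  qed (use D(1)[OF g] eN g in auto)
  also have "\<dots> = \<delta> g [^] card (lcosets P) \<otimes> (g \<otimes> T \<otimes> inv g)"
    unfolding T_def using finL eN D(1)[OF g] g by (intro finprod_twisted) auto
  finally have *: "T = \<delta> g [^] card (lcosets P) \<otimes> (g \<otimes> T \<otimes> inv g)" .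
  have "coset_prod P \<delta> = T" by (simp add: coset_prod_def T_def e_def[abs_def])
  then have conjT: "g \<otimes> T \<otimes> inv g = T" using alt TN g by auto
  have dc: "\<delta> g \<in> carrier G" using D(1)[OF g] by simp
  have "\<delta> g [^] card (lcosets P) = \<one>"
    using * TN dc unfolding conjT by (metis N_carrier nat_pow_closed r_cancel_one')
  moreover have "\<delta> g [^] q = \<one>" using exp D(1)[OF g] by simp
  ultimately have "ord (\<delta> g) dvd card (lcosets P)" "ord (\<delta> g) dvd q"
    using pow_eq_id[OF dc] by auto
  then have "ord (\<delta> g) = 1" using cop by (metis coprime_common_divisor_nat)
  then show ?thesis using dc ord_eq_1 by auto
qed

text \<open>Elements of \<open>Z\<close> agree on \<open>N\<close>, so on \<open>P\<close> they are
  separated by their values on \<open>S\<close>. If those coincide, the quotient of the two is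
  trivial on \<open>P\<close>, and its product over the transversal decides whether it is trivial
  everywhere. This last parameter costs one factor \<open>card N\<close>, which is saved if
  \<open>N\<close> is central or nothing lies outside \<open>P\<close>.\<close>

lemma card_splitting_crossed_homs_le:
  fixes q :: nat
  assumes fin: "finite (carrier G)"
    and P: "subgroup P G" "generate G (N \<union> S) = P" "S \<subseteq> carrier G" "finite S"
    and cop: "coprime q (card (lcosets P))" and exp: "\<And>x. x \<in> N \<Longrightarrow> x [^] q = \<one>"
  defines "Z \<equiv> {\<delta> \<in> crossed_homs G N. \<forall>x\<in>N. \<delta> x = x}"
  shows "finite Z" "card Z \<le> card N ^ Suc (card S)"
    and "(\<forall>g\<in>carrier G. \<forall>x\<in>N. g \<otimes> x \<otimes> inv g = x) \<or> P = carrier G \<Longrightarrow> card Z \<le> card N ^ card S"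
proof -
  have finN: "finite N" using fin subset finite_subset by blast
  have key: "\<delta> = \<epsilon>" if Z: "\<delta> \<in> Z" "\<epsilon> \<in> Z" and S: "\<And>s. s \<in> S \<Longrightarrow> \<delta> s = \<epsilon> s"
    and alt: "coset_prod P \<delta> = coset_prod P \<epsilon> \<or> (\<forall>g\<in>carrier G. \<forall>x\<in>N. g \<otimes> x \<otimes> inv g = x)
       \<or> P = carrier G" for \<delta> \<epsilon>
  proof -
    have d: "\<delta> \<in> crossed_homs G N" and e: "\<epsilon> \<in> crossed_homs G N" using Z by (auto simp: Z_def)
    note D = crossed_homD[OF d] and E = crossed_homD[OF e]
    have agree: "\<delta> h = \<epsilon> h" if "h \<in> P" for h
    proof (rule crossed_homs_agree_on_generate[OF d e])
      show "N \<union> S \<subseteq> carrier G" using P(3) subset by auto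
      show "\<delta> s = \<epsilon> s" if "s \<in> N \<union> S" for s using that S Z by (auto simp: Z_def)
      show "h \<in> generate G (N \<union> S)" using that P(2) by simp
    qed
    have "\<delta> g = \<epsilon> g" if g: "g \<in> carrier G" for g
    proof (cases "P = carrier G")
      case True then show ?thesis using agree g by simp
    next
      case False
      let ?q = "\<lambda>g\<in>carrier G. \<delta> g \<otimes> inv (\<epsilon> g)"
      have q: "?q \<in> crossed_homs G N" using crossed_hom_quotient[OF d e] .
      have "?q g = \<one>"
      proof (rule crossed_hom_trivial[OF fin q P(1) _ cop exp _ g])
        fix h assume "h \<in> P"
        then show "?q h = \<one>" using agree E(1) P(1) subgroup.mem_carrier by fastforce
      next
        interpret A: comm_group "G\<lparr>carrier := N\<rparr>" by (rule N_comm_group)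
        let ?f = "\<lambda>\<delta> C. \<delta> (SOME t. t \<in> C)"
        have 1: "coset_prod P \<delta> = coset_prod P ?q \<otimes> coset_prod P \<epsilon>"
        proof -
          have "finprod (G\<lparr>carrier := N\<rparr>) (\<lambda>C. ?f ?q C \<otimes>\<^bsub>G\<lparr>carrier := N\<rparr>\<^esub> ?f \<epsilon> C) (lcosets P) =
            finprod (G\<lparr>carrier := N\<rparr>) (?f ?q) (lcosets P) \<otimes>\<^bsub>G\<lparr>carrier := N\<rparr>\<^esub>
            finprod (G\<lparr>carrier := N\<rparr>) (?f \<epsilon>) (lcosets P)"
            using crossed_homD(1)[OF q] E(1) some_in_lcoset(2)[OF P(1)]
            by (intro A.finprod_multf) (auto simp del: restrict_apply)
          moreover have "finprod (G\<lparr>carrier := N\<rparr>) (\<lambda>C. ?f ?q C \<otimes>\<^bsub>G\<lparr>carrier := N\<rparr>\<^esub> ?f \<epsilon> C) (lcosets P)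
            = finprod (G\<lparr>carrier := N\<rparr>) (?f \<delta>) (lcosets P)"
            using D(1) E(1) some_in_lcoset(2)[OF P(1)]
            by (intro A.finprod_cong') (auto simp: m_assoc)
          ultimately show ?thesis unfolding coset_prod_def by simp
        qed
        show "coset_prod P ?q = \<one> \<or> (\<forall>g\<in>carrier G. \<forall>x\<in>N. g \<otimes> x \<otimes> inv g = x)"
        proof (cases "coset_prod P \<delta> = coset_prod P \<epsilon>")
          case True
          then show ?thesis using 1 coset_prod_closed[OF q P(1)] coset_prod_closed[OF e P(1)]
            by (metis N_carrier r_cancel_one')
        qed (use alt False in auto)
      qed
      then have "\<delta> g \<otimes> inv (\<epsilon> g) = \<one>" using g by simp
      then show ?thesis using D(1)[OF g] E(1)[OF g]
        by (metis N_carrier inv_closed inv_equality inv_inv)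
    qed
    then show ?thesis using d e unfolding crossed_homs_def
      by (auto intro!: PiE_ext[of _ "carrier G" "\<lambda>_. N"])
  qed
  let ?f = "\<lambda>\<delta>. (restrict \<delta> S, coset_prod P \<delta>)"
  have ZN: "\<delta> x \<in> N" if "\<delta> \<in> Z" "x \<in> S" for \<delta> x
    using that P(3) crossed_homD(1) by (auto simp: Z_def)
  have "crossed_homs G N \<subseteq> carrier G \<rightarrow>\<^sub>E N" by (auto simp: crossed_homs_def)
  moreover have "finite (carrier G \<rightarrow>\<^sub>E N)" using fin finN by (intro finite_PiE) auto
  ultimately show finZ: "finite Z" by (metis (no_types, lifting) Z_def finite_subset mem_Collect_eq subsetI)
  have finSN: "finite (S \<rightarrow>\<^sub>E N)" using P(4) finN by (intro finite_PiE) auto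
  have res: "\<delta> s = \<epsilon> s" if "restrict \<delta> S = restrict \<epsilon> S" "s \<in> S" for \<delta> \<epsilon> :: "'a \<Rightarrow> 'a" and s
    using that by (metis restrict_apply')
  have "card Z \<le> card ((S \<rightarrow>\<^sub>E N) \<times> N)"
  proof (rule card_inj_on_le)
    show "inj_on ?f Z" by (rule inj_onI) (use key res in auto)
    show "?f ` Z \<subseteq> (S \<rightarrow>\<^sub>E N) \<times> N"
      using ZN coset_prod_closed[OF _ P(1)] by (auto simp: Z_def)
    show "finite ((S \<rightarrow>\<^sub>E N) \<times> N)" using finSN finN by simp
  qed
  also have "\<dots> = card N ^ Suc (card S)"
    using P(4) by (simp add: card_cartesian_product card_PiE)
  finally show "card Z \<le> card N ^ Suc (card S)" .
  assume c: "(\<forall>g\<in>carrier G. \<forall>x\<in>N. g \<otimes> x \<otimes> inv g = x) \<or> P = carrier G"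
  have "card Z \<le> card (S \<rightarrow>\<^sub>E N)"
  proof (rule card_inj_on_le)
    show "inj_on (\<lambda>\<delta>. restrict \<delta> S) Z" by (rule inj_onI) (use key res c in auto)
    show "(\<lambda>\<delta>. restrict \<delta> S) ` Z \<subseteq> S \<rightarrow>\<^sub>E N" using ZN by auto
  qed (rule finSN)
  also have "\<dots> = card N ^ card S" using P(4) by (simp add: card_PiE)
  finally show "card Z \<le> card N ^ card S" .
qed

lemma complement_decomp:
  assumes K: "K \<in> complements G N" and g: "g \<in> carrier G"
  shows "\<exists>!n. n \<in> N \<and> inv n \<otimes> g \<in> K"
proof (rule ex_ex1I)
  have Ks: "subgroup K G" using K by (simp add: complements_def)
  have "g \<in> N <#> K" using K g by (simp add: complements_def)
  then obtain n k where nk: "n \<in> N" "k \<in> K" "g = n \<otimes> k" by (auto simp: set_mult_def)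
  then have "inv n \<otimes> g = k" using subgroup.mem_carrier[OF Ks] by (simp add: m_assoc[symmetric])
  then show "\<exists>n. n \<in> N \<and> inv n \<otimes> g \<in> K" using nk by auto
  fix n m assume n: "n \<in> N \<and> inv n \<otimes> g \<in> K" and m: "m \<in> N \<and> inv m \<otimes> g \<in> K"
  then have "(inv n \<otimes> g) \<otimes> inv (inv m \<otimes> g) \<in> K"
    using Ks by (meson subgroup.m_closed subgroup.m_inv_closed)
  moreover have "(inv n \<otimes> g) \<otimes> inv (inv m \<otimes> g) = inv n \<otimes> m"
    using n m g by (simp add: inv_mult_group m_assoc mult_inv_cancel_left)
  moreover have "inv n \<otimes> m \<in> N" using n m by auto
  ultimately have "inv n \<otimes> m = \<one>" using K by (auto simp: complements_def)
  then show "n = m" using n m by (metis N_carrier inv_closed inv_equality inv_inv)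
qed

text \<open>To a complement \<open>K\<close> belongs the map sending \<open>g = n k\<close> to its
  component \<open>n\<close> in \<open>N\<close>. It is a crossed homomorphism that is the identity
  on \<open>N\<close>, and \<open>K\<close> is recovered as the set where it takes the value
  \<open>\<one>\<close>.\<close>

lemma card_complements_le_crossed_homs:
  assumes fin: "finite (carrier G)"
  defines "Z \<equiv> {\<delta> \<in> crossed_homs G N. \<forall>x\<in>N. \<delta> x = x}"
  shows "card (complements G N) \<le> card Z"
proof -
  define D where "D K = (\<lambda>g\<in>carrier G. THE n. n \<in> N \<and> inv n \<otimes> g \<in> K)" for K
  have D: "D K g \<in> N" "inv (D K g) \<otimes> g \<in> K" if "K \<in> complements G N" "g \<in> carrier G" for K g
    using theI'[OF complement_decomp[OF that]] that(2) by (auto simp: D_def)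
  have D_eq: "D K g = n" if "K \<in> complements G N" "g \<in> carrier G" "n \<in> N" "inv n \<otimes> g \<in> K" for K g n
    using complement_decomp[OF that(1,2)] D[OF that(1,2)] that(3,4) by blast
  show ?thesis
  proof (rule card_inj_on_le)
    show "inj_on D (complements G N)"
    proof (rule inj_onI)
      fix K L assume KL: "K \<in> complements G N" "L \<in> complements G N" and eq: "D K = D L"
      have *: "K' = {g \<in> carrier G. D K' g = \<one>}" if K': "K' \<in> complements G N" for K'
      proof -
        have "subgroup K' G" using K' by (simp add: complements_def)
        then show ?thesis using D_eq[OF K', of _ \<one>] D(2)[OF K'] subgroup.mem_carrier by force
      qed
      show "K = L" using *[OF KL(1)] *[OF KL(2)] eq by simp
    qed
    show "D ` complements G N \<subseteq> Z"
    proof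
      fix \<delta> assume "\<delta> \<in> D ` complements G N"
      then obtain K where K: "K \<in> complements G N" "\<delta> = D K" by auto
      have Ks: "subgroup K G" using K(1) by (simp add: complements_def)
      have "D K (g \<otimes> h) = D K g \<otimes> (g \<otimes> D K h \<otimes> inv g)" if g: "g \<in> carrier G" and h: "h \<in> carrier G" for g h
      proof (rule D_eq[OF K(1)])
        show "D K g \<otimes> (g \<otimes> D K h \<otimes> inv g) \<in> N" using D(1)[OF K(1)] g h by auto
        have "inv (D K g \<otimes> (g \<otimes> D K h \<otimes> inv g)) = inv (D K g) \<otimes> inv (g \<otimes> D K h \<otimes> inv g)"
          using D(1)[OF K(1)] g h by (subst N_comm) (auto simp: inv_mult_group)
        also have "inv (g \<otimes> D K h \<otimes> inv g) = g \<otimes> inv (D K h) \<otimes> inv g"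
          using D(1)[OF K(1) h] g by (simp add: inv_mult_group m_assoc)
        finally have "inv (D K g \<otimes> (g \<otimes> D K h \<otimes> inv g)) \<otimes> (g \<otimes> h) =
          (inv (D K g) \<otimes> g) \<otimes> (inv (D K h) \<otimes> h)"
          using D(1)[OF K(1)] g h by (simp add: m_assoc mult_inv_cancel_left)
        then show "inv (D K g \<otimes> (g \<otimes> D K h \<otimes> inv g)) \<otimes> (g \<otimes> h) \<in> K"
          using D(2)[OF K(1)] g h subgroup.m_closed[OF Ks] by simp
      qed (use g h in simp)
      moreover have "D K x = x" if "x \<in> N" for x
        using D_eq[OF K(1), of x x] that subgroup.one_closed[OF Ks] by simp
      moreover have "D K \<in> carrier G \<rightarrow>\<^sub>E N" using D(1)[OF K(1)] by (auto simp: D_def)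
      ultimately show "\<delta> \<in> Z" unfolding Z_def crossed_homs_def K(2) by auto
    qed
    have finN: "finite N" using fin subset finite_subset by blast
    have "Z \<subseteq> carrier G \<rightarrow>\<^sub>E N" by (auto simp: Z_def crossed_homs_def)
    moreover have "finite (carrier G \<rightarrow>\<^sub>E N)" using fin finN by (intro finite_PiE) auto
    ultimately show "finite Z" by (rule finite_subset)
  qed
qed

end

section \<open>Minimal normal subgroups and Sylow subgroups of quotients\<close>

lemma (in group_hom) fibre_eq_translate:
  assumes P: "subgroup P G" and x: "x \<in> P"
  shows "{y \<in> P. h y = h x} = (\<lambda>n. n \<otimes>\<^bsub>G\<^esub> x) ` (P \<inter> kernel G H h)"
proof
  have xc: "x \<in> carrier G" using P x by (rule subgroup.mem_carrier)
  show "{y \<in> P. h y = h x} \<subseteq> (\<lambda>n. n \<otimes>\<^bsub>G\<^esub> x) ` (P \<inter> kernel G H h)"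
  proof
    fix y assume y: "y \<in> {y \<in> P. h y = h x}"
    then have yc: "y \<in> carrier G" using P subgroup.mem_carrier by fastforce
    have "y \<otimes>\<^bsub>G\<^esub> inv\<^bsub>G\<^esub> x \<in> P \<inter> kernel G H h"
      using y yc xc x P by (auto simp: kernel_def intro: subgroup.m_closed subgroup.m_inv_closed)
    moreover have "y = y \<otimes>\<^bsub>G\<^esub> inv\<^bsub>G\<^esub> x \<otimes>\<^bsub>G\<^esub> x" using xc yc by (simp add: G.m_assoc)
    ultimately show "y \<in> (\<lambda>n. n \<otimes>\<^bsub>G\<^esub> x) ` (P \<inter> kernel G H h)" by blast
  qed
  show "(\<lambda>n. n \<otimes>\<^bsub>G\<^esub> x) ` (P \<inter> kernel G H h) \<subseteq> {y \<in> P. h y = h x}"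
    using x xc P by (auto simp: kernel_def intro: subgroup.m_closed)
qed

lemma (in group_hom) card_fibre:
  assumes P: "subgroup P G" and x: "x \<in> P"
  shows "card {y \<in> P. h y = h x} = card (P \<inter> kernel G H h)"
proof -
  have "inj_on (\<lambda>n. n \<otimes>\<^bsub>G\<^esub> x) (P \<inter> kernel G H h)"
    using subgroup.mem_carrier[OF P x] by (intro inj_onI) (auto simp: kernel_def)
  then show ?thesis using fibre_eq_translate[OF assms] card_image by metis
qed

lemma (in group_hom) card_subgroup_eq:
  assumes P: "subgroup P G" and fin: "finite (carrier G)"
  shows "card P = card (h ` P) * card (P \<inter> kernel G H h)"
proof -
  have finP: "finite P" using P fin by (meson finite_subset subgroup.subset)
  have "card P = (\<Sum>y\<in>h ` P. card {x \<in> P. h x = y})"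
    using sum.image_gen[OF finP, of "\<lambda>_. 1::nat" h] by simp
  also have "\<dots> = (\<Sum>y\<in>h ` P. card (P \<inter> kernel G H h))"
    using card_fibre[OF P] by (intro sum.cong) auto
  finally show ?thesis by simp
qed

lemma (in group_hom) order_eq_order_kernel:
  assumes "h ` carrier G = carrier H" "finite (carrier G)"
  shows "order G = order H * card (kernel G H h)"
proof -
  have "carrier G \<inter> kernel G H h = kernel G H h" by (auto simp: kernel_def)
  then show ?thesis
    using card_subgroup_eq[OF G.subgroup_self assms(2)] assms(1) by (simp add: order_def)
qed

text \<open>\<open>card P\<close> is the product of the orders of the image and of the intersection
  with the kernel. Both are powers of \<open>p\<close>, bounded by the \<open>p\<close>-parts of the
  orders of \<open>H\<close> and of the kernel. These \<open>p\<close>-parts multiply to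
  \<open>card P\<close>, so both bounds are attained; if the kernel is itself a
  \<open>p\<close>-group, the second equality places it inside \<open>P\<close>.\<close>

lemma (in group_hom) sylow_subgroup_image:
  assumes fin: "finite (carrier G)" and surj: "h ` carrier G = carrier H"
    and P: "sylow_subgroup G p P"
  shows "sylow_subgroup H p (h ` P)"
    and "card (kernel G H h) = p ^ k \<Longrightarrow> kernel G H h \<subseteq> P"
proof -
  let ?N = "kernel G H h"
  have p: "Factorial_Ring.prime p" and Ps: "subgroup P G"
    and cP: "card P = p ^ multiplicity p (order G)" using P by (auto simp: sylow_subgroup_def)
  have finN: "finite ?N" using fin by (simp add: kernel_def)
  have finH: "finite (carrier H)" using fin surj by (metis finite_imageI)
  obtain i j where ij: "card (h ` P) = p ^ i" "card (P \<inter> ?N) = p ^ j"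
    using prime_power_mult_nat[OF p] card_subgroup_eq[OF Ps fin] cP by metis
  have "p ^ (i + j) = p ^ multiplicity p (order G)"
    using card_subgroup_eq[OF Ps fin] ij cP by (simp add: power_add)
  then have e: "i + j = multiplicity p (order G)"
    using prime_gt_1_nat[OF p] power_inject_exp by blast
  have pos: "order H \<noteq> 0" "card ?N \<noteq> 0"
    using finH finN subgroup.one_closed[OF subgroup_kernel]
    by (auto simp: H.order_gt_0_iff_finite)
  have m: "multiplicity p (order G) = multiplicity p (order H) + multiplicity p (card ?N)"
    unfolding order_eq_order_kernel[OF surj fin]
    using p pos by (intro prime_elem_multiplicity_mult_distrib) auto
  have "p ^ i dvd order H"
    using H.lagrange[OF subgroup_img_is_subgroup[OF Ps]] ij by (metis dvd_triv_right)
  then have i: "i \<le> multiplicity p (order H)"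
    using pos p by (intro multiplicity_geI) auto
  have "subgroup (P \<inter> ?N) (G\<lparr>carrier := ?N\<rparr>)"
    using G.subgroup_incl[OF G.subgroups_Inter_pair[OF Ps subgroup_kernel] subgroup_kernel] by simp
  then have "card (rcosets\<^bsub>G\<lparr>carrier := ?N\<rparr>\<^esub> (P \<inter> ?N)) * card (P \<inter> ?N) = order (G\<lparr>carrier := ?N\<rparr>)"
    using group.lagrange[OF subgroup.subgroup_is_group[OF subgroup_kernel G.is_group]] by blast
  then have "p ^ j dvd card ?N" unfolding ij by (simp add: order_def) (metis dvd_triv_right)
  then have j: "j \<le> multiplicity p (card ?N)"
    using pos p by (intro multiplicity_geI) auto
  have ij': "i = multiplicity p (order H)" "j = multiplicity p (card ?N)" using i j e m by auto
  show "sylow_subgroup H p (h ` P)"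
    using p subgroup_img_is_subgroup[OF Ps] ij ij' by (simp add: sylow_subgroup_def)
  assume "card ?N = p ^ k"
  then have "card (P \<inter> ?N) = card ?N" using ij ij' p by simp
  then have "P \<inter> ?N = ?N" using finN by (intro card_subset_eq) auto
  then show "?N \<subseteq> P" by blast
qed

text \<open>The Sylow theorem is applied with the exponent 1 rather than with the full power of
  \<open>p\<close>, which yields a subgroup of order exactly \<open>p\<close>.\<close>

lemma (in group) cauchy_in_subgroup:
  assumes N: "subgroup N G" "finite N" and p: "Factorial_Ring.prime (p::nat)" "p dvd card N"
  obtains x where "x \<in> N" "x \<noteq> \<one>" "x [^] p = \<one>"
proof -
  let ?N = "G\<lparr>carrier := N\<rparr>"
  interpret N: group ?N using subgroup.subgroup_is_group[OF N(1) is_group] .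
  obtain m where "card N = p * m" using p by blast
  then obtain K where K: "subgroup K ?N" "card K = p"
    using sylow_thm[of p ?N 1 m] p(1) N.is_group N(2) by (auto simp: order_def)
  have KN: "K \<subseteq> N" using subgroup.subset[OF K(1)] by simp
  have Ks: "subgroup K G" using incl_subgroup[OF N(1) K(1)] .
  interpret K: group "G\<lparr>carrier := K\<rparr>" using subgroup.subgroup_is_group[OF Ks is_group] .
  have "\<not> K \<subseteq> {\<one>}"
  proof
    assume "K \<subseteq> {\<one>}"
    then have "card K \<le> card {\<one>}" by (intro card_mono) auto
    then show False using K(2) prime_gt_1_nat[OF p(1)] by simp
  qed
  then obtain x where x: "x \<in> K" "x \<noteq> \<one>" by blast
  have "x [^]\<^bsub>G\<lparr>carrier := K\<rparr>\<^esub> order (G\<lparr>carrier := K\<rparr>) = \<one>"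
    using K.pow_order_eq_1[of x] x by simp
  then have "x [^] p = \<one>" using nat_pow_consistent[of x p K] K(2) by (simp add: order_def)
  then show thesis using that x KN by blast
qed

text \<open>A minimal normal subgroup is sought inside the last nontrivial term of the derived
  series, where commutators vanish, so \<open>N\<close> is abelian. For a prime \<open>p\<close>
  dividing its order, the elements with trivial \<open>p\<close>-th power form a normal subgroup,
  nontrivial by Cauchy, hence all of \<open>N\<close>; an element of another prime order is then
  impossible.\<close>

lemma (in group) solvable_minimal_normal:
  assumes solv: "solvable G" and fin: "finite (carrier G)" and nt: "carrier G \<noteq> {\<one>}"
  obtains N p k where "abelian_normal N G" "Factorial_Ring.prime (p::nat)" "card N = p ^ k" "k > 0"
    "\<And>x. x \<in> N \<Longrightarrow> x [^] p = \<one>" "\<And>M. M \<lhd> G \<Longrightarrow> M \<subseteq> N \<Longrightarrow> M = {\<one>} \<or> M = N"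
proof -
  let ?D = "\<lambda>n. (derived G ^^ n) (carrier G)"
  have ex: "\<exists>n. ?D n = {\<one>}" using solv solvable_iff_trivial_derived_seq by blast
  define n where "n = (LEAST n. ?D n = {\<one>})"
  have n: "?D n = {\<one>}" unfolding n_def using LeastI_ex[OF ex] .
  have "n \<noteq> 0" using n nt by (cases n) auto
  then obtain m where m: "n = Suc m" by (cases n) auto
  have Dm: "?D m \<noteq> {\<one>}" using not_less_Least[of m "\<lambda>n. ?D n = {\<one>}"] m n_def by simp
  have Dn: "?D i \<lhd> G" for i by (induction i) (auto simp: normal_self derived_is_normal)
  define \<M> where "\<M> = {M. M \<lhd> G \<and> M \<noteq> {\<one>} \<and> M \<subseteq> ?D m}"
  have "finite \<M>"
    by (rule finite_subset[of _ "Pow (carrier G)"])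
       (use fin in \<open>auto simp: \<M>_def dest: normal_imp_subgroup subgroup.subset\<close>)
  moreover have "\<M> \<noteq> {}" using Dn Dm by (auto simp: \<M>_def)
  ultimately obtain N where "N \<in> \<M>" and Nmin: "\<And>M. M \<in> \<M> \<Longrightarrow> M \<subseteq> N \<Longrightarrow> M = N"
    using finite_has_minimal[of \<M>] by metis
  then have N: "N \<lhd> G" "N \<noteq> {\<one>}" "N \<subseteq> ?D m" by (auto simp: \<M>_def)
  have Ns: "subgroup N G" using N(1) by (rule normal_imp_subgroup)
  have min: "M = {\<one>} \<or> M = N" if "M \<lhd> G" "M \<subseteq> N" for M
    using Nmin[of M] that N(3) by (auto simp: \<M>_def)
  have comm: "x \<otimes> y = y \<otimes> x" if xy: "x \<in> N" "y \<in> N" for x y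
  proof -
    have c: "x \<in> carrier G" "y \<in> carrier G" using xy Ns by (auto intro: subgroup.mem_carrier)
    have "x \<otimes> y \<otimes> inv x \<otimes> inv y \<in> derived_set G (?D m)" using xy N(3) by blast
    then have "x \<otimes> y \<otimes> inv x \<otimes> inv y \<in> derived G (?D m)"
      unfolding derived_def by (rule generate.incl)
    then have "x \<otimes> y \<otimes> inv x \<otimes> inv y = \<one>" using n m by simp
    then have "x \<otimes> y \<otimes> inv (y \<otimes> x) = \<one>" using c by (simp add: inv_mult_group m_assoc)
    then show ?thesis using c by (metis inv_equality inv_inv inv_closed m_closed)
  qed
  interpret N: abelian_normal N G
    using N(1) comm by (simp add: abelian_normal_def abelian_normal_axioms_def)
  have finN: "finite N" using fin subgroup.subset[OF Ns] finite_subset by blast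
  have "card N \<noteq> 1" using N(2) subgroup.one_closed[OF Ns] by (metis card_1_singletonE singletonD)
  then obtain p where p: "Factorial_Ring.prime p" "p dvd card N" using prime_factor_nat by blast
  define W where "W = {x \<in> N. x [^] p = \<one>}"
  have Ws: "subgroup W G"
  proof (rule subgroupI)
    show "W \<subseteq> carrier G" "W \<noteq> {}"
      using subgroup.one_closed[OF Ns] by (auto simp: W_def intro: exI[of _ \<one>])
    show "inv a \<in> W" if "a \<in> W" for a using that by (auto simp: W_def nat_pow_inv)
    show "a \<otimes> b \<in> W" if "a \<in> W" "b \<in> W" for a b
      using that by (auto simp: W_def pow_mult_distrib comm)
  qed
  have "W \<lhd> G"
  proof (rule normal_invI[OF Ws])
    fix g x assume g: "g \<in> carrier G" and x: "x \<in> W"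
    then have xc: "x \<in> carrier G" by (simp add: W_def)
    have "(g \<otimes> x \<otimes> inv g) [^] i = g \<otimes> x [^] i \<otimes> inv g" for i :: nat
      by (induction i) (use g xc in \<open>auto simp: N.conj_mult\<close>)
    then show "g \<otimes> x \<otimes> inv g \<in> W" using g x by (simp add: W_def)
  qed
  moreover have "W \<noteq> {\<one>}" using cauchy_in_subgroup[OF Ns finN p] by (auto simp: W_def)
  ultimately have "W = N" using min[of W] by (auto simp: W_def)
  then have exp: "x [^] p = \<one>" if "x \<in> N" for x using that by (auto simp: W_def)
  have only_p: "q = p" if q: "Factorial_Ring.prime q" "q dvd card N" for q
  proof -
    obtain x where x: "x \<in> N" "x \<noteq> \<one>" "x [^] q = \<one>" using cauchy_in_subgroup[OF Ns finN q] .
    then have "ord x dvd q" "ord x dvd p" using exp[OF x(1)] pow_eq_id[of x] by auto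
    moreover have "ord x \<noteq> 1" using x ord_eq_1 by auto
    ultimately have "ord x = q" "ord x = p" using p(1) q(1) by (auto simp: prime_nat_iff)
    then show ?thesis by simp
  qed
  have cN: "card N \<noteq> 0" using finN subgroup.one_closed[OF Ns] by (metis card_0_eq empty_iff)
  obtain r where r: "card N = p ^ multiplicity p (card N) * r" "\<not> p dvd r"
    using multiplicity_decompose'[of "card N" p] cN p(1) by (auto simp: prime_nat_iff)
  have "r = 1"
  proof (rule ccontr)
    assume "r \<noteq> 1"
    then obtain q where "Factorial_Ring.prime q" "q dvd r" using prime_factor_nat by blast
    then show False using only_p r by (metis dvd_mult)
  qed
  then have "card N = p ^ multiplicity p (card N)" using r by simp
  moreover from this have "multiplicity p (card N) > 0" using \<open>card N \<noteq> 1\<close> by (metis gr0I power_0)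
  ultimately show thesis using that[OF N.abelian_normal_axioms p(1) _ _ exp min] by blast
qed

text \<open>Keeping the element type allows induction on the group order.\<close>

lemma (in normal) quotient_on_same_type:
  obtains Q :: "'a monoid" and h where "group_hom G Q h" "h ` carrier G = carrier Q" "kernel G Q h = H"
proof -
  \<comment> \<open>Choosing one element from each coset is injective, because distinct cosets are
    disjoint. The quotient structure is carried over to the representatives.\<close>
  let ?rep = "\<lambda>U. SOME g. g \<in> U"
  let ?Q = "flatten (G Mod H) ?rep"
  let ?h = "?rep \<circ> (\<lambda>x. H #> x)"
  have iso: "?rep \<in> iso (G Mod H) ?Q" by (rule flatten_set_group_mod_iso)
  have hom: "?h \<in> hom G ?Q"
    using Group.hom_compose[OF r_coset_hom_Mod] iso by (auto simp: iso_def)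
  have Q: "group ?Q" by (rule flatten_set_group_mod)
  have surj: "?h ` carrier G = carrier ?Q"
    by (auto simp: flatten_def FactGroup_def RCOSETS_def image_comp)
  have "?h x = \<one>\<^bsub>?Q\<^esub> \<longleftrightarrow> x \<in> H" if x: "x \<in> carrier G" for x
  proof -
    have "?h x = \<one>\<^bsub>?Q\<^esub> \<longleftrightarrow> ?rep (H #> x) = ?rep H" by (simp add: flatten_def)
    also have "\<dots> \<longleftrightarrow> H #> x = H"
      using flatten_set_group_mod_inj x subgroup_in_rcosets[OF is_group]
      by (intro inj_on_eq_iff[of ?rep "carrier (G Mod H)"]) (auto simp: FactGroup_def RCOSETS_def)
    also have "\<dots> \<longleftrightarrow> x \<in> H"
      using coset_join1[OF _ x is_subgroup] coset_join2[OF x is_subgroup] subset by auto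
    finally show ?thesis .
  qed
  then have "kernel G ?Q ?h = H" using subset by (auto simp: kernel_def)
  then show thesis using that[of ?Q ?h] hom Q surj is_group
    by (auto simp: group_hom_def group_hom_axioms_def)
qed

section \<open>Lifting generating tuples\<close>

text \<open>\<open>K \<inter> N\<close> is normalized by \<open>K\<close>, and by \<open>N\<close>
  because \<open>N\<close> is abelian, so it is normal in \<open>N K\<close>, which is everything.
  Minimality leaves the trivial group or \<open>N\<close>; the latter would make \<open>K\<close>
  the whole group.\<close>

lemma (in abelian_normal) supplement_complement_or_all:
  assumes min: "\<And>M. M \<lhd> G \<Longrightarrow> M \<subseteq> N \<Longrightarrow> M = {\<one>} \<or> M = N"
    and K: "subgroup K G" "N <#> K = carrier G" "K \<noteq> carrier G"
  shows "K \<in> complements G N"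
proof -
  have Ns: "subgroup N G" by (rule is_subgroup)
  have "K \<inter> N \<lhd> G"
  proof (rule normal_invI)
    show "subgroup (K \<inter> N) G" using subgroups_Inter_pair[OF K(1) Ns] .
    fix g x assume g: "g \<in> carrier G" and x: "x \<in> K \<inter> N"
    have "g \<in> N <#> K" using g K(2) by simp
    then obtain n k where nk: "n \<in> N" "k \<in> K" "g = n \<otimes> k" by (auto simp: set_mult_def)
    have kc: "k \<in> carrier G" using K(1) nk(2) by (rule subgroup.mem_carrier)
    have kN: "k \<otimes> x \<otimes> inv k \<in> N" using x kc by auto
    have "g \<otimes> x \<otimes> inv g = n \<otimes> (k \<otimes> x \<otimes> inv k) \<otimes> inv n"
      unfolding nk(3) using nk(1) kc x by (simp add: inv_mult_group m_assoc)
    also have "\<dots> = (k \<otimes> x \<otimes> inv k) \<otimes> n \<otimes> inv n" using N_comm[OF nk(1) kN] by simp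
    also have "\<dots> = k \<otimes> x \<otimes> inv k" using nk(1) kN by (simp add: m_assoc)
    finally have "g \<otimes> x \<otimes> inv g = k \<otimes> x \<otimes> inv k" .
    moreover have "k \<otimes> x \<otimes> inv k \<in> K"
      using nk(2) x K(1) by (auto intro: subgroup.m_closed subgroup.m_inv_closed)
    ultimately show "g \<otimes> x \<otimes> inv g \<in> K \<inter> N" using kN by simp
  qed
  then have "K \<inter> N = {\<one>} \<or> K \<inter> N = N" using min by blast
  moreover have "K \<inter> N \<noteq> N"
  proof
    assume "K \<inter> N = N"
    then have "N <#> K \<subseteq> K" using K(1) by (auto simp: set_mult_def intro: subgroup.m_closed)
    then show False using K subgroup.subset by blast
  qed
  ultimately show ?thesis using K by (simp add: complements_def)
qed

text \<open>A lift of a generating tuple of \<open>Q\<close> that fails to generate \<open>G\<close> generates a complement of \<open>N\<close>, and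
  it is the only lift with entries in that complement.\<close>

lemma gaschuetz_lower_bound:
  assumes hom: "group_hom G Q h" and surj: "h ` carrier G = carrier Q"
    and fin: "finite (carrier G)" and ab: "abelian_normal N G" and ker: "kernel G Q h = N"
    and min: "\<And>M. M \<lhd> G \<Longrightarrow> M \<subseteq> N \<Longrightarrow> M = {\<one>\<^bsub>G\<^esub>} \<or> M = N"
  shows "gen_prob Q n * (1 - real (card (complements G N)) / real (card N) ^ n) \<le> gen_prob G n"
proof -
  interpret group_hom G Q h by (rule hom)
  interpret N: abelian_normal N G by (rule ab)
  have N_iff: "x \<in> N \<longleftrightarrow> x \<in> carrier G \<and> h x = \<one>\<^bsub>Q\<^esub>" for x
    unfolding ker[symmetric] by (simp add: kernel_def)
  let ?I = "{0..<n}"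
  define U where "U = generating_tuples G n"
  define Y where "Y = generating_tuples Q n"
  define F where "F y = Pi\<^sub>E ?I (\<lambda>i. {x \<in> carrier G. h x = y i})" for y
  define L where "L = (\<Union>y\<in>Y. F y)"
  have finQ: "finite (carrier Q)" using fin surj by (metis finite_imageI)
  have finN: "finite N" using fin N.subset finite_subset by blast
  have finX: "finite U" "finite Y" unfolding U_def Y_def using fin finQ finite_generating_tuples by auto
  have finF: "finite (F y)" for y unfolding F_def using fin by (intro finite_PiE) auto
  have finL: "finite L" using finX finF by (simp add: L_def)
  have finC: "finite (complements G N)"
    by (rule finite_subset[of _ "Pow (carrier G)"])
       (use fin in \<open>auto simp: complements_def dest: subgroup.subset\<close>)
  have Nne: "card N > 0" using finN subgroup.one_closed[OF N.is_subgroup] card_gt_0_iff by blast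
  have cF: "card (F y) = card N ^ n" if "y \<in> Y" for y
  proof -
    have "card {x \<in> carrier G. h x = y i} = card N" if "i \<in> ?I" for i
    proof -
      have "y i \<in> carrier Q" using \<open>y \<in> Y\<close> that by (auto simp: Y_def generating_tuples_def)
      then obtain x where x: "x \<in> carrier G" "h x = y i" using surj by (metis imageE)
      have "carrier G \<inter> N = N" using N.subset by blast
      then show ?thesis using card_fibre[OF G.subgroup_self x(1)] x(2) ker by simp
    qed
    then show ?thesis unfolding F_def by (simp add: card_PiE)
  qed
  have disj: "y = restrict (h \<circ> f) ?I" if "y \<in> Y" "f \<in> F y" for y f
  proof -
    have "y \<in> extensional ?I" using that(1) by (auto simp: Y_def generating_tuples_def PiE_def)
    then show ?thesis using that(2)
      by (intro extensionalityI[of _ ?I]) (auto simp: F_def PiE_def Pi_def)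
  qed
  have cL: "card L = card Y * card N ^ n"
  proof -
    have "card L = (\<Sum>y\<in>Y. card (F y))"
      unfolding L_def
    proof (rule card_UN_disjoint)
      show "\<forall>y\<in>Y. \<forall>z\<in>Y. y \<noteq> z \<longrightarrow> F y \<inter> F z = {}" using disj by blast
    qed (use finX finF in auto)
    also have "\<dots> = (\<Sum>y\<in>Y. card N ^ n)" using cF by (intro sum.cong) auto
    finally show ?thesis by simp
  qed
  have bad: "generate G (f ` ?I) \<in> complements G N" if f: "f \<in> L - U" for f
  proof -
    obtain y where y: "y \<in> Y" "f \<in> F y" using f by (auto simp: L_def)
    have fc: "f ` ?I \<subseteq> carrier G" using y(2) by (auto simp: F_def)
    have fE: "f \<in> ?I \<rightarrow>\<^sub>E carrier G" using y(2) by (auto simp: F_def PiE_iff)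
    let ?K = "generate G (f ` ?I)"
    have Ks: "subgroup ?K G" using G.generate_is_subgroup[OF fc] .
    have "h ` ?K = generate Q (h ` f ` ?I)" using generate_img[OF fc] by simp
    also have "h ` f ` ?I = y ` ?I"
      unfolding image_image by (rule image_cong) (use y(2) in \<open>auto simp: F_def PiE_iff\<close>)
    also have "generate Q (y ` ?I) = carrier Q" using y(1) by (simp add: Y_def generating_tuples_def)
    finally have hK: "h ` ?K = carrier Q" .
    have "carrier G \<subseteq> N <#>\<^bsub>G\<^esub> ?K"
    proof
      fix g assume g: "g \<in> carrier G"
      then have "h g \<in> h ` ?K" using hK by simp
      then obtain k where k: "k \<in> ?K" "h g = h k" by blast
      have kc: "k \<in> carrier G" using subgroup.mem_carrier[OF Ks k(1)] .
      have "g \<otimes>\<^bsub>G\<^esub> inv\<^bsub>G\<^esub> k \<in> N" using g kc k(2) by (simp add: N_iff)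
      moreover have "g = (g \<otimes>\<^bsub>G\<^esub> inv\<^bsub>G\<^esub> k) \<otimes>\<^bsub>G\<^esub> k" using g kc by (simp add: G.m_assoc)
      ultimately show "g \<in> N <#>\<^bsub>G\<^esub> ?K" using k(1) unfolding set_mult_def by blast
    qed
    then have NK: "N <#>\<^bsub>G\<^esub> ?K = carrier G"
      using G.setmult_subset_G[OF N.subset subgroup.subset[OF Ks]] by (rule subset_antisym[rotated])
    have "?K \<noteq> carrier G" using f fE by (simp add: U_def generating_tuples_def)
    then show ?thesis
      by (intro N.supplement_complement_or_all[OF _ Ks NK]) (erule (1) min)
  qed
  have "card (L - U) \<le> card (Y \<times> complements G N)"
  proof (rule card_inj_on_le)
    let ?f = "\<lambda>f. (restrict (h \<circ> f) ?I, generate G (f ` ?I))"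
    show "?f ` (L - U) \<subseteq> Y \<times> complements G N"
    proof
      fix z assume "z \<in> ?f ` (L - U)"
      then obtain f where f: "f \<in> L - U" "z = ?f f" by blast
      then obtain y where y: "y \<in> Y" "f \<in> F y" by (auto simp: L_def)
      have "restrict (h \<circ> f) ?I \<in> Y" using disj[OF y] y(1) by simp
      then show "z \<in> Y \<times> complements G N" using f(2) bad[OF f(1)] by simp
    qed
    show "inj_on ?f (L - U)"
    proof (rule inj_onI)
      fix f g assume fg: "f \<in> L - U" "g \<in> L - U" "?f f = ?f g"
      let ?K = "generate G (f ` ?I)"
      have eqK: "?K = generate G (g ` ?I)" and eqh: "restrict (h \<circ> f) ?I = restrict (h \<circ> g) ?I"
        using fg(3) by auto
      have K: "?K \<in> complements G N" using bad fg by blast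
      then have Ks: "subgroup ?K G" by (simp add: complements_def)
      obtain y z where yz: "f \<in> F y" "g \<in> F z" using fg by (auto simp: L_def)
      have "f i = g i" if i: "i \<in> ?I" for i
      proof -
        have 1: "f i \<in> ?K" "g i \<in> ?K"
          using generate.incl[of "f i" "f ` ?I" G] generate.incl[of "g i" "g ` ?I" G] imageI[OF i] eqK
          by blast+
        have c: "f i \<in> carrier G" "g i \<in> carrier G" using yz i by (auto simp: F_def)
        have "h (f i) = h (g i)" using eqh i by (metis comp_apply restrict_apply')
        then have "f i \<otimes>\<^bsub>G\<^esub> inv\<^bsub>G\<^esub> g i \<in> N" using c by (simp add: N_iff)
        moreover have "f i \<otimes>\<^bsub>G\<^esub> inv\<^bsub>G\<^esub> g i \<in> ?K"
          using subgroup.m_closed[OF Ks 1(1) subgroup.m_inv_closed[OF Ks 1(2)]] .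
        ultimately have "f i \<otimes>\<^bsub>G\<^esub> inv\<^bsub>G\<^esub> g i = \<one>\<^bsub>G\<^esub>" using K by (auto simp: complements_def)
        then show ?thesis using c by (metis G.inv_closed G.inv_equality G.inv_inv)
      qed
      then show "f = g" using yz
        by (intro extensionalityI[of _ ?I]) (auto simp: F_def PiE_def)
    qed
    show "finite (Y \<times> complements G N)" using finX finC by simp
  qed
  then have cbad: "card (L - U) \<le> card Y * card (complements G N)"
    by (simp add: card_cartesian_product)
  have "card L \<le> card (L - U) + card U"
  proof -
    have "card L \<le> card ((L - U) \<union> U)" using finL finX by (intro card_mono) auto
    also have "\<dots> \<le> card (L - U) + card U" by (rule card_Un_le)
    finally show ?thesis .
  qed
  then have "card Y * card N ^ n \<le> card Y * card (complements G N) + card U" using cL cbad by linarith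
  then have "real (card Y * card N ^ n) \<le> real (card Y * card (complements G N) + card U)"
    by (simp only: of_nat_le_iff)
  then have main: "real (card Y) * (real (card N) ^ n - real (card (complements G N))) \<le> real (card U)"
    by (simp add: algebra_simps)
  have oQ: "real (order Q) > 0" using finQ by (simp add: order_gt_0_iff_finite)
  have "gen_prob Q n * (1 - real (card (complements G N)) / real (card N) ^ n) =
    real (card Y) * (real (card N) ^ n - real (card (complements G N))) / (real (order Q) ^ n * real (card N) ^ n)"
    using Nne oQ by (simp add: gen_prob_eq Y_def diff_divide_distrib right_diff_distrib)
  also have "\<dots> \<le> real (card U) / (real (order Q) ^ n * real (card N) ^ n)"
    using main by (intro divide_right_mono) auto
  also have "\<dots> = gen_prob G n"
    using order_eq_order_kernel[OF surj fin] ker by (simp add: gen_prob_eq U_def power_mult_distrib)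
  finally show ?thesis .
qed

section \<open>The lower bound for soluble groups\<close>

lemma (in group) generate_Un_one:
  assumes "S \<subseteq> carrier G" "T \<subseteq> {\<one>}"
  shows "generate G (T \<union> S) = generate G S"
proof
  show "generate G (T \<union> S) \<subseteq> generate G S"
  proof (rule generate_subgroup_incl[OF _ generate_is_subgroup[OF assms(1)]])
    show "T \<union> S \<subseteq> generate G S"
    proof
      fix x assume "x \<in> T \<union> S"
      then have "x = \<one> \<or> x \<in> S" using assms(2) by blast
      then show "x \<in> generate G S" using generate.one[of G S] generate.incl[of x S G] by auto
    qed
  qed
  show "generate G S \<subseteq> generate G (T \<union> S)" by (rule mono_generate) auto
qed

lemma (in group) sylow_subgroup_coprime_index:
  assumes fin: "finite (carrier G)" and P: "sylow_subgroup G p P"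
  shows "coprime p (card (lcosets P))"
proof -
  have p: "Factorial_Ring.prime p" and Ps: "subgroup P G"
    and cP: "card P = p ^ multiplicity p (order G)" using P by (auto simp: sylow_subgroup_def)
  have o: "order G \<noteq> 0" using fin order_gt_0_iff_finite by simp
  have "\<not> p dvd card (lcosets P)"
  proof
    assume "p dvd card (lcosets P)"
    then have "p * p ^ multiplicity p (order G) dvd card (lcosets P) * card P"
      unfolding cP by (rule mult_dvd_mono) simp
    then have "p ^ Suc (multiplicity p (order G)) dvd order G" using l_lagrange[OF fin Ps] by simp
    then have "Suc (multiplicity p (order G)) \<le> multiplicity p (order G)"
      using o p by (intro multiplicity_geI) auto
    then show False by simp
  qed
  then show ?thesis using p prime_imp_coprime by blast
qed

lemma complements_bound:
  assumes hom: "group_hom G Q h" and surj: "h ` carrier G = carrier Q"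
    and fin: "finite (carrier G)" and ab: "abelian_normal N G" and ker: "kernel G Q h = N"
    and p: "Factorial_Ring.prime p" and cN: "card N = p ^ k" and k: "k > 0"
    and exp: "\<And>x. x \<in> N \<Longrightarrow> x [^]\<^bsub>G\<^esub> p = \<one>\<^bsub>G\<^esub>"
    and P: "sylow_subgroup G p P" and D: "d_generated G D P" and ne: "complements G N \<noteq> {}"
  shows "D > 0" "d_generated Q (D - 1) (h ` P)" "card (complements G N) \<le> card N ^ D"
    and "card N = 2 \<or> P = carrier G \<Longrightarrow> card (complements G N) \<le> card N ^ (D - 1)"
proof -
  interpret group_hom G Q h by (rule hom)
  interpret N: abelian_normal N G by (rule ab)
  let ?P = "G\<lparr>carrier := P\<rparr>"
  have Ps: "subgroup P G" and cP: "card P = p ^ multiplicity p (order G)"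
    using P by (auto simp: sylow_subgroup_def)
  have PG: "P \<subseteq> carrier G" using Ps by (rule subgroup.subset)
  have NP: "N \<subseteq> P" using sylow_subgroup_image(2)[OF fin surj P, of k] ker cN by simp
  interpret P: group ?P using subgroup.subgroup_is_group[OF Ps G.is_group] .
  obtain S where S: "S \<subseteq> carrier G" "finite S" "card S \<le> D" "generate G S = P"
    using D by (auto simp: d_generated_def)
  have SP: "S \<subseteq> P" using S(4) generate.incl[of _ S G] by blast
  obtain K where K: "K \<in> complements G N" using ne by blast
  then have Ks: "subgroup K G" and KN: "K \<inter> N = {\<one>\<^bsub>G\<^esub>}" and NK: "N <#>\<^bsub>G\<^esub> K = carrier G"
    by (auto simp: complements_def)
  have "card N > 1" using cN one_less_power[OF prime_gt_1_nat[OF p] k] by simp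
  obtain S' where S': "finite S'" "S' \<subseteq> P" "card S' < card S" "generate ?P (N \<union> S') = P"
  proof (rule P.p_group_drop_generator[OF p, of "multiplicity p (order G)" N "P \<inter> K" S])
    show "order ?P = p ^ multiplicity p (order G)" using cP by (simp add: order_def)
    show "N \<lhd> ?P" using G.normal_restrict_supergroup[OF Ps N.normal_axioms NP] .
    show "subgroup (P \<inter> K) ?P"
      using G.subgroup_incl[OF G.subgroups_Inter_pair[OF Ps Ks] Ps] by simp
    show "P \<inter> K \<noteq> carrier ?P"
    proof
      assume "P \<inter> K = carrier ?P"
      then have "N \<subseteq> {\<one>\<^bsub>G\<^esub>}" using KN NP by auto
      then have "card N \<le> card {\<one>\<^bsub>G\<^esub>}" by (intro card_mono) auto
      then show False using \<open>card N > 1\<close> by simp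
    qed
    have "P \<subseteq> N <#>\<^bsub>G\<^esub> (P \<inter> K)"
    proof
      fix x assume x: "x \<in> P"
      then have "x \<in> N <#>\<^bsub>G\<^esub> K" using NK PG by auto
      then obtain n c where nc: "n \<in> N" "c \<in> K" "x = n \<otimes>\<^bsub>G\<^esub> c" by (auto simp: set_mult_def)
      have "c = inv\<^bsub>G\<^esub> n \<otimes>\<^bsub>G\<^esub> x"
        using nc Ks by (simp add: G.mult_inv_cancel_left subgroup.mem_carrier)
      also have "\<dots> \<in> P" using nc(1) NP x Ps by (meson subgroup.m_closed subgroup.m_inv_closed subsetD)
      finally show "x \<in> N <#>\<^bsub>G\<^esub> (P \<inter> K)" using nc by (auto simp: set_mult_def)
    qed
    moreover have "N <#>\<^bsub>G\<^esub> (P \<inter> K) \<subseteq> P"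
      using NP Ps by (auto simp: set_mult_def intro: subgroup.m_closed)
    ultimately show "N <#>\<^bsub>?P\<^esub> (P \<inter> K) = carrier ?P" by simp
    show "finite S" by (rule S(2))
    show "S \<subseteq> carrier ?P" using SP by simp
    show "generate ?P S = carrier ?P" using G.generate_consistent[OF SP Ps] S(4) by simp
  qed (use that in auto)
  have gen: "generate G (N \<union> S') = P" using G.generate_consistent[of "N \<union> S'" P] S'(2,4) NP Ps by simp
  have S'G: "S' \<subseteq> carrier G" using S'(2) PG by auto
  have D1: "card S' \<le> D - 1" and "D > 0" using S'(3) S(3) by auto
  show "D > 0" by fact
  have hN: "h ` N \<subseteq> {\<one>\<^bsub>Q\<^esub>}" using ker by (auto simp: kernel_def)
  have "h ` P = generate Q (h ` (N \<union> S'))"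
    using generate_img[of "N \<union> S'"] S'G N.subset gen by simp
  also have "\<dots> = generate Q (h ` S')"
    unfolding image_Un using hN S'G by (intro H.generate_Un_one) auto
  finally have "generate Q (h ` S') = h ` P" by simp
  moreover have "card (h ` S') \<le> D - 1" using card_image_le[OF S'(1), of h] D1 by simp
  ultimately show "d_generated Q (D - 1) (h ` P)"
    using S'(1) S'G by (auto simp: d_generated_def intro!: exI[of _ "h ` S'"])
  have cop: "coprime p (card (lcosets\<^bsub>G\<^esub> P))" by (rule G.sylow_subgroup_coprime_index[OF fin P])
  note Z = N.card_splitting_crossed_homs_le[OF fin Ps gen S'G S'(1) cop exp]
  note C = N.card_complements_le_crossed_homs[OF fin]
  have N0: "card N \<ge> 1" using \<open>card N > 1\<close> by simp
  have "card (complements G N) \<le> card N ^ Suc (card S')" using C Z(2) by linarith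
  also have "\<dots> \<le> card N ^ D" using D1 \<open>D > 0\<close> N0 by (intro power_increasing) auto
  finally show "card (complements G N) \<le> card N ^ D" .
  assume alt: "card N = 2 \<or> P = carrier G"
  \<comment> \<open>In a normal subgroup of order 2, conjugation fixes the identity and therefore
    also the only other element.\<close>
  have "(\<forall>g\<in>carrier G. \<forall>x\<in>N. g \<otimes>\<^bsub>G\<^esub> x \<otimes>\<^bsub>G\<^esub> inv\<^bsub>G\<^esub> g = x) \<or> P = carrier G"
  proof (cases "P = carrier G")
    case False
    then have "card N = 2" using alt by simp
    then obtain a b where ab: "N = {a, b}" "a \<noteq> b" by (auto simp: card_2_iff)
    have one: "\<one>\<^bsub>G\<^esub> \<in> N" using N.is_subgroup by (rule subgroup.one_closed)
    have "g \<otimes>\<^bsub>G\<^esub> x \<otimes>\<^bsub>G\<^esub> inv\<^bsub>G\<^esub> g = x" if g: "g \<in> carrier G" and x: "x \<in> N" for g x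
    proof (cases "x = \<one>\<^bsub>G\<^esub>")
      case True then show ?thesis using g by simp
    next
      case False
      have xc: "x \<in> carrier G" using x by simp
      have "g \<otimes>\<^bsub>G\<^esub> x \<otimes>\<^bsub>G\<^esub> inv\<^bsub>G\<^esub> g \<noteq> \<one>\<^bsub>G\<^esub>"
      proof
        assume "g \<otimes>\<^bsub>G\<^esub> x \<otimes>\<^bsub>G\<^esub> inv\<^bsub>G\<^esub> g = \<one>\<^bsub>G\<^esub>"
        then have "g \<otimes>\<^bsub>G\<^esub> x = g" using g xc by (metis G.inv_closed G.inv_equality G.inv_inv G.m_closed)
        then show False using False g xc by simp
      qed
      moreover have "g \<otimes>\<^bsub>G\<^esub> x \<otimes>\<^bsub>G\<^esub> inv\<^bsub>G\<^esub> g \<in> N" using g x by simp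
      ultimately show ?thesis using ab one x False by auto
    qed
    then show ?thesis by blast
  qed simp
  then have "card (complements G N) \<le> card N ^ card S'" using C Z(3) by linarith
  also have "\<dots> \<le> card N ^ (D - 1)" using D1 N0 by (intro power_increasing) auto
  finally show "card (complements G N) \<le> card N ^ (D - 1)" .
qed

lemma prime_factor_bound_01:
  assumes "Factorial_Ring.prime p" "m \<le> n" "p = 2 \<or> m < n"
  shows "0 \<le> prime_factor_bound p m n" "prime_factor_bound p m n \<le> 1"
proof -
  have *: "0 \<le> 1 - real p ^ (i + (if p = 2 then 0 else 1)) / real p ^ n \<and>
     1 - real p ^ (i + (if p = 2 then 0 else 1)) / real p ^ n \<le> 1" if "i < m" for i
  proof -
    have "p \<ge> 1" using assms(1) by (rule prime_ge_1_nat)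
    then have "real p ^ (i + (if p = 2 then 0 else 1)) \<le> real p ^ n"
      using that assms by (intro power_increasing) auto
    then show ?thesis using \<open>p \<ge> 1\<close> by (simp add: field_simps)
  qed
  show "0 \<le> prime_factor_bound p m n" unfolding prime_factor_bound_def using * by (intro prod_nonneg) auto
  show "prime_factor_bound p m n \<le> 1" unfolding prime_factor_bound_def using * by (intro prod_le_1) auto
qed

text \<open>Reduces the comparison of the fraction of failing lifts with one factor of
  \<open>prime_factor_bound\<close> to an inequality between exponents of \<open>p\<close>.\<close>

lemma power_ratio_le:
  assumes p: "p > (1::nat)" and c: "c \<le> (p ^ k) ^ x" and e: "k * x + n \<le> y + k * n"
  shows "real c / real (p ^ k) ^ n \<le> real p ^ y / real p ^ n"
proof -
  have "real c * real p ^ n \<le> real ((p ^ k) ^ x) * real p ^ n"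
    using c by (intro mult_right_mono) (simp_all only: of_nat_le_iff zero_le_power of_nat_0_le_iff)
  also have "\<dots> = real p ^ (k * x + n)" by (simp add: power_mult power_add)
  also have "\<dots> \<le> real p ^ (y + k * n)" using p e by (intro power_increasing) auto
  also have "\<dots> = real p ^ y * real (p ^ k) ^ n" by (simp add: power_mult power_add)
  finally show ?thesis using p by (simp add: divide_le_eq pos_le_divide_eq field_simps)
qed

text \<open>Asking for one \<open>D p\<close>-generated Sylow subgroup per prime makes the notion pass to quotients
  without conjugacy of Sylow subgroups.  The case \<open>D p = n\<close> is allowed only for 2-groups.\<close>

definition sylow_rank_data :: "('a, 'b) monoid_scheme \<Rightarrow> nat set \<Rightarrow> (nat \<Rightarrow> nat) \<Rightarrow> nat \<Rightarrow> bool" where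
  "sylow_rank_data G S D n \<longleftrightarrow>
     group G \<and> finite (carrier G) \<and> solvable G \<and>
     (\<forall>p. Factorial_Ring.prime p \<and> p dvd order G \<longrightarrow> p \<in> S) \<and>
     (\<forall>p\<in>S. \<exists>P. sylow_subgroup G p P \<and> d_generated G (D p) P) \<and>
     (\<forall>p\<in>S. D p \<le> n) \<and> ((\<forall>p\<in>S. D p < n) \<or> S = {2})"

lemma gen_prob_trivial:
  assumes "group G" "carrier G = {\<one>\<^bsub>G\<^esub>}"
  shows "gen_prob G n = 1"
proof -
  interpret group G by fact
  have "generate G (f ` {0..<n}) = carrier G" if "f \<in> {0..<n} \<rightarrow>\<^sub>E carrier G" for f
  proof -
    have "f ` {0..<n} \<subseteq> {\<one>\<^bsub>G\<^esub>}" using that assms(2) by auto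
    then have "generate G (f ` {0..<n}) \<subseteq> generate G {\<one>\<^bsub>G\<^esub>}" by (rule mono_generate)
    then show ?thesis using generate_one generate.one[of G "f ` {0..<n}"] assms(2) by auto
  qed
  then have "generating_tuples G n = {0..<n} \<rightarrow>\<^sub>E carrier G" by (auto simp: generating_tuples_def)
  then show ?thesis using assms(2) by (simp add: gen_prob_eq order_def card_PiE)
qed

lemma gen_prob_nonneg: "gen_prob G n \<ge> 0"
  by (simp add: gen_prob_def)

text \<open>The induction step stands alone because \<open>G\<close> may carry further record fields
  while its quotients are plain monoids; the induction runs over the latter, and the step is applied
  once more to \<open>G\<close>. Only the rank at the prime of the chosen chief factor changes in
  passing to the quotient, and only if there is a complement.\<close>

lemma gen_prob_lower_bound_step:
  fixes G :: "('a, 'b) monoid_scheme"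
  assumes S: "finite S" "\<And>p. p \<in> S \<Longrightarrow> Factorial_Ring.prime p"
    and G: "sylow_rank_data G S D n"
    and IH: "\<And>(Q :: 'a monoid) D'. \<lbrakk>order Q < order G; sylow_rank_data Q S D' n\<rbrakk> \<Longrightarrow>
        (\<Prod>p\<in>S. prime_factor_bound p (D' p) n) \<le> gen_prob Q n"
  shows "(\<Prod>p\<in>S. prime_factor_bound p (D p) n) \<le> gen_prob G n"
proof -
  interpret group G using G by (simp add: sylow_rank_data_def)
  have fin: "finite (carrier G)" and solv: "solvable G"
    and primes: "\<And>p. \<lbrakk>Factorial_Ring.prime p; p dvd order G\<rbrakk> \<Longrightarrow> p \<in> S"
    and syl: "\<And>p. p \<in> S \<Longrightarrow> \<exists>P. sylow_subgroup G p P \<and> d_generated G (D p) P"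
    and Dn: "\<And>p. p \<in> S \<Longrightarrow> D p \<le> n" and alt: "(\<forall>p\<in>S. D p < n) \<or> S = {2}"
    using G by (auto simp: sylow_rank_data_def)
  show ?thesis
  proof (cases "carrier G = {\<one>\<^bsub>G\<^esub>}")
    case True
    have "(\<Prod>p\<in>S. prime_factor_bound p (D p) n) \<le> 1"
      using prime_factor_bound_01 S(2) Dn alt by (intro prod_le_1) auto
    then show ?thesis using gen_prob_trivial[OF is_group True] by simp
  next
    case False
    obtain N p k where ab: "abelian_normal N G" and p: "Factorial_Ring.prime (p::nat)"
      and cN: "card N = p ^ k" and k: "k > 0" and exp: "\<And>x. x \<in> N \<Longrightarrow> x [^]\<^bsub>G\<^esub> p = \<one>\<^bsub>G\<^esub>"
      and min: "\<And>M. M \<lhd> G \<Longrightarrow> M \<subseteq> N \<Longrightarrow> M = {\<one>\<^bsub>G\<^esub>} \<or> M = N"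
      using solvable_minimal_normal[OF solv fin False] by metis
    interpret N: abelian_normal N G by (rule ab)
    obtain Q :: "'a monoid" and h where hom: "group_hom G Q h"
      and surj: "h ` carrier G = carrier Q" and ker: "kernel G Q h = N"
      using N.quotient_on_same_type by metis
    interpret h: group_hom G Q h by (rule hom)
    have ordG: "order G = order Q * p ^ k" using h.order_eq_order_kernel[OF surj fin] ker cN by simp
    have p1: "p > 1" using p by (rule prime_gt_1_nat)
    have finQ: "finite (carrier Q)" using fin surj by (metis finite_imageI)
    have oQ: "order Q > 0" using finQ by (simp add: h.H.order_gt_0_iff_finite)
    have lt: "order Q < order G" unfolding ordG using oQ one_less_power[OF p1 k] by simp
    have pS: "p \<in> S" using primes[OF p] ordG k by simp
    have solvQ: "solvable Q" using h.surj_hom_imp_solvable[OF surj solv] .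
    have primesQ: "q \<in> S" if "Factorial_Ring.prime q" "q dvd order Q" for q
      using primes[OF that(1)] that(2) ordG by simp
    have img: "\<exists>P'. sylow_subgroup Q q P' \<and> d_generated Q m P'"
      if sg: "sylow_subgroup G q P" and dg: "d_generated G m P" for q m P
    proof -
      obtain T where T: "T \<subseteq> carrier G" "finite T" "card T \<le> m" "generate G T = P"
        using dg by (auto simp: d_generated_def)
      have "generate Q (h ` T) = h ` P" using h.generate_img[OF T(1)] T(4) by simp
      moreover have "card (h ` T) \<le> m" using card_image_le[OF T(2), of h] T(3) by simp
      ultimately have "d_generated Q m (h ` P)"
        using T by (auto simp: d_generated_def intro!: exI[of _ "h ` T"])
      then show ?thesis using h.sylow_subgroup_image(1)[OF fin surj sg] by blast
    qed
    note gas = gaschuetz_lower_bound[OF hom surj fin ab ker min, of n]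
    show ?thesis
    proof (cases "complements G N = {}")
      case True
      \<comment> \<open>Without complements no lift of a generating tuple fails, so no factor has to
        be paid and the ranks may stay as they are.\<close>
      have "sylow_rank_data Q S D n"
        unfolding sylow_rank_data_def
      proof (intro conjI allI impI ballI)
        show "\<exists>P. sylow_subgroup Q q P \<and> d_generated Q (D q) P" if "q \<in> S" for q
          using syl[OF that] img by blast
      qed (use h.H.is_group finQ solvQ primesQ Dn alt in auto)
      then have "(\<Prod>p\<in>S. prime_factor_bound p (D p) n) \<le> gen_prob Q n" using IH[OF lt] by blast
      also have "\<dots> \<le> gen_prob G n" using gas True by simp
      finally show ?thesis .
    next
      case False
      obtain P where P: "sylow_subgroup G p P" "d_generated G (D p) P" using syl[OF pS] by blast
      note cb = complements_bound[OF hom surj fin ab ker p cN k exp P False]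
      define D' where "D' = D(p := D p - 1)"
      have "sylow_rank_data Q S D' n"
        unfolding sylow_rank_data_def
      proof (intro conjI allI impI ballI)
        fix q assume q: "q \<in> S"
        show "\<exists>P. sylow_subgroup Q q P \<and> d_generated Q (D' q) P"
        proof (cases "q = p")
          case True
          then show ?thesis using cb(2) h.sylow_subgroup_image(1)[OF fin surj P(1)] by (auto simp: D'_def)
        next
          case False
          then show ?thesis using syl[OF q] img by (auto simp: D'_def)
        qed
        show "D' q \<le> n" using Dn[OF q] by (auto simp: D'_def)
      next
        show "(\<forall>p\<in>S. D' p < n) \<or> S = {2}" using alt pS by (auto simp: D'_def)
      qed (use h.H.is_group finQ solvQ primesQ in auto)
      then have IHQ: "(\<Prod>p\<in>S. prime_factor_bound p (D' p) n) \<le> gen_prob Q n" using IH[OF lt] by blast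
      \<comment> \<open>\<open>l\<close> is the last factor, with index \<open>D p - 1\<close>, of
        the product \<open>prime_factor_bound p (D p) n\<close>; it is the one lost when the rank at
        \<open>p\<close> drops by one.\<close>
      define e where "e = (if p = 2 then 0 else 1 :: nat)"
      define l where "l = 1 - real p ^ (D p - 1 + e) / real p ^ n"
      have Dp: "0 < D p" "D p \<le> n" using cb(1) Dn[OF pS] by auto
      have "real (card (complements G N)) / real (card N) ^ n \<le> real p ^ (D p - 1 + e) / real p ^ n"
      \<comment> \<open>For odd \<open>p\<close> the shift \<open>e = 1\<close> pays for the
        exponent \<open>D p\<close> in the number of complements. For \<open>p = 2\<close> there is
        no shift: either the exponent drops to \<open>D p - 1\<close>, or \<open>k \<ge> 2\<close>
        and \<open>D p < n\<close>, and then \<open>(k - 1) * (n - D p) \<ge> 1\<close> makes up for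
        it.\<close>
      proof (cases "p = 2 \<and> (k = 1 \<or> P = carrier G)")
        case True
        then have "card (complements G N) \<le> card N ^ (D p - 1)" using cb(4) cN by auto
        moreover have "k * (D p - 1) + n \<le> D p - 1 + e + k * n"
        proof -
          obtain j where j: "k = Suc j" using k by (cases k) auto
          have "j * (D p - 1) \<le> j * n" using Dp by (intro mult_left_mono) auto
          then show ?thesis unfolding j mult_Suc by linarith
        qed
        ultimately show ?thesis using power_ratio_le[OF p1] cN by simp
      next
        case F: False
        have "k * D p + n \<le> D p - 1 + e + k * n"
        proof (cases "p = 2")
          case True
          \<comment> \<open>Equality would force \<open>S = {2}\<close>; then \<open>G\<close> is a
            2-group and equals its Sylow subgroup, which this case excludes.\<close>
          have "D p < n"
          proof (rule ccontr)
            assume "\<not> D p < n"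
            then have S2: "S = {2}" using alt pS by auto
            have oG: "order G \<noteq> 0" using oQ lt by simp
            have "card P = order G"
            proof -
              obtain r where r: "order G = 2 ^ multiplicity 2 (order G) * r" "\<not> 2 dvd r"
                using multiplicity_decompose'[of "order G" 2] oG by auto
              have "r = 1"
              proof (rule ccontr)
                assume "r \<noteq> 1"
                then obtain q where "Factorial_Ring.prime q" "q dvd r" using prime_factor_nat by blast
                then have "q \<in> S" using primes[of q] r(1) by (metis dvd_mult)
                then show False using r(2) \<open>q dvd r\<close> S2 by simp
              qed
              then show ?thesis using r(1) P(1) True by (simp add: sylow_subgroup_def)
            qed
            then have "P = carrier G"
              using P(1) fin by (intro card_subset_eq) (auto simp: sylow_subgroup_def order_def dest: subgroup.subset)
            then show False using F True by simp
          qed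
          obtain j where j: "k = Suc (Suc j)" using k F True by (cases k; cases "k - 1") auto
          have "j * D p \<le> j * n" using Dp by (intro mult_left_mono) auto
          then show ?thesis using \<open>D p < n\<close> Dp unfolding j mult_Suc by linarith
        next
          case False
          obtain j where j: "k = Suc j" using k by (cases k) auto
          have "j * D p \<le> j * n" using Dp by (intro mult_left_mono) auto
          moreover have "e = 1" using False by (simp add: e_def)
          ultimately show ?thesis using Dp unfolding j mult_Suc by linarith
        qed
        then show ?thesis using power_ratio_le[OF p1, of _ k "D p"] cb(3) cN by simp
      qed
      then have le: "l \<le> 1 - real (card (complements G N)) / real (card N) ^ n" by (simp add: l_def)
      have l0: "0 \<le> l"
      proof -
        have "real p ^ (D p - 1 + e) \<le> real p ^ n" using p1 Dp by (intro power_increasing) (auto simp: e_def)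
        then show ?thesis using p1 by (simp add: l_def field_simps)
      qed
      have "prime_factor_bound p (D p) n = prime_factor_bound p (D' p) n * l"
      proof -
        obtain m where "D p = Suc m" using Dp by (cases "D p") auto
        then show ?thesis by (simp add: prime_factor_bound_def D'_def l_def e_def)
      qed
      moreover have "(\<Prod>q\<in>S - {p}. prime_factor_bound q (D q) n) = (\<Prod>q\<in>S - {p}. prime_factor_bound q (D' q) n)"
        by (intro prod.cong) (auto simp: D'_def)
      ultimately have "(\<Prod>q\<in>S. prime_factor_bound q (D q) n) = (\<Prod>q\<in>S. prime_factor_bound q (D' q) n) * l"
        using prod.remove[OF S(1) pS, of "\<lambda>q. prime_factor_bound q (D q) n"]
          prod.remove[OF S(1) pS, of "\<lambda>q. prime_factor_bound q (D' q) n"] by simp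
      also have "\<dots> \<le> gen_prob Q n * l" using IHQ l0 by (rule mult_right_mono)
      also have "\<dots> \<le> gen_prob Q n * (1 - real (card (complements G N)) / real (card N) ^ n)"
        using le gen_prob_nonneg by (rule mult_left_mono)
      also have "\<dots> \<le> gen_prob G n" by (rule gas)
      finally show ?thesis .
    qed
  qed
qed

lemma gen_prob_lower_bound:
  fixes G :: "('a, 'b) monoid_scheme"
  assumes S: "finite S" "\<And>p. p \<in> S \<Longrightarrow> Factorial_Ring.prime p"
    and G: "sylow_rank_data G S D n"
  shows "(\<Prod>p\<in>S. prime_factor_bound p (D p) n) \<le> gen_prob G n"
proof (rule gen_prob_lower_bound_step[OF S(1) _ G])
  show "Factorial_Ring.prime p" if "p \<in> S" for p using that by (rule S(2))
  fix Q :: "'a monoid" and D'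
  assume "sylow_rank_data Q S D' n"
  then show "(\<Prod>p\<in>S. prime_factor_bound p (D' p) n) \<le> gen_prob Q n"
  proof (induction "order Q" arbitrary: Q D' rule: less_induct)
    case less
    show ?case by (rule gen_prob_lower_bound_step[OF S(1) _ less.prems]) (auto intro: S(2) less.hyps)
  qed
qed

section \<open>Counting linearly independent families modulo q\<close>

definition vectors :: "nat \<Rightarrow> nat \<Rightarrow> (nat \<Rightarrow> nat) set" where
  "vectors q n = {0..<n} \<rightarrow>\<^sub>E {0..<q}"

text \<open>Coefficients are restricted to the representatives below \<open>q\<close>, so that
  vanishing modulo \<open>q\<close> is the same as being 0.\<close>

definition lin_indep :: "nat \<Rightarrow> nat \<Rightarrow> nat \<Rightarrow> (nat \<Rightarrow> nat \<Rightarrow> nat) \<Rightarrow> bool" where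
  "lin_indep q n m u \<longleftrightarrow> (\<forall>c :: nat \<Rightarrow> nat. (\<forall>i<m. c i < q) \<longrightarrow>
     (\<forall>j<n. q dvd (\<Sum>i<m. c i * u i j)) \<longrightarrow> (\<forall>i<m. c i = 0))"

lemma lin_indepD:
  assumes "lin_indep q n m u" "\<And>i. i < m \<Longrightarrow> c i < q"
    "\<And>j. j < n \<Longrightarrow> q dvd (\<Sum>i<m. c i * u i j)" "i < m"
  shows "c i = 0"
  using assms(1)[unfolded lin_indep_def, THEN spec, of c] assms(2-4) by simp

text \<open>\<open>B\<close> confines the first row. Modulo 2 it is the set of all vectors; modulo
  an odd prime it is a singleton, because there the first row has already been chosen.\<close>

definition indep_families :: "nat \<Rightarrow> nat \<Rightarrow> nat \<Rightarrow> (nat \<Rightarrow> nat) set \<Rightarrow> (nat \<Rightarrow> nat \<Rightarrow> nat) set" where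
  "indep_families q n m B = {u \<in> {0..<m} \<rightarrow>\<^sub>E vectors q n. lin_indep q n m u \<and> u 0 \<in> B}"

lemma finite_vectors [simp]: "finite (vectors q n)"
  unfolding vectors_def by (intro finite_PiE) auto

lemma card_vectors [simp]: "card (vectors q n) = q ^ n"
  by (simp add: vectors_def card_PiE)

lemma finite_indep_families [simp]: "finite (indep_families q n m B)"
  by (rule finite_subset[of _ "{0..<m} \<rightarrow>\<^sub>E vectors q n"])
     (auto simp: indep_families_def intro: finite_PiE)

definition lin_span :: "nat \<Rightarrow> nat \<Rightarrow> nat \<Rightarrow> (nat \<Rightarrow> nat \<Rightarrow> nat) \<Rightarrow> (nat \<Rightarrow> nat) set" where
  "lin_span q n m u = (\<lambda>c. \<lambda>j\<in>{0..<n}. (\<Sum>i<m. c i * u i j) mod q) ` ({0..<m} \<rightarrow>\<^sub>E {0..<q})"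

lemma lin_span_subset: "q > 0 \<Longrightarrow> lin_span q n m u \<subseteq> vectors q n"
  by (auto simp: lin_span_def vectors_def)

lemma card_lin_span:
  assumes q: "q > 0" and u: "lin_indep q n m u"
  shows "card (lin_span q n m u) = q ^ m"
proof -
  have "inj_on (\<lambda>c. \<lambda>j\<in>{0..<n}. (\<Sum>i<m. c i * u i j) mod q) ({0..<m} \<rightarrow>\<^sub>E {0..<q})"
  proof (rule inj_onI)
    fix c c' assume c: "c \<in> {0..<m} \<rightarrow>\<^sub>E {0..<q}" and c': "c' \<in> {0..<m} \<rightarrow>\<^sub>E {0..<q}"
      and eq: "(\<lambda>j\<in>{0..<n}. (\<Sum>i<m. c i * u i j) mod q) = (\<lambda>j\<in>{0..<n}. (\<Sum>i<m. c' i * u i j) mod q)"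
    \<comment> \<open>The difference \<open>c i - c' i\<close> modulo \<open>q\<close>, written so
      that it is again an admissible coefficient. Equal combinations make it the coefficient vector
      of a relation.\<close>
    define e where "e i = (c i + (q - c' i)) mod q" for i
    have "q dvd (\<Sum>i<m. e i * u i j)" if j: "j < n" for j
    proof -
      have eqj: "(\<Sum>i<m. c i * u i j) mod q = (\<Sum>i<m. c' i * u i j) mod q"
        using fun_cong[OF eq, of j] j by simp
      have "[\<Sum>i<m. int (e i) * int (u i j) = \<Sum>i<m. (int (c i) - int (c' i)) * int (u i j)] (mod int q)"
      proof (intro cong_sum cong_mult cong_refl)
        fix i assume "i \<in> {..<m}"
        then have "c' i < q" using PiE_mem[OF c', of i] by simp
        then have "c' i \<le> q" by simp
        have "[int (e i) = int (c i + (q - c' i))] (mod int q)"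
          unfolding cong_int_iff by (simp add: e_def cong_def)
        also have "int (c i + (q - c' i)) = int (c i) - int (c' i) + int q"
          using \<open>c' i \<le> q\<close> by (simp add: of_nat_diff)
        also have "[\<dots> = int (c i) - int (c' i)] (mod int q)" by (simp add: cong_def)
        finally show "[int (e i) = int (c i) - int (c' i)] (mod int q)" .
      qed
      also have "(\<Sum>i<m. (int (c i) - int (c' i)) * int (u i j)) =
         int (\<Sum>i<m. c i * u i j) - int (\<Sum>i<m. c' i * u i j)"
        by (simp add: left_diff_distrib sum_subtractf)
      also have "[\<dots> = 0] (mod int q)"
        unfolding cong_diff_iff_cong_0 cong_int_iff using eqj by (simp only: cong_def)
      finally have "int q dvd (\<Sum>i<m. int (e i) * int (u i j))" by (simp add: cong_0_iff)
      then have "int q dvd int (\<Sum>i<m. e i * u i j)" by simp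
      then show ?thesis by (simp only: of_nat_dvd_iff)
    qed
    moreover have "e i < q" for i using q by (simp add: e_def)
    ultimately have e0: "e i = 0" if "i < m" for i
      using lin_indepD[OF u, of e i] that by simp
    have "c i = c' i" if i: "i \<in> {0..<m}" for i
    proof -
      have l: "c i < q" "c' i < q" using c c' i by (auto simp: PiE_iff)
      have "(c i + (q - c' i)) mod q = 0" using e0[of i] i by (simp add: e_def)
      then obtain t where t: "c i + (q - c' i) = q * t" by blast
      have "0 < q * t" "q * t < q * 2" using l t by linarith+
      then have "0 < t" "t < 2" by (auto simp only: mult_less_cancel1 nat_0_less_mult_iff)
      then have "t = 1" by linarith
      then show ?thesis using t l by simp
    qed
    then show "c = c'" by (rule PiE_ext[OF c c'])
  qed
  then have "card (lin_span q n m u) = card ({0..<m} \<rightarrow>\<^sub>E {0..<q})"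
    unfolding lin_span_def by (rule card_image)
  then show ?thesis by (simp add: card_PiE)
qed

lemma lin_indep_restrict:
  assumes "q > 0" "lin_indep q n (Suc m) u"
  shows "lin_indep q n m (restrict u {0..<m})"
  unfolding lin_indep_def
proof (intro allI impI)
  fix c :: "nat \<Rightarrow> nat" and i
  assume c: "\<forall>i<m. c i < q" and d: "\<forall>j<n. q dvd (\<Sum>i<m. c i * restrict u {0..<m} i j)" and i: "i < m"
  let ?c = "\<lambda>i. if i < m then c i else 0"
  have "(\<Sum>i<Suc m. ?c i * u i j) = (\<Sum>i<m. c i * restrict u {0..<m} i j)" for j by simp
  then have "q dvd (\<Sum>i<Suc m. ?c i * u i j)" if "j < n" for j using d that by simp
  moreover have "?c i < q" for i using c assms(1) by simp
  ultimately have "?c i = 0" by (intro lin_indepD[OF assms(2), where c = ?c]) (use i in simp_all)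
  then show "c i = 0" using i by simp
qed

lemma lin_indep_not_in_span:
  assumes q: "q > 1" and u: "lin_indep q n (Suc m) u"
  shows "u m \<notin> lin_span q n m (restrict u {0..<m})"
proof
  assume "u m \<in> lin_span q n m (restrict u {0..<m})"
  then obtain c where c: "c \<in> {0..<m} \<rightarrow>\<^sub>E {0..<q}"
    and um: "u m = (\<lambda>j\<in>{0..<n}. (\<Sum>i<m. c i * restrict u {0..<m} i j) mod q)"
    by (auto simp: lin_span_def)
  \<comment> \<open>The coefficient \<open>q - 1\<close> plays the part of -1: it moves the last row
    to the other side of the equation that expresses it by the others.\<close>
  let ?c = "\<lambda>i. if i < m then c i else q - 1"
  have "q dvd (\<Sum>i<Suc m. ?c i * u i j)" if j: "j < n" for j
  proof -
    have "u m j = (\<Sum>i<m. c i * u i j) mod q" using um j by simp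
    then have "[(\<Sum>i<m. c i * u i j) + (q - 1) * u m j = u m j + (q - 1) * u m j] (mod q)"
      by (intro cong_add cong_refl) (simp add: cong_def)
    also have "u m j + (q - 1) * u m j = q * u m j" using q by (cases q) auto
    finally have "q dvd (\<Sum>i<m. c i * u i j) + (q - 1) * u m j" by (metis cong_dvd_iff dvd_triv_left)
    then show ?thesis by simp
  qed
  moreover have "?c i < q" if "i < Suc m" for i using c q by (auto simp: PiE_iff)
  ultimately have "?c m = 0" by (intro lin_indepD[OF u, where c = ?c]) simp_all
  then show False using q by simp
qed

definition zero_vector :: "nat \<Rightarrow> nat \<Rightarrow> nat" where
  "zero_vector n = (\<lambda>j\<in>{0..<n}. 0)"

text \<open>A row with index \<open>i\<close> has to avoid the span of the \<open>i\<close> rows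
  before it, which has exactly \<open>q^i\<close> elements. The first row is counted separately, as
  a nonzero element of \<open>B\<close>.\<close>

lemma card_indep_families_le:
  assumes q: "q > 1" and B: "B \<subseteq> vectors q n"
  shows "card (indep_families q n (Suc m) B) \<le>
    card (B - {zero_vector n}) * (\<Prod>i=1..m. q ^ n - q ^ i)"
proof (induction m)
  case 0
  have "card (indep_families q n (Suc 0) B) \<le> card (B - {zero_vector n})"
  proof (rule card_inj_on_le)
    show "inj_on (\<lambda>u. u 0) (indep_families q n (Suc 0) B)"
    proof (rule inj_onI)
      fix u w assume "u \<in> indep_families q n (Suc 0) B" "w \<in> indep_families q n (Suc 0) B" "u 0 = w 0"
      then show "u = w" by (intro PiE_ext[of u "{0..<Suc 0}" "\<lambda>_. vectors q n" w]) (simp_all add: indep_families_def)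
    qed
    show "(\<lambda>u. u 0) ` indep_families q n (Suc 0) B \<subseteq> B - {zero_vector n}"
    proof
      fix w assume "w \<in> (\<lambda>u. u 0) ` indep_families q n (Suc 0) B"
      then obtain u where u: "u 0 \<in> B" "w = u 0" "lin_indep q n (Suc 0) u"
        by (auto simp: indep_families_def)
      have "u 0 \<noteq> zero_vector n"
      proof
        assume "u 0 = zero_vector n"
        then have "(1::nat) = 0"
          by (intro lin_indepD[OF u(3), where c = "\<lambda>_. 1"]) (use q in \<open>simp_all add: zero_vector_def\<close>)
        then show False by simp
      qed
      then show "w \<in> B - {zero_vector n}" using u by simp
    qed
    show "finite (B - {zero_vector n})" using B finite_subset finite_vectors by blast
  qed
  then show ?case by simp
next
  case (Suc m)
  let ?A = "indep_families q n (Suc m) B"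
  let ?S = "SIGMA u : ?A. vectors q n - lin_span q n (Suc m) u"
  have "card (indep_families q n (Suc (Suc m)) B) \<le> card ?S"
  proof (rule card_inj_on_le)
    let ?f = "\<lambda>u. (restrict u {0..<Suc m}, u (Suc m))"
    show "inj_on ?f (indep_families q n (Suc (Suc m)) B)"
    proof (rule inj_onI)
      fix u w assume u: "u \<in> indep_families q n (Suc (Suc m)) B"
        and w: "w \<in> indep_families q n (Suc (Suc m)) B" and eq: "?f u = ?f w"
      have "u i = w i" if "i \<in> {0..<Suc (Suc m)}" for i
      proof (cases "i = Suc m")
        case False
        then have "i \<in> {0..<Suc m}" using that by auto
        moreover have "restrict u {0..<Suc m} i = restrict w {0..<Suc m} i" using eq by simp
        ultimately show ?thesis by simp
      qed (use eq in simp)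
      then show "u = w" using u w
        by (intro PiE_ext[of u "{0..<Suc (Suc m)}" "\<lambda>_. vectors q n" w]) (simp_all add: indep_families_def)
    qed
    show "?f ` indep_families q n (Suc (Suc m)) B \<subseteq> ?S"
    proof
      fix z assume "z \<in> ?f ` indep_families q n (Suc (Suc m)) B"
      then obtain u where z: "z = ?f u" and u: "u \<in> {0..<Suc (Suc m)} \<rightarrow>\<^sub>E vectors q n"
        "lin_indep q n (Suc (Suc m)) u" "u 0 \<in> B" by (auto simp: indep_families_def)
      have "restrict u {0..<Suc m} \<in> ?A"
        using lin_indep_restrict[OF _ u(2)] q u(1,3) by (simp add: indep_families_def PiE_iff)
      moreover have "u (Suc m) \<in> vectors q n" using u(1) by (rule PiE_mem) simp
      ultimately show "z \<in> ?S" using z lin_indep_not_in_span[OF q u(2)] by simp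
    qed
    show "finite ?S" by simp
  qed
  also have "card ?S = (\<Sum>u\<in>?A. card (vectors q n - lin_span q n (Suc m) u))" by simp
  also have "\<dots> = (\<Sum>u\<in>?A. q ^ n - q ^ Suc m)"
  proof (rule sum.cong)
    fix u assume "u \<in> ?A"
    then have "card (lin_span q n (Suc m) u) = q ^ Suc m"
      using card_lin_span[of q n "Suc m" u] q by (simp add: indep_families_def)
    then show "card (vectors q n - lin_span q n (Suc m) u) = q ^ n - q ^ Suc m"
      using lin_span_subset[of q n "Suc m" u] q
      by (subst card_Diff_subset) (simp_all add: finite_subset)
  qed simp
  also have "\<dots> = card ?A * (q ^ n - q ^ Suc m)" by simp
  also have "\<dots> \<le> card (B - {zero_vector n}) * (\<Prod>i=1..m. q ^ n - q ^ i) * (q ^ n - q ^ Suc m)"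
    using Suc by (intro mult_right_mono) auto
  finally show ?case by (simp add: mult.assoc)
qed

section \<open>Independence of the coordinates of a generating tuple\<close>

text \<open>\<open>L\<close> obeys the rule of a crossed homomorphism to the integers modulo
  \<open>m\<close>, with the action given by the sign \<open>\<sigma>\<close>. Like a kernel, its
  zero set is a subgroup, since a sign does not affect divisibility.\<close>

lemma (in group) crossed_functional_subgroup:
  fixes L \<sigma> :: "'a \<Rightarrow> int"
  assumes L: "\<And>x y. \<lbrakk>x \<in> carrier G; y \<in> carrier G\<rbrakk> \<Longrightarrow> [L (x \<otimes> y) = L x + \<sigma> x * L y] (mod m)"
    and s: "\<And>x. x \<in> carrier G \<Longrightarrow> \<sigma> x = 1 \<or> \<sigma> x = - 1"
  shows "subgroup {x \<in> carrier G. m dvd L x} G"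
proof (rule subgroupI)
  have dvd_iff: "m dvd L (x \<otimes> y) \<longleftrightarrow> m dvd L x + \<sigma> x * L y"
    if "x \<in> carrier G" "y \<in> carrier G" for x y
    using L[OF that] by (rule cong_dvd_iff)
  have "[L (\<one> \<otimes> \<one>) = L \<one> + \<sigma> \<one> * L \<one>] (mod m)" by (rule L) simp_all
  then have "[L \<one> + \<sigma> \<one> * L \<one> = L \<one>] (mod m)" by (simp add: cong_sym)
  then have "m dvd \<sigma> \<one> * L \<one>" by (simp add: cong_iff_dvd_diff)
  then have one: "m dvd L \<one>" using s[OF one_closed] by auto
  then show "{x \<in> carrier G. m dvd L x} \<noteq> {}" by auto
  show "inv a \<in> {x \<in> carrier G. m dvd L x}" if "a \<in> {x \<in> carrier G. m dvd L x}" for a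
  proof -
    have a: "a \<in> carrier G" "m dvd L a" using that by auto
    have "m dvd L (a \<otimes> inv a)" using one a(1) by simp
    then have "m dvd L a + \<sigma> a * L (inv a)" using dvd_iff[of a "inv a"] a(1) by simp
    then have "m dvd \<sigma> a * L (inv a)" using a(2) by (simp add: dvd_add_right_iff)
    then show ?thesis using s[OF a(1)] a(1) by auto
  qed
  show "a \<otimes> b \<in> {x \<in> carrier G. m dvd L x}"
    if "a \<in> {x \<in> carrier G. m dvd L x}" "b \<in> {x \<in> carrier G. m dvd L x}" for a b
    using that dvd_iff[of a b] by simp
qed auto

text \<open>A relation between the rows is a combination \<open>L\<close> of the coordinates that
  vanishes on every entry of the tuple. All coordinates share the same sign, so the zero set of
  \<open>L\<close> is a subgroup and contains the whole group; evaluation at the unit elements shows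
  that every coefficient is 0.\<close>

lemma (in group) generating_tuple_coordinates_indep:
  fixes co :: "'a \<Rightarrow> nat \<Rightarrow> nat" and \<sigma> :: "'a \<Rightarrow> int"
  assumes f: "f \<in> generating_tuples G n"
    and crossed: "\<And>x y i. \<lbrakk>x \<in> carrier G; y \<in> carrier G; i < m\<rbrakk> \<Longrightarrow>
      [int (co (x \<otimes> y) i) = int (co x i) + \<sigma> x * int (co y i)] (mod int q)"
    and s: "\<And>x. x \<in> carrier G \<Longrightarrow> \<sigma> x = 1 \<or> \<sigma> x = - 1"
    and unit: "\<And>i. i < m \<Longrightarrow> \<exists>x\<in>carrier G. \<forall>j<m. co x j = (if j = i then 1 else 0)"
  shows "lin_indep q n m (\<lambda>i\<in>{0..<m}. \<lambda>j\<in>{0..<n}. co (f j) i)"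
  unfolding lin_indep_def
proof (intro allI impI)
  fix c :: "nat \<Rightarrow> nat" and i
  assume c: "\<forall>i<m. c i < q" and i: "i < m"
    and dvd: "\<forall>j<n. q dvd (\<Sum>i<m. c i * (\<lambda>i\<in>{0..<m}. \<lambda>j\<in>{0..<n}. co (f j) i) i j)"
  define L where "L x = (\<Sum>i<m. int (c i) * int (co x i))" for x
  have sub: "subgroup {x \<in> carrier G. int q dvd L x} G"
  proof (rule crossed_functional_subgroup)
    fix x y assume xy: "x \<in> carrier G" "y \<in> carrier G"
    have "[L (x \<otimes> y) = (\<Sum>i<m. int (c i) * (int (co x i) + \<sigma> x * int (co y i)))] (mod int q)"
      unfolding L_def using crossed xy by (intro cong_sum cong_mult cong_refl) auto
    also have "(\<Sum>i<m. int (c i) * (int (co x i) + \<sigma> x * int (co y i))) = L x + \<sigma> x * L y"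
      by (simp add: L_def sum.distrib sum_distrib_left algebra_simps)
    finally show "[L (x \<otimes> y) = L x + \<sigma> x * L y] (mod int q)" .
  qed (rule s)
  have fE: "f \<in> {0..<n} \<rightarrow>\<^sub>E carrier G" and gen: "generate G (f ` {0..<n}) = carrier G"
    using f by (auto simp: generating_tuples_def)
  have img: "f ` {0..<n} \<subseteq> {x \<in> carrier G. int q dvd L x}"
  proof
    fix x assume "x \<in> f ` {0..<n}"
    then obtain j where j: "j < n" "x = f j" by auto
    have "q dvd (\<Sum>i<m. c i * co (f j) i)" using dvd j(1) by simp
    then have "int q dvd int (\<Sum>i<m. c i * co (f j) i)" by (simp only: of_nat_dvd_iff)
    then have "int q dvd L x" by (simp add: L_def j(2))
    moreover have "x \<in> carrier G" unfolding j(2) using fE by (rule PiE_mem) (use j in simp)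
    ultimately show "x \<in> {x \<in> carrier G. int q dvd L x}" by simp
  qed
  have "carrier G \<subseteq> {x \<in> carrier G. int q dvd L x}"
    using generate_subgroup_incl[OF img sub] unfolding gen .
  then have all: "int q dvd L x" if "x \<in> carrier G" for x using that by blast
  obtain x where x: "x \<in> carrier G" "\<forall>j<m. co x j = (if j = i then 1 else 0)" using unit[OF i] by blast
  have "L x = (\<Sum>j<m. if j = i then int (c i) else 0)"
    unfolding L_def using x(2) by (intro sum.cong) auto
  also have "\<dots> = int (c i)" using i by simp
  finally have "q dvd c i" using all[OF x(1)] by (simp only: of_nat_dvd_iff)
  then show "c i = 0" using c i using nat_dvd_not_less[of "c i" q] by blast
qed

section \<open>Convergence of the expectation series\<close>

text \<open>A tuple that does not generate lies in some proper subgroup. The union bound over the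
  finitely many proper subgroups dominates the series by a finite sum of geometric series. Termwise
  comparison of \<open>suminf\<close> relies on this.\<close>

lemma summable_one_minus_gen_prob:
  assumes "group G" and fin: "finite (carrier G)"
  shows "summable (\<lambda>n. 1 - gen_prob G n)"
proof -
  interpret group G by fact
  define \<M> where "\<M> = {M. subgroup M G \<and> M \<noteq> carrier G}"
  have finM: "finite \<M>"
    by (rule finite_subset[of _ "Pow (carrier G)"])
       (use fin in \<open>auto simp: \<M>_def dest: subgroup.subset\<close>)
  have o: "order G > 0" using fin order_gt_0_iff_finite by simp
  have ratio: "real (card M) / real (order G) < 1" if "M \<in> \<M>" for M
  proof -
    have "M \<subset> carrier G" using that subgroup.subset unfolding \<M>_def by blast
    then have "card M < order G" using fin by (simp add: order_def psubset_card_mono)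
    then show ?thesis using o by simp
  qed
  have sum: "summable (\<lambda>n. \<Sum>M\<in>\<M>. (real (card M) / real (order G)) ^ n)"
    using ratio by (intro summable_sum summable_geometric) auto
  have "norm (1 - gen_prob G n) \<le> (\<Sum>M\<in>\<M>. (real (card M) / real (order G)) ^ n)" for n
  proof -
    let ?T = "{0..<n} \<rightarrow>\<^sub>E carrier G"
    let ?U = "generating_tuples G n"
    have finT: "finite ?T" using fin by (intro finite_PiE) auto
    have U: "?U \<subseteq> ?T" by (auto simp: generating_tuples_def)
    have cT: "card ?T = order G ^ n" by (simp add: card_PiE order_def)
    have "card (?T - ?U) \<le> card (\<Union>M\<in>\<M>. {0..<n} \<rightarrow>\<^sub>E M)"
    proof (rule card_mono)
      have "finite M" if "M \<in> \<M>" for M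
        using that fin subgroup.subset finite_subset unfolding \<M>_def by blast
      then show "finite (\<Union>M\<in>\<M>. {0..<n} \<rightarrow>\<^sub>E M)" using finM by (intro finite_UN_I finite_PiE) simp_all
      show "?T - ?U \<subseteq> (\<Union>M\<in>\<M>. {0..<n} \<rightarrow>\<^sub>E M)"
      proof
        fix f assume f: "f \<in> ?T - ?U"
        then have fc: "f ` {0..<n} \<subseteq> carrier G" by auto
        let ?M = "generate G (f ` {0..<n})"
        have "?M \<noteq> carrier G" using f by (simp add: generating_tuples_def)
        then have "?M \<in> \<M>" using generate_is_subgroup[OF fc] by (simp add: \<M>_def)
        moreover have "f \<in> {0..<n} \<rightarrow>\<^sub>E ?M"
        proof (rule PiE_I)
          show "f i \<in> ?M" if "i \<in> {0..<n}" for i using that by (intro generate.incl imageI)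
          show "f i = undefined" if "i \<notin> {0..<n}" for i using PiE_arb[OF DiffD1[OF f] that] .
        qed
        ultimately show "f \<in> (\<Union>M\<in>\<M>. {0..<n} \<rightarrow>\<^sub>E M)" by blast
      qed
    qed
    also have "\<dots> \<le> (\<Sum>M\<in>\<M>. card ({0..<n} \<rightarrow>\<^sub>E M))" using finM by (rule card_UN_le)
    also have "\<dots> = (\<Sum>M\<in>\<M>. card M ^ n)" by (simp add: card_PiE)
    finally have "card ?T \<le> (\<Sum>M\<in>\<M>. card M ^ n) + card ?U"
      unfolding card_Diff_subset[OF finite_subset[OF U finT] U] by linarith
    then have "real (card ?T) \<le> real ((\<Sum>M\<in>\<M>. card M ^ n) + card ?U)" by (simp only: of_nat_le_iff)
    then have le: "real (order G) ^ n - real (card ?U) \<le> (\<Sum>M\<in>\<M>. real (card M) ^ n)"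
      unfolding cT by simp
    have "1 - gen_prob G n = (real (order G) ^ n - real (card ?U)) / real (order G) ^ n"
      using o by (simp add: gen_prob_eq diff_divide_distrib)
    also have "\<dots> \<le> (\<Sum>M\<in>\<M>. real (card M) ^ n) / real (order G) ^ n"
      using le by (rule divide_right_mono) simp
    also have "\<dots> = (\<Sum>M\<in>\<M>. (real (card M) / real (order G)) ^ n)"
      by (simp add: sum_divide_distrib power_divide)
    finally have 1: "1 - gen_prob G n \<le> (\<Sum>M\<in>\<M>. (real (card M) / real (order G)) ^ n)" .
    have "real (card ?U) \<le> real (order G ^ n)" using card_mono[OF finT U] cT by (simp only: of_nat_le_iff)
    then have "gen_prob G n \<le> 1" using o by (simp add: gen_prob_eq divide_le_eq_1)
    then show ?thesis using 1 by simp
  qed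
  then show ?thesis by (rule summable_comparison_test'[OF sum])
qed

section \<open>The group H\<close>

type_synonym h_elem = "(nat \<Rightarrow> nat \<Rightarrow> nat) \<times> nat \<times> (nat \<Rightarrow> nat)"

lemma H_bnd_pos: "H_bnd \<pi> d p i > 0"
  by (auto simp: H_bnd_def prime_gt_0_nat)

lemma H_vbnd_pos: "H_vbnd d i > 0"
  by (simp add: H_vbnd_def)

definition H_sign :: "nat \<Rightarrow> int" where
  "H_sign k = (if k = 0 then 1 else - 1)"

lemma H_sign_add: "\<lbrakk>k < 2; l < 2\<rbrakk> \<Longrightarrow> H_sign ((k + l) mod 2) = H_sign k * H_sign l"
  by (cases "k = 0"; cases "l = 0") (auto simp: H_sign_def less_2_cases_iff)

lemma H_component_int:
  assumes "x \<le> m"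
  shows "int ((a + (if k = 0 then x else m - x)) mod m) = (int a + H_sign k * int x) mod int m"
proof (cases "k = 0")
  case True then show ?thesis by (simp add: H_sign_def zmod_int)
next
  case False
  have "int ((a + (m - x)) mod m) = (int a - int x + int m) mod int m"
    using assms by (simp add: zmod_int of_nat_diff algebra_simps)
  then show ?thesis using False by (simp add: H_sign_def)
qed

text \<open>The natural number \<open>m - x\<close> encodes \<open>-x\<close>. Over the integers
  both sides become \<open>a + s x + s t y\<close> with the signs \<open>s\<close> and
  \<open>t\<close> of \<open>k\<close> and \<open>l\<close>, because the sign is
  multiplicative.\<close>

lemma H_component_assoc:
  fixes a x y k l m :: nat
  assumes m: "m > 0" and x: "x \<le> m" and y: "y \<le> m" and k: "k < 2" "l < 2"
  shows "((a + (if k = 0 then x else m - x)) mod m + (if (k + l) mod 2 = 0 then y else m - y)) mod m =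
    (a + (if k = 0 then (x + (if l = 0 then y else m - y)) mod m
       else m - (x + (if l = 0 then y else m - y)) mod m)) mod m"
    (is "?l = ?r")
proof -
  let ?A = "(a + (if k = 0 then x else m - x)) mod m" and ?B = "(x + (if l = 0 then y else m - y)) mod m"
  have "int ?l = (int ?A + H_sign ((k + l) mod 2) * int y) mod int m"
    using y by (rule H_component_int)
  also have "int ?A = (int a + H_sign k * int x) mod int m" using x by (rule H_component_int)
  finally have l: "int ?l = (int a + H_sign k * int x + H_sign k * H_sign l * int y) mod int m"
    using H_sign_add[OF k] by (simp add: mod_add_left_eq)
  have "int ?r = (int a + H_sign k * int ?B) mod int m"
    using m by (intro H_component_int) (simp add: less_imp_le)
  also have "int ?B = (int x + H_sign l * int y) mod int m" using y by (rule H_component_int)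
  also have "(int a + H_sign k * ((int x + H_sign l * int y) mod int m)) mod int m =
    (int a + H_sign k * (int x + H_sign l * int y)) mod int m"
    by (rule mod_add_cong) (simp_all add: mod_mult_right_eq)
  finally have "int ?l = int ?r" using l by (simp add: algebra_simps)
  then show ?thesis by (simp only: of_nat_eq_iff)
qed

lemma H_carrier_iff:
  "(a, k, v) \<in> H_carrier \<pi> d \<longleftrightarrow> (\<forall>p i. a p i < H_bnd \<pi> d p i) \<and> k < 2 \<and> (\<forall>i. v i < H_vbnd d i)"
  by (simp add: H_carrier_def)

lemma H_mult_simp:
  "H_mult \<pi> d (a, k, v) (a', k', v') =
    (\<lambda>p i. (a p i + (if k = 0 then a' p i else H_bnd \<pi> d p i - a' p i)) mod H_bnd \<pi> d p i,
     (k + k') mod 2, \<lambda>i. (v i + v' i) mod H_vbnd d i)"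
  by (simp add: H_mult_def)

lemma group_H_group: "group (H_group \<pi> d)"
proof (rule groupI)
  fix x y assume "x \<in> carrier (H_group \<pi> d)" "y \<in> carrier (H_group \<pi> d)"
  then show "x \<otimes>\<^bsub>H_group \<pi> d\<^esub> y \<in> carrier (H_group \<pi> d)"
    by (cases x; cases y) (simp add: H_group_def H_carrier_iff H_mult_simp H_bnd_pos H_vbnd_pos)
next
  show "\<one>\<^bsub>H_group \<pi> d\<^esub> \<in> carrier (H_group \<pi> d)"
    by (simp add: H_group_def H_carrier_iff H_bnd_pos H_vbnd_pos)
next
  fix x y z
  assume x: "x \<in> carrier (H_group \<pi> d)" and y: "y \<in> carrier (H_group \<pi> d)" and z: "z \<in> carrier (H_group \<pi> d)"
  obtain a k v where x': "x = (a, k, v)" by (cases x)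
  obtain a' k' v' where y': "y = (a', k', v')" by (cases y)
  obtain a'' k'' v'' where z': "z = (a'', k'', v'')" by (cases z)
  have b: "a' p i \<le> H_bnd \<pi> d p i" "a'' p i \<le> H_bnd \<pi> d p i" "k < 2" "k' < 2" for p i
    using x y z by (simp_all add: x' y' z' H_group_def H_carrier_iff less_imp_le)
  show "x \<otimes>\<^bsub>H_group \<pi> d\<^esub> y \<otimes>\<^bsub>H_group \<pi> d\<^esub> z = x \<otimes>\<^bsub>H_group \<pi> d\<^esub> (y \<otimes>\<^bsub>H_group \<pi> d\<^esub> z)"
    unfolding x' y' z' H_group_def monoid.simps H_mult_simp prod.inject
  proof (intro conjI ext)
    show "((a p i + (if k = 0 then a' p i else H_bnd \<pi> d p i - a' p i)) mod H_bnd \<pi> d p i +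
        (if (k + k') mod 2 = 0 then a'' p i else H_bnd \<pi> d p i - a'' p i)) mod H_bnd \<pi> d p i =
      (a p i + (if k = 0 then (a' p i + (if k' = 0 then a'' p i else H_bnd \<pi> d p i - a'' p i)) mod H_bnd \<pi> d p i
        else H_bnd \<pi> d p i - (a' p i + (if k' = 0 then a'' p i else H_bnd \<pi> d p i - a'' p i)) mod H_bnd \<pi> d p i))
      mod H_bnd \<pi> d p i" for p i
      using H_bnd_pos b by (intro H_component_assoc) auto
    show "((k + k') mod 2 + k'') mod 2 = (k + (k' + k'') mod 2) mod 2"
      by (simp add: mod_simps add.assoc)
    show "((v i + v' i) mod H_vbnd d i + v'' i) mod H_vbnd d i = (v i + (v' i + v'' i) mod H_vbnd d i) mod H_vbnd d i" for i
      by (simp add: mod_simps add.assoc)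
  qed
next
  fix x assume x: "x \<in> carrier (H_group \<pi> d)"
  obtain a k v where x': "x = (a, k, v)" by (cases x)
  have b: "\<And>p i. a p i < H_bnd \<pi> d p i" "k < 2" "\<And>i. v i < H_vbnd d i"
    using x by (simp_all add: x' H_group_def H_carrier_iff)
  show "\<one>\<^bsub>H_group \<pi> d\<^esub> \<otimes>\<^bsub>H_group \<pi> d\<^esub> x = x"
    using b by (simp add: x' H_group_def H_mult_simp)
  \<comment> \<open>Elements with \<open>k = 1\<close> are involutions, as the inversion cancels
    \<open>a\<close>. For \<open>k = 0\<close> only \<open>a\<close> has to be negated; the outer
    \<open>mod\<close> takes care of the coordinates that are 0.\<close>
  let ?y = "(\<lambda>p i. if k = 0 then (H_bnd \<pi> d p i - a p i) mod H_bnd \<pi> d p i else a p i, k, v)"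
  have "?y \<in> carrier (H_group \<pi> d)"
    using b H_bnd_pos by (simp add: H_group_def H_carrier_iff)
  moreover have "?y \<otimes>\<^bsub>H_group \<pi> d\<^esub> x = \<one>\<^bsub>H_group \<pi> d\<^esub>"
  proof -
    have "(v i + v i) mod H_vbnd d i = 0" for i by (simp add: H_vbnd_def mod_0_imp_dvd)
    moreover have "(k + k) mod 2 = 0" by simp
    moreover have "(((H_bnd \<pi> d p i - a p i) mod H_bnd \<pi> d p i) + a p i) mod H_bnd \<pi> d p i = 0" for p i
      using b(1)[of p i] by (simp add: mod_add_left_eq)
    ultimately show ?thesis
      using b(1) by (cases "k = 0") (simp_all add: x' H_group_def H_mult_simp less_imp_le)
  qed
  ultimately show "\<exists>y\<in>carrier (H_group \<pi> d). y \<otimes>\<^bsub>H_group \<pi> d\<^esub> x = \<one>\<^bsub>H_group \<pi> d\<^esub>" by blast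
qed

section \<open>The order of \<open>H\<close>\<close>

text \<open>A bound of 1 forces the value 0, so these functions are determined on \<open>I\<close>:
  padding by zeros takes the place of the \<open>undefined\<close> values in
  \<open>PiE\<close>.\<close>

lemma bounded_functions:
  fixes b :: "'c \<Rightarrow> nat"
  assumes fin: "finite I" and b: "\<And>x. x \<notin> I \<Longrightarrow> b x = 1"
  shows "finite {f. \<forall>x. f x < b x}" "card {f. \<forall>x. f x < b x} = (\<Prod>x\<in>I. b x)"
proof -
  have bij: "bij_betw (\<lambda>f. restrict f I) {f. \<forall>x. f x < b x} (\<Pi>\<^sub>E x\<in>I. {0..<b x})"
  proof (rule bij_betwI[where g = "\<lambda>g x. if x \<in> I then g x else 0"])
    show "(\<lambda>f. restrict f I) \<in> {f. \<forall>x. f x < b x} \<rightarrow> (\<Pi>\<^sub>E x\<in>I. {0..<b x})" by auto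
    show "(\<lambda>g x. if x \<in> I then g x else 0) \<in> (\<Pi>\<^sub>E x\<in>I. {0..<b x}) \<rightarrow> {f. \<forall>x. f x < b x}"
      using b by (auto simp: PiE_iff)
    show "(\<lambda>x. if x \<in> I then restrict f I x else 0) = f" if "f \<in> {f. \<forall>x. f x < b x}" for f
    proof
      fix x show "(if x \<in> I then restrict f I x else 0) = f x"
        using that b[of x] by (cases "x \<in> I") (auto dest: spec[of _ x])
    qed
    show "restrict (\<lambda>x. if x \<in> I then g x else 0) I = g" if "g \<in> (\<Pi>\<^sub>E x\<in>I. {0..<b x})" for g
      using that by (intro extensionalityI[of _ I]) (auto simp: PiE_iff)
  qed
  have "finite (\<Pi>\<^sub>E x\<in>I. {0..<b x})" using fin by (intro finite_PiE) auto
  then show "finite {f. \<forall>x. f x < b x}" using bij_betw_finite[OF bij] by simp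
  show "card {f. \<forall>x. f x < b x} = (\<Prod>x\<in>I. b x)"
    using bij_betw_same_card[OF bij] fin by (simp add: card_PiE)
qed

lemma H_carrier_card:
  assumes fin: "finite \<pi>" and d: "d > 0"
  defines "\<rho> \<equiv> {p \<in> \<pi>. Factorial_Ring.prime p \<and> p \<noteq> 2}"
  shows "finite (carrier (H_group \<pi> d))" "order (H_group \<pi> d) = 2 ^ d * (\<Prod>p\<in>\<rho>. p ^ d)"
proof -
  \<comment> \<open>The component \<open>a\<close> is uncurried to a function of pairs, so that one
    product over \<open>\<rho> \<times> {0..<d}\<close> counts it.\<close>
  let ?F = "{f :: nat \<times> nat \<Rightarrow> nat. \<forall>x. f x < case_prod (H_bnd \<pi> d) x}"
  let ?V = "{v. \<forall>i. v i < H_vbnd d i}"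
  have finr: "finite (\<rho> \<times> {0..<d})" using fin by (simp add: \<rho>_def)
  have "case_prod (H_bnd \<pi> d) x = 1" if "x \<notin> \<rho> \<times> {0..<d}" for x
    using that by (cases x) (auto simp: \<rho>_def H_bnd_def)
  note F = bounded_functions[of "\<rho> \<times> {0..<d}" "case_prod (H_bnd \<pi> d)", OF finr this]
  have "H_vbnd d i = 1" if "i \<notin> {0..<d - 1}" for i using that by (simp add: H_vbnd_def)
  note V = bounded_functions[of "{0..<d - 1}" "H_vbnd d", OF finite_atLeastLessThan this]
  have inj: "inj_on curry ?F" by (rule inj_on_inverseI[of _ case_prod]) simp
  have car: "carrier (H_group \<pi> d) = (curry ` ?F) \<times> ({0..<2} \<times> ?V)"
  proof -
    have F_iff: "(\<forall>p i. a p i < H_bnd \<pi> d p i) \<longleftrightarrow> a \<in> curry ` ?F" for a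
    proof
      assume a: "\<forall>p i. a p i < H_bnd \<pi> d p i"
      have "a = curry (case_prod a)" by simp
      moreover have "case_prod a \<in> ?F" using a by auto
      ultimately show "a \<in> curry ` ?F" by blast
    next
      assume "a \<in> curry ` ?F"
      then obtain f where f: "a = curry f" "\<forall>x. f x < case_prod (H_bnd \<pi> d) x" by blast
      show "\<forall>p i. a p i < H_bnd \<pi> d p i"
      proof (intro allI)
        fix p i show "a p i < H_bnd \<pi> d p i" using spec[OF f(2), of "(p, i)"] f(1) by simp
      qed
    qed
    show ?thesis
    proof (rule Set.set_eqI)
      fix x :: h_elem
      obtain a k v where x: "x = (a, k, v)" by (cases x)
      show "x \<in> carrier (H_group \<pi> d) \<longleftrightarrow> x \<in> (curry ` ?F) \<times> ({0..<2} \<times> ?V)"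
        unfolding x H_group_def partial_object.simps H_carrier_iff F_iff by simp
    qed
  qed
  show "finite (carrier (H_group \<pi> d))" unfolding car using F(1) V(1) by simp
  have "order (H_group \<pi> d) = card ?F * (2 * card ?V)"
    unfolding order_def car card_cartesian_product card_image[OF inj] by simp
  also have "card ?F = (\<Prod>p\<in>\<rho>. \<Prod>i\<in>{0..<d}. H_bnd \<pi> d p i)"
  proof -
    have "card ?F = (\<Prod>x\<in>\<rho> \<times> {0..<d}. case_prod (H_bnd \<pi> d) x)" by (rule F(2))
    then show ?thesis by (simp only: prod.cartesian_product)
  qed
  also have "\<dots> = (\<Prod>p\<in>\<rho>. p ^ d)" by (intro prod.cong) (auto simp: \<rho>_def H_bnd_def)
  also have "card ?V = 2 ^ (d - 1)"
  proof -
    have "card ?V = (\<Prod>i\<in>{0..<d - 1}. H_vbnd d i)" by (rule V(2))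
    also have "\<dots> = (\<Prod>i\<in>{0..<d - 1}. 2)" by (intro prod.cong) (simp_all add: H_vbnd_def)
    finally show ?thesis by simp
  qed
  also have "2 * 2 ^ (d - 1) = (2::nat) ^ d" using d by (cases d) auto
  finally show "order (H_group \<pi> d) = 2 ^ d * (\<Prod>p\<in>\<rho>. p ^ d)" by simp
qed

section \<open>Coordinate matrices of generating tuples of \<open>H\<close>\<close>

definition row_mod2 :: "nat \<Rightarrow> nat \<Rightarrow> (nat \<Rightarrow> h_elem) \<Rightarrow> nat \<Rightarrow> nat \<Rightarrow> nat" where
  "row_mod2 n d f = (\<lambda>i\<in>{0..<d}. \<lambda>j\<in>{0..<n}. case f j of (a, k, v) \<Rightarrow> if i = 0 then k else v (i - 1))"

text \<open>The exponent \<open>k\<close> of \<open>y\<close> is repeated as the first row, read as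
  residues modulo \<open>p\<close>. A tuple of \<open>H\<close> whose \<open>a\<close>-rows depend
  on each other only together with this row does not generate either, and it is this extra row that
  raises the exponents at odd primes by one.\<close>

definition row_modp :: "nat \<Rightarrow> nat \<Rightarrow> nat \<Rightarrow> (nat \<Rightarrow> h_elem) \<Rightarrow> nat \<Rightarrow> nat \<Rightarrow> nat" where
  "row_modp p n d f = (\<lambda>i\<in>{0..<Suc d}. \<lambda>j\<in>{0..<n}. case f j of (a, k, v) \<Rightarrow> if i = 0 then k else a p (i - 1))"

lemma row_mod2_indep:
  assumes d: "d > 0" and f: "f \<in> generating_tuples (H_group \<pi> d) n"
  shows "lin_indep 2 n d (row_mod2 n d f)"
proof -
  interpret group "H_group \<pi> d" by (rule group_H_group)
  define co :: "h_elem \<Rightarrow> nat \<Rightarrow> nat" where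
    "co x i = (case x of (a, k, v) \<Rightarrow> if i = 0 then k else v (i - 1))" for x i
  have "lin_indep 2 n d (\<lambda>i\<in>{0..<d}. \<lambda>j\<in>{0..<n}. co (f j) i)"
  proof (rule generating_tuple_coordinates_indep[OF f, where \<sigma> = "\<lambda>_. 1"])
    fix x y :: h_elem and i assume "i < d"
    obtain a k v where x: "x = (a, k, v)" by (cases x)
    obtain a' k' v' where y: "y = (a', k', v')" by (cases y)
    show "[int (co (x \<otimes>\<^bsub>H_group \<pi> d\<^esub> y) i) = int (co x i) + 1 * int (co y i)] (mod int 2)"
    proof (cases "i = 0")
      case True
      then show ?thesis by (simp add: x y co_def H_group_def H_mult_simp cong_def zmod_int)
    next
      case False
      then have "H_vbnd d (i - 1) = 2" using \<open>i < d\<close> by (simp add: H_vbnd_def)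
      then show ?thesis using False by (simp add: x y co_def H_group_def H_mult_simp cong_def zmod_int)
    qed
  next
    fix i assume i: "i < d"
    let ?x = "(\<lambda>p i. 0, if i = 0 then 1 else 0, \<lambda>j. if Suc j = i then 1 else 0)
       :: h_elem"
    have "?x \<in> carrier (H_group \<pi> d)"
      using i by (auto simp: H_group_def H_carrier_iff H_bnd_pos H_vbnd_def)
    moreover have "\<forall>j<d. co ?x j = (if j = i then 1 else 0)" by (auto simp: co_def)
    ultimately show "\<exists>x\<in>carrier (H_group \<pi> d). \<forall>j<d. co x j = (if j = i then 1 else 0)" by blast
  qed simp
  then show ?thesis by (simp add: row_mod2_def co_def)
qed

lemma row_modp_indep:
  assumes f: "f \<in> generating_tuples (H_group \<pi> d) n"
    and p: "p \<in> \<pi>" "Factorial_Ring.prime p" "p \<noteq> 2"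
  shows "lin_indep p n (Suc d) (row_modp p n d f)"
proof -
  interpret group "H_group \<pi> d" by (rule group_H_group)
  define co :: "h_elem \<Rightarrow> nat \<Rightarrow> nat" where
    "co x i = (case x of (a, k, v) \<Rightarrow> if i = 0 then k else a p (i - 1))" for x i
  have bnd: "H_bnd \<pi> d p i = p" if "i < d" for i using p that by (simp add: H_bnd_def)
  have "lin_indep p n (Suc d) (\<lambda>i\<in>{0..<Suc d}. \<lambda>j\<in>{0..<n}. co (f j) i)"
  proof (rule generating_tuple_coordinates_indep[OF f, where \<sigma> = "\<lambda>x. H_sign (fst (snd x))"])
    fix x y :: h_elem and i assume xc: "x \<in> carrier (H_group \<pi> d)" and yc: "y \<in> carrier (H_group \<pi> d)" and i: "i < Suc d"
    obtain a k v where x: "x = (a, k, v)" by (cases x)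
    obtain a' k' v' where y: "y = (a', k', v')" by (cases y)
    show "[int (co (x \<otimes>\<^bsub>H_group \<pi> d\<^esub> y) i) = int (co x i) + H_sign (fst (snd x)) * int (co y i)] (mod int p)"
    proof (cases i)
      case 0
      \<comment> \<open>For 0/1 values, addition modulo 2 is the exact integer identity
        \<open>k + H_sign k * k'\<close>. So the exponent of \<open>y\<close> obeys the same crossed
        rule as the coordinates of \<open>a\<close>, modulo any \<open>p\<close>.\<close>
      have "k < 2" "k' < 2" using xc yc by (simp_all add: x y H_group_def H_carrier_iff)
      then have "int ((k + k') mod 2) = int k + H_sign k * int k'"
        by (auto simp: less_2_cases_iff H_sign_def)
      then show ?thesis using 0 by (simp add: x y co_def H_group_def H_mult_simp)
    next
      case (Suc l)
      then have b: "H_bnd \<pi> d p l = p" using i bnd by simp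
      have "a' p l < H_bnd \<pi> d p l" using yc by (simp add: y H_group_def H_carrier_iff)
      then have "a' p l < p" using b by simp
      then have "int ((a p l + (if k = 0 then a' p l else p - a' p l)) mod p) =
        (int (a p l) + H_sign k * int (a' p l)) mod int p"
        by (intro H_component_int) simp
      moreover have "co (x \<otimes>\<^bsub>H_group \<pi> d\<^esub> y) i = (a p l + (if k = 0 then a' p l else p - a' p l)) mod p"
        using Suc b by (simp add: x y co_def H_group_def H_mult_simp)
      moreover have "co x i = a p l" "co y i = a' p l" "fst (snd x) = k"
        using Suc by (simp_all add: x y co_def)
      ultimately show ?thesis by (simp only: cong_def mod_mod_trivial)
    qed
  next
    fix i assume i: "i < Suc d"
    let ?x = "(\<lambda>r j. if r = p \<and> Suc j = i then 1 else 0, if i = 0 then 1 else 0, \<lambda>j. 0)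
       :: h_elem"
    have "?x \<in> carrier (H_group \<pi> d)"
      using i bnd prime_gt_1_nat[OF p(2)] by (auto simp: H_group_def H_carrier_iff H_bnd_pos H_vbnd_pos)
    moreover have "\<forall>j<Suc d. co ?x j = (if j = i then 1 else 0)" by (auto simp: co_def)
    ultimately show "\<exists>x\<in>carrier (H_group \<pi> d). \<forall>j<Suc d. co x j = (if j = i then 1 else 0)" by blast
  qed (simp add: H_sign_def)
  then show ?thesis by (simp add: row_modp_def co_def)
qed

lemma H_tuple_entries:
  assumes f: "f \<in> generating_tuples (H_group \<pi> d) n" and j: "j < n"
  obtains a k v where "f j = (a, k, v)" "\<And>p i. a p i < H_bnd \<pi> d p i" "k < 2" "\<And>i. v i < H_vbnd d i"
proof -
  obtain a k v where fj: "f j = (a, k, v)" by (cases "f j")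
  have "f \<in> {0..<n} \<rightarrow>\<^sub>E carrier (H_group \<pi> d)" using f by (simp add: generating_tuples_def)
  then have "f j \<in> carrier (H_group \<pi> d)" by (rule PiE_mem) (use j in simp)
  then show thesis using that[OF fj] fj by (simp add: H_group_def H_carrier_iff)
qed

lemma row_mod2_vectors:
  assumes f: "f \<in> generating_tuples (H_group \<pi> d) n"
  shows "row_mod2 n d f \<in> {0..<d} \<rightarrow>\<^sub>E vectors 2 n"
proof (rule PiE_I)
  fix i assume i: "i \<in> {0..<d}"
  have "(case f j of (a, k, v) \<Rightarrow> if i = 0 then k else v (i - 1)) < 2" if "j < n" for j
  proof (rule H_tuple_entries[OF f that])
    fix a k v assume *: "f j = (a, k, v)" "k < 2" "\<And>i. v i < H_vbnd d i"
    have "v (i - 1) < 2" using *(3)[of "i - 1"] by (simp add: H_vbnd_def split: if_splits)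
    then show ?thesis using * by simp
  qed
  then show "row_mod2 n d f i \<in> vectors 2 n" using i by (simp add: row_mod2_def vectors_def PiE_iff)
qed (simp add: row_mod2_def)

lemma row_modp_vectors:
  assumes f: "f \<in> generating_tuples (H_group \<pi> d) n"
    and p: "p \<in> \<pi>" "Factorial_Ring.prime p" "p \<noteq> 2"
  shows "row_modp p n d f \<in> {0..<Suc d} \<rightarrow>\<^sub>E vectors p n"
proof (rule PiE_I)
  fix i assume i: "i \<in> {0..<Suc d}"
  have "(case f j of (a, k, v) \<Rightarrow> if i = 0 then k else a p (i - 1)) < p" if "j < n" for j
  proof (rule H_tuple_entries[OF f that])
    fix a k v assume *: "f j = (a, k, v)" "k < 2" "\<And>p i. a p i < H_bnd \<pi> d p i"
    have "a p (i - 1) < p" if "i \<noteq> 0"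
    proof -
      have "i - 1 < d" using i that by auto
      then show ?thesis using *(3)[of p "i - 1"] p by (simp add: H_bnd_def)
    qed
    then show ?thesis using * prime_ge_2_nat[OF p(2)] by simp
  qed
  then show "row_modp p n d f i \<in> vectors p n" using i by (simp add: row_modp_def vectors_def PiE_iff)
qed (simp add: row_modp_def)

lemma rows_determine_tuple:
  assumes d: "d > 0" and f: "f \<in> generating_tuples (H_group \<pi> d) n" and g: "g \<in> generating_tuples (H_group \<pi> d) n"
    and row2: "row_mod2 n d f = row_mod2 n d g"
    and rowp: "\<And>p. \<lbrakk>p \<in> \<pi>; Factorial_Ring.prime p; p \<noteq> 2\<rbrakk> \<Longrightarrow> row_modp p n d f = row_modp p n d g"
  shows "f = g"
proof (rule PiE_ext[of f "{0..<n}" "\<lambda>_. carrier (H_group \<pi> d)" g])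
  show "f \<in> {0..<n} \<rightarrow>\<^sub>E carrier (H_group \<pi> d)" "g \<in> {0..<n} \<rightarrow>\<^sub>E carrier (H_group \<pi> d)"
    using f g by (simp_all add: generating_tuples_def)
  fix j assume "j \<in> {0..<n}"
  then have j: "j < n" by simp
  obtain a k v where fj: "f j = (a, k, v)" and fb: "\<And>p i. a p i < H_bnd \<pi> d p i" "\<And>i. v i < H_vbnd d i"
    using H_tuple_entries[OF f j] by metis
  obtain a' k' v' where gj: "g j = (a', k', v')" and gb: "\<And>p i. a' p i < H_bnd \<pi> d p i" "\<And>i. v' i < H_vbnd d i"
    using H_tuple_entries[OF g j] by metis
  have r2: "row_mod2 n d f i j = row_mod2 n d g i j" for i using row2 by simp
  have k: "k = k'" using r2[of 0] d j by (simp add: row_mod2_def fj gj)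
  have v: "v = v'"
  proof
    fix i show "v i = v' i"
    proof (cases "i < d - 1")
      case True
      then have "Suc i < d" by simp
      then show ?thesis using r2[of "Suc i"] j by (simp add: row_mod2_def fj gj)
    next
      case False
      then show ?thesis using fb(2)[of i] gb(2)[of i] by (simp add: H_vbnd_def)
    qed
  qed
  have a: "a = a'"
  proof (intro ext)
    fix p i show "a p i = a' p i"
    proof (cases "Factorial_Ring.prime p \<and> p \<in> \<pi> \<and> p \<noteq> 2 \<and> i < d")
      case True
      then have "row_modp p n d f (Suc i) j = row_modp p n d g (Suc i) j" using rowp by simp
      then show ?thesis using True j by (simp add: row_modp_def fj gj)
    next
      case False
      then have "H_bnd \<pi> d p i = 1" unfolding H_bnd_def by (rule if_not_P)
      then show ?thesis using fb(1)[of p i] gb(1)[of p i] by simp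
    qed
  qed
  show "f j = g j" by (simp add: fj gj a k v)
qed

text \<open>The matrix modulo 2 is chosen first. Its first row prescribes the first row modulo every
  odd prime, whereas the other rows are bounded separately for each prime; hence the dependent sum
  over \<open>W\<close>, whose fibres use only \<open>W 0\<close>.\<close>

lemma card_generating_tuples_H_le:
  assumes fin: "finite \<pi>" and d: "d > 0"
  defines "\<rho> \<equiv> {p \<in> \<pi>. Factorial_Ring.prime p \<and> p \<noteq> 2}"
  shows "card (generating_tuples (H_group \<pi> d) n) \<le>
    (\<Prod>i<d. 2 ^ n - 2 ^ i) * (\<Prod>p\<in>\<rho>. \<Prod>i<d. p ^ n - p ^ (i + 1))"
proof -
  let ?I2 = "indep_families 2 n d (vectors 2 n)"
  let ?Ip = "\<lambda>W. \<Pi>\<^sub>E p\<in>\<rho>. indep_families p n (Suc d) {W 0}"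
  have finr: "finite \<rho>" using fin by (simp add: \<rho>_def)
  have rho: "p \<in> \<pi>" "Factorial_Ring.prime p" "p \<noteq> 2" "p > 1" if "p \<in> \<rho>" for p
    using that prime_gt_1_nat[of p] unfolding \<rho>_def by blast+
  have finIp: "finite (?Ip W)" for W using finr by (intro finite_PiE) auto
  have "card (generating_tuples (H_group \<pi> d) n) \<le> card (SIGMA W : ?I2. ?Ip W)"
  proof (rule card_inj_on_le)
    let ?F = "\<lambda>f. (row_mod2 n d f, \<lambda>p\<in>\<rho>. row_modp p n d f)"
    show "inj_on ?F (generating_tuples (H_group \<pi> d) n)"
    proof (rule inj_onI)
      fix f g assume fg: "f \<in> generating_tuples (H_group \<pi> d) n" "g \<in> generating_tuples (H_group \<pi> d) n"
        and eq: "?F f = ?F g"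
      have eq2: "(\<lambda>p\<in>\<rho>. row_modp p n d f) = (\<lambda>p\<in>\<rho>. row_modp p n d g)" using eq by blast
      show "f = g"
      proof (rule rows_determine_tuple[OF d fg])
        show "row_mod2 n d f = row_mod2 n d g" using eq by blast
        show "row_modp p n d f = row_modp p n d g" if "p \<in> \<pi>" "Factorial_Ring.prime p" "p \<noteq> 2" for p
          using fun_cong[OF eq2, of p] that by (simp add: \<rho>_def)
      qed
    qed
    show "?F ` generating_tuples (H_group \<pi> d) n \<subseteq> (SIGMA W : ?I2. ?Ip W)"
    proof
      fix z assume "z \<in> ?F ` generating_tuples (H_group \<pi> d) n"
      then obtain f where f: "f \<in> generating_tuples (H_group \<pi> d) n" and z: "z = ?F f" by blast
      have v2: "row_mod2 n d f \<in> {0..<d} \<rightarrow>\<^sub>E vectors 2 n" by (rule row_mod2_vectors[OF f])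
      have "row_mod2 n d f 0 \<in> vectors 2 n" using v2 by (rule PiE_mem) (use d in simp)
      then have 1: "row_mod2 n d f \<in> ?I2"
        using v2 row_mod2_indep[OF d f] by (simp add: indep_families_def)
      have "row_modp p n d f 0 = row_mod2 n d f 0" for p
        using d by (simp add: row_modp_def row_mod2_def)
      then have "row_modp p n d f \<in> indep_families p n (Suc d) {row_mod2 n d f 0}" if "p \<in> \<rho>" for p
        using row_modp_vectors[OF f rho(1-3)[OF that]] row_modp_indep[OF f rho(1-3)[OF that]]
        by (simp add: indep_families_def)
      then have "(\<lambda>p\<in>\<rho>. row_modp p n d f) \<in> ?Ip (row_mod2 n d f)" by (simp add: PiE_iff)
      then show "z \<in> (SIGMA W : ?I2. ?Ip W)" using 1 z by blast
    qed
    show "finite (SIGMA W : ?I2. ?Ip W)" by (intro finite_SigmaI finIp) simp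
  qed
  also have "\<dots> = (\<Sum>W\<in>?I2. card (?Ip W))" by (intro card_SigmaI ballI finIp) simp
  also have "\<dots> \<le> (\<Sum>W\<in>?I2. \<Prod>p\<in>\<rho>. \<Prod>i<d. p ^ n - p ^ (i + 1))"
  proof (rule sum_mono)
    fix W assume "W \<in> ?I2"
    then have W: "W 0 \<in> vectors 2 n" by (simp add: indep_families_def)
    have "card (indep_families p n (Suc d) {W 0}) \<le> (\<Prod>i<d. p ^ n - p ^ (i + 1))" if p: "p \<in> \<rho>" for p
    proof -
      have "{W 0} \<subseteq> vectors p n"
      proof -
        have "{0..<2} \<subseteq> {0..<p}" using rho(4)[OF p] by auto
        then have "vectors 2 n \<subseteq> vectors p n" unfolding vectors_def by (rule PiE_mono)
        then show ?thesis using W by blast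
      qed
      then have "card (indep_families p n (Suc d) {W 0}) \<le>
        card ({W 0} - {zero_vector n}) * (\<Prod>i=1..d. p ^ n - p ^ i)"
        using rho(4)[OF p] by (intro card_indep_families_le)
      also have "\<dots> \<le> 1 * (\<Prod>i=1..d. p ^ n - p ^ i)"
      proof (rule mult_right_mono)
        have "card ({W 0} - {zero_vector n}) \<le> card {W 0}" by (intro card_mono) auto
        then show "card ({W 0} - {zero_vector n}) \<le> 1" by simp
      qed simp
      also have "\<dots> = (\<Prod>i<d. p ^ n - p ^ (i + 1))" by (simp add: prod.atLeast1_atMost_eq)
      finally show ?thesis .
    qed
    then have "(\<Prod>p\<in>\<rho>. card (indep_families p n (Suc d) {W 0})) \<le> (\<Prod>p\<in>\<rho>. \<Prod>i<d. p ^ n - p ^ (i + 1))"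
      by (intro prod_mono) simp
    then show "card (?Ip W) \<le> (\<Prod>p\<in>\<rho>. \<Prod>i<d. p ^ n - p ^ (i + 1))"
      using finr by (simp only: card_PiE)
  qed
  also have "\<dots> = card ?I2 * (\<Prod>p\<in>\<rho>. \<Prod>i<d. p ^ n - p ^ (i + 1))" by simp
  also have "\<dots> \<le> (\<Prod>i<d. 2 ^ n - 2 ^ i) * (\<Prod>p\<in>\<rho>. \<Prod>i<d. p ^ n - p ^ (i + 1))"
  proof (rule mult_right_mono)
    obtain m where m: "d = Suc m" using d by (cases d) auto
    have "card ?I2 \<le> card (vectors 2 n - {zero_vector n}) * (\<Prod>i=1..m. 2 ^ n - 2 ^ i)"
      unfolding m by (rule card_indep_families_le) simp_all
    also have "card (vectors 2 n - {zero_vector n}) = 2 ^ n - 2 ^ 0"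
    proof -
      have "zero_vector n \<in> vectors 2 n" by (simp add: zero_vector_def vectors_def)
      then show ?thesis by (simp add: card_Diff_singleton)
    qed
    also have "(\<Prod>i=1..m. 2 ^ n - 2 ^ i) = (\<Prod>i<m. 2 ^ n - 2 ^ Suc i :: nat)"
      by (simp add: prod.atLeast1_atMost_eq)
    also have "(2 ^ n - 2 ^ 0) * \<dots> = (\<Prod>i<d. 2 ^ n - 2 ^ i :: nat)"
      unfolding m prod.lessThan_Suc_shift ..
    finally show "card ?I2 \<le> (\<Prod>i<d. 2 ^ n - 2 ^ i)" .
  qed simp
  finally show ?thesis .
qed

text \<open>The bound on \<open>i + e\<close> keeps the subtraction of natural numbers from being
  truncated.\<close>

lemma prod_power_diff_eq:
  assumes p: "p > (0::nat)" and e: "\<And>i. i < d \<Longrightarrow> i + e \<le> n"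
  shows "real (\<Prod>i<d. p ^ n - p ^ (i + e)) = (real p ^ d) ^ n * (\<Prod>i<d. 1 - real p ^ (i + e) / real p ^ n)"
proof -
  have "real (p ^ n - p ^ (i + e)) = real p ^ n * (1 - real p ^ (i + e) / real p ^ n)" if "i < d" for i
  proof -
    have "p ^ (i + e) \<le> p ^ n" using p e[OF that] by (intro power_increasing) auto
    then show ?thesis using p by (simp add: of_nat_diff right_diff_distrib)
  qed
  then have "real (\<Prod>i<d. p ^ n - p ^ (i + e)) = (\<Prod>i<d. real p ^ n * (1 - real p ^ (i + e) / real p ^ n))"
    unfolding of_nat_prod by (intro prod.cong) auto
  also have "\<dots> = (real p ^ n) ^ d * (\<Prod>i<d. 1 - real p ^ (i + e) / real p ^ n)"
    by (simp add: prod.distrib)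
  also have "(real p ^ n) ^ d = (real p ^ d) ^ n" by (simp add: power_mult[symmetric] mult.commute)
  finally show ?thesis .
qed

text \<open>The bound on the number of generating tuples has a zero factor as soon as there are more
  rows than columns: \<open>d\<close> rows modulo 2, \<open>d + 1\<close> rows modulo an odd prime.
  In the remaining range all differences are genuine and can be divided by the powers that make up
  the order of \<open>H\<close>.\<close>

lemma gen_prob_H_group:
  assumes fin: "finite \<pi>" and d: "d > 0"
  defines "\<rho> \<equiv> {p \<in> \<pi>. Factorial_Ring.prime p \<and> p \<noteq> 2}"
  shows "n < d \<or> n = d \<and> \<rho> \<noteq> {} \<Longrightarrow> gen_prob (H_group \<pi> d) n = 0"
    and "d < n \<or> d = n \<and> \<rho> = {} \<Longrightarrow>
      gen_prob (H_group \<pi> d) n \<le> (\<Prod>p\<in>insert 2 \<rho>. prime_factor_bound p d n)"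
proof -
  note le = card_generating_tuples_H_le[OF fin d, of n, folded \<rho>_def]
  have finr: "finite \<rho>" using fin by (simp add: \<rho>_def)
  have rho: "Factorial_Ring.prime p" "p \<noteq> 2" "p > 0" if "p \<in> \<rho>" for p
    using that by (auto simp: \<rho>_def prime_gt_0_nat)
  have ord: "order (H_group \<pi> d) = 2 ^ d * (\<Prod>p\<in>\<rho>. p ^ d)"
    using H_carrier_card(2)[OF fin d] by (simp add: \<rho>_def)
  show "gen_prob (H_group \<pi> d) n = 0" if n: "n < d \<or> n = d \<and> \<rho> \<noteq> {}"
  proof -
    have "(\<Prod>i<d. 2 ^ n - 2 ^ i) * (\<Prod>p\<in>\<rho>. \<Prod>i<d. p ^ n - p ^ (i + 1)) = (0::nat)"
    proof (cases "n < d")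
      case True
      then have "(\<Prod>i<d. 2 ^ n - 2 ^ i) = (0::nat)" by (intro prod_zero) auto
      then show ?thesis by simp
    next
      case False
      then obtain p where p: "p \<in> \<rho>" "n = d" using n by blast
      \<comment> \<open>The last factor, with \<open>i = d - 1\<close>, is
        \<open>p ^ d - p ^ d\<close>.\<close>
      have "(\<Prod>i<d. p ^ n - p ^ (i + 1)) = 0"
        using d p(2) by (intro prod_zero bexI[of _ "d - 1"]) auto
      then have "(\<Prod>p\<in>\<rho>. \<Prod>i<d. p ^ n - p ^ (i + 1)) = 0" using p(1) finr by (intro prod_zero) auto
      then show ?thesis by simp
    qed
    then have "card (generating_tuples (H_group \<pi> d) n) = 0"
      using le by (simp only: le_zero_eq)
    then show ?thesis by (simp add: gen_prob_eq)
  qed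
  assume n: "d < n \<or> d = n \<and> \<rho> = {}"
  let ?R = "\<Prod>p\<in>\<rho>. (real p ^ d) ^ n"
  have "real (\<Prod>i<d. 2 ^ n - 2 ^ (i + 0)) = (real 2 ^ d) ^ n * (\<Prod>i<d. 1 - real 2 ^ (i + 0) / real 2 ^ n)"
    using n by (intro prod_power_diff_eq) auto
  then have e2: "real (\<Prod>i<d. 2 ^ n - 2 ^ i) = (2 ^ d) ^ n * prime_factor_bound 2 d n"
    by (simp add: prime_factor_bound_def)
  have ep: "real (\<Prod>i<d. p ^ n - p ^ (i + 1)) = (real p ^ d) ^ n * prime_factor_bound p d n" if "p \<in> \<rho>" for p
  proof -
    have "real (\<Prod>i<d. p ^ n - p ^ (i + 1)) = (real p ^ d) ^ n * (\<Prod>i<d. 1 - real p ^ (i + 1) / real p ^ n)"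
      using n that rho(3)[OF that] by (intro prod_power_diff_eq) auto
    then show ?thesis using rho(2)[OF that] by (simp only: prime_factor_bound_def if_False)
  qed
  have "real (card (generating_tuples (H_group \<pi> d) n)) \<le>
    real ((\<Prod>i<d. 2 ^ n - 2 ^ i) * (\<Prod>p\<in>\<rho>. \<Prod>i<d. p ^ n - p ^ (i + 1)))"
    using le by (simp only: of_nat_le_iff)
  also have "\<dots> = real (\<Prod>i<d. 2 ^ n - 2 ^ i) * (\<Prod>p\<in>\<rho>. real (\<Prod>i<d. p ^ n - p ^ (i + 1)))"
    by (simp only: of_nat_mult of_nat_prod)
  also have "(\<Prod>p\<in>\<rho>. real (\<Prod>i<d. p ^ n - p ^ (i + 1))) = (\<Prod>p\<in>\<rho>. (real p ^ d) ^ n * prime_factor_bound p d n)"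
    using ep by (intro prod.cong) auto
  also have "\<dots> = ?R * (\<Prod>p\<in>\<rho>. prime_factor_bound p d n)" by (rule prod.distrib)
  also have "real (\<Prod>i<d. 2 ^ n - 2 ^ i) * (?R * (\<Prod>p\<in>\<rho>. prime_factor_bound p d n)) =
    ((2 ^ d) ^ n * ?R) * (prime_factor_bound 2 d n * (\<Prod>p\<in>\<rho>. prime_factor_bound p d n))"
    unfolding e2 by (simp only: mult_ac)
  also have "prime_factor_bound 2 d n * (\<Prod>p\<in>\<rho>. prime_factor_bound p d n) =
    (\<Prod>p\<in>insert 2 \<rho>. prime_factor_bound p d n)"
    using finr by (subst prod.insert) (auto simp: \<rho>_def)
  also have "(2 ^ d) ^ n * ?R = real (order (H_group \<pi> d)) ^ n"
    unfolding ord by (simp add: power_mult_distrib prod_power_distrib)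
  finally have *: "real (card (generating_tuples (H_group \<pi> d) n)) \<le>
    real (order (H_group \<pi> d)) ^ n * (\<Prod>p\<in>insert 2 \<rho>. prime_factor_bound p d n)" .
  have "real (order (H_group \<pi> d)) ^ n > 0" unfolding ord using rho(3) by (simp add: prod_pos)
  then show "gen_prob (H_group \<pi> d) n \<le> (\<Prod>p\<in>insert 2 \<rho>. prime_factor_bound p d n)"
    using * by (simp add: gen_prob_eq divide_le_eq mult.commute)
qed

section \<open>Comparison of \<open>G\<close> with \<open>H\<close>\<close>

lemma (in group) ex_sylow_subgroup:
  assumes "finite (carrier G)" "Factorial_Ring.prime p"
  shows "\<exists>P. sylow_subgroup G p P"
proof -
  obtain m where "order G = p ^ multiplicity p (order G) * m"
    using multiplicity_dvd[of p "order G"] by blast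
  then show ?thesis
    using sylow_thm[OF assms(2) is_group _ assms(1)] assms(2) by (auto simp: sylow_subgroup_def)
qed

theorem theorem5:
  fixes G :: "('a, 'b) monoid_scheme" and d :: nat
  assumes "group G" and "finite (carrier G)" and "solvable G" and "d > 0"
    and "\<And>p P. sylow_subgroup G p P \<Longrightarrow> d_generated G d P"
  shows "exp_gen G \<le> exp_gen (H_group ({p. Factorial_Ring.prime p \<and> p dvd order G} \<union> {2}) d)"
proof -
  interpret group G by fact
  define \<pi> where "\<pi> = {p. Factorial_Ring.prime p \<and> p dvd order G} \<union> {2}"
  define \<rho> where "\<rho> = {p \<in> \<pi>. Factorial_Ring.prime p \<and> p \<noteq> 2}"
  let ?H = "H_group \<pi> d"
  have o: "order G > 0" using assms(2) order_gt_0_iff_finite by simp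
  have fin: "finite \<pi>"
  proof -
    have "{p. Factorial_Ring.prime p \<and> p dvd order G} \<subseteq> {..order G}" using o by (auto dest: dvd_imp_le)
    then show ?thesis unfolding \<pi>_def using finite_subset by blast
  qed
  have primes: "Factorial_Ring.prime p" if "p \<in> \<pi>" for p
    using that two_is_prime_nat by (auto simp: \<pi>_def)
  have pi_eq: "insert 2 \<rho> = \<pi>" using primes by (auto simp: \<rho>_def \<pi>_def)
  note H = gen_prob_H_group[OF fin \<open>d > 0\<close>, folded \<rho>_def]
  \<comment> \<open>In the first case \<open>H\<close> is not generated by any \<open>n\<close>
    elements. Otherwise \<open>d < n\<close>, or \<open>n = d\<close> and
    \<open>\<pi> = {2}\<close>, which is the exceptional clause of \<open>sylow_rank_data\<close>;
    the ranks start with the constant value \<open>d\<close>, also at 2 when \<open>G\<close> has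
    odd order and the Sylow 2-subgroup is trivial.\<close>
  have le: "gen_prob ?H n \<le> gen_prob G n" for n
  proof (cases "n < d \<or> n = d \<and> \<rho> \<noteq> {}")
    case True
    then show ?thesis using H(1)[of n] gen_prob_nonneg[of G n] by simp
  next
    case False
    then have n: "d < n \<or> d = n \<and> \<rho> = {}" by linarith
    have "sylow_rank_data G \<pi> (\<lambda>_. d) n"
      unfolding sylow_rank_data_def
    proof (intro conjI allI impI ballI)
      show "p \<in> \<pi>" if "Factorial_Ring.prime p \<and> p dvd order G" for p using that by (simp add: \<pi>_def)
      show "\<exists>P. sylow_subgroup G p P \<and> d_generated G d P" if "p \<in> \<pi>" for p
        using ex_sylow_subgroup[OF assms(2) primes[OF that]] assms(5) by blast
      show "d \<le> n" using n by auto
      show "(\<forall>p\<in>\<pi>. d < n) \<or> \<pi> = {2}" using n pi_eq by auto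
    qed (use assms in auto)
    from gen_prob_lower_bound[OF fin primes this]
    have "(\<Prod>p\<in>\<pi>. prime_factor_bound p d n) \<le> gen_prob G n" by simp
    then show ?thesis using H(2)[OF n] unfolding pi_eq by (rule order_trans[rotated])
  qed
  have "exp_gen G \<le> exp_gen ?H"
    unfolding exp_gen_def
  proof (rule suminf_le)
    show "1 - gen_prob G n \<le> 1 - gen_prob ?H n" for n using le[of n] by simp
    show "summable (\<lambda>n. 1 - gen_prob G n)" by (rule summable_one_minus_gen_prob[OF assms(1,2)])
    show "summable (\<lambda>n. 1 - gen_prob ?H n)"
      by (rule summable_one_minus_gen_prob[OF group_H_group H_carrier_card(1)[OF fin \<open>d > 0\<close>]])
  qed
  then show ?thesis by (simp only: \<pi>_def)
qed

end
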